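(* Let $\mu=\mu^{(N)}$ be either (Case 1) the joint distribution of the ordered eigenvalues $\lambda_1\le\ldots\le\lambda_N$ of the Wigner matrix $\Xi$, or (Case 2) the $\beta$-ensemble distribution, both as defined in the context. Let $f\colon\mathbb{R}\to\mathbb{R}$ be a $\mathcal{C}^2$-smooth function with $f'(\lambda_j)\in L^1(\mu)$ for all $j$ and with second derivative bounded in absolute value by some constant $\gamma>0$. Let $$S_N=\sum_{j=1}^N\big(f(\lambda_j)-\mu[f(\lambda_j)]\big),\qquad \tilde S_N := S_N-\sum_{j=1}^N(\lambda_j-\mu[\lambda_j])\,\mu[f'(\lambda_j)].$$ Then $$\int\exp\big(cN^{1/2}|\tilde S_N|\big)\,d\mu\le 2,$$ where $c=c(\gamma)>0$ is a constant (not depending on $N$) which in Case 1 moreover depends on the Sobolev constant $\sigma^2$, and in Case 2 (with $\beta$ fixed) also depends on the quantity $a$.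
   Context: $\mu[\cdot]$ denotes integration with respect to $\mu$, and $\lambda=(\lambda_1,\ldots,\lambda_N)\in\mathbb{R}^N$. Case 1 (Wigner matrices): $\{\xi_{jk}:1\le j\le k\le N\}$ are independent real random variables whose distributions all satisfy a logarithmic Sobolev inequality with common constant $\sigma^2$, i.e. each such law $\nu$ satisfies $\mathrm{Ent}_\nu(u^2)\le2\sigma^2\int|u'|^2d\nu$ for all locally Lipschitz $u\colon\mathbb{R}\to\mathbb{R}$, where $\mathrm{Ent}_\nu(u^2)=\int u^2\log u^2d\nu-\int u^2d\nu\log\int u^2d\nu$. Put $\xi_{jk}=\xi_{kj}$ for $1\le k<j\le N$ and $\Xi=(\xi_{jk}/\sqrt N)_{1\le j,k\le N}$; $\mu$ is the joint law on $\mathbb{R}^N$ of the ordered eigenvalues of $\Xi$. Case 2 ($\beta$-ensembles): $\beta>0$ is fixed and $\mu$ is the probability measure on $\mathbb{R}^N$ supported on $\{\lambda_1<\ldots<\lambda_N\}$ with density $$\mu(d\lambda)=\frac1{Z_N}e^{-\beta N\mathcal{H}(\lambda)}d\lambda,\qquad \mathcal{H}(\lambda)=\frac12\sum_{k=1}^NV(\lambda_k)-\frac1N\sum_{1\le k<l\le N}\log(\lambda_l-\lambda_k),$$ where $V\colon\mathbb{R}\to\mathbb{R}$ is strictly convex and $\mathcal{C}^2$-smooth, $Z_N$ is a normalization constant, and $a>0$ is a constant with $\mathcal{H}''(\lambda)\ge a\,\mathrm{Id}$ uniformly in $\lambda$ (Hessian, in the sense of symmetric matrices). *)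

theory Defs
  imports "HOL-Probability.Probability" "Jordan_Normal_Form.Char_Poly"
begin

text \<open>
  Points of \<open>\<real>\<^sup>N\<close> are functions \<open>nat \<Rightarrow> real\<close> in the product space over the index
  set \<open>{1..N}\<close>, so that \<open>N\<close> can be quantified over inside a statement.
\<close>

definition C2 :: "(real \<Rightarrow> real) \<Rightarrow> bool" where
  "C2 f \<longleftrightarrow> f C1_differentiable_on UNIV \<and> deriv f C1_differentiable_on UNIV"

definition strictly_convex :: "(real \<Rightarrow> real) \<Rightarrow> bool" where
  "strictly_convex V \<longleftrightarrow>
     (\<forall>x y t. x \<noteq> y \<longrightarrow> 0 < t \<longrightarrow> t < 1 \<longrightarrow>
        V ((1 - t) * x + t * y) < (1 - t) * V x + t * V y)"

definition locally_lipschitz :: "(real \<Rightarrow> real) \<Rightarrow> bool" where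
  "locally_lipschitz u \<longleftrightarrow> (\<forall>x. \<exists>r>0. \<exists>L. L-lipschitz_on (cball x r) u)"

text \<open>
  A locally Lipschitz function need not be differentiable \<open>\<nu>\<close>-almost everywhere (\<open>\<nu>\<close> may have a
  singular part). As usual for logarithmic Sobolev inequalities, \<open>|u'(x)|\<close> is read as
  \<open>limsup |u(y) - u(x)| / |y - x|\<close> for \<open>y \<rightarrow> x\<close>, which is \<open>|u'(x)|\<close> wherever \<open>u\<close> is differentiable.
\<close>

definition abs_deriv :: "(real \<Rightarrow> real) \<Rightarrow> real \<Rightarrow> ennreal" where
  "abs_deriv u x = Limsup (at x) (\<lambda>y. ennreal (\<bar>u y - u x\<bar> / \<bar>y - x\<bar>))"

definition entropy_functional :: "real measure \<Rightarrow> (real \<Rightarrow> real) \<Rightarrow> real" where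
  "entropy_functional \<nu> g =
     (\<integral>x. g x * ln (g x) \<partial>\<nu>) - (\<integral>x. g x \<partial>\<nu>) * ln (\<integral>x. g x \<partial>\<nu>)"

text \<open>
  The inequality is imposed whenever the two integrals defining the entropy converge (\<open>0 log 0 = 0\<close>
  holds because \<open>ln 0 = 0\<close>); its right-hand side may be infinite.
\<close>

definition log_sobolev :: "real measure \<Rightarrow> real \<Rightarrow> bool" where
  "log_sobolev \<nu> s \<longleftrightarrow>
     (\<forall>u. locally_lipschitz u \<longrightarrow>
          integrable \<nu> (\<lambda>x. (u x)\<^sup>2) \<longrightarrow>
          integrable \<nu> (\<lambda>x. (u x)\<^sup>2 * ln ((u x)\<^sup>2)) \<longrightarrow>
          ennreal (entropy_functional \<nu> (\<lambda>x. (u x)\<^sup>2))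
            \<le> ennreal (2 * s) * (\<integral>\<^sup>+x. (abs_deriv u x)\<^sup>2 \<partial>\<nu>))"

definition upper_indices :: "nat \<Rightarrow> (nat \<times> nat) set" where
  "upper_indices N = {(j, k). 1 \<le> j \<and> j \<le> k \<and> k \<le> N}"

text \<open>
  Matrix entries are indexed from \<open>0\<close> in \<open>mat\<close>, but from \<open>1\<close> in \<open>\<xi>\<close>. Only \<open>\<xi> j k\<close> with \<open>j \<le> k\<close> is used,
  the lower triangle being filled in by symmetry.
\<close>

definition wigner_matrix :: "nat \<Rightarrow> (nat \<Rightarrow> nat \<Rightarrow> real) \<Rightarrow> real mat" where
  "wigner_matrix N \<xi> =
     mat N N (\<lambda>(j, k). \<xi> (min (Suc j) (Suc k)) (max (Suc j) (Suc k)) / sqrt (real N))"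

text \<open>
  The \<open>j\<close>-th smallest eigenvalue (\<open>j = 1, \<dots>, N\<close>), counted with multiplicity; a real symmetric \<open>N \<times> N\<close>
  matrix has \<open>N\<close> real eigenvalues, so the list below has length \<open>N\<close>.
\<close>

definition ordered_eigenvalue :: "real mat \<Rightarrow> nat \<Rightarrow> real" where
  "ordered_eigenvalue A j = sorted_list_of_multiset (proots (char_poly A)) ! (j - 1)"

definition wigner_eigenvalue_law ::
  "nat \<Rightarrow> 'w measure \<Rightarrow> (nat \<Rightarrow> nat \<Rightarrow> 'w \<Rightarrow> real) \<Rightarrow> (nat \<Rightarrow> real) measure" where
  "wigner_eigenvalue_law N M \<xi> =
     distr M (\<Pi>\<^sub>M j\<in>{1..N}. borel)
       (\<lambda>\<omega>. \<lambda>j\<in>{1..N}. ordered_eigenvalue (wigner_matrix N (\<lambda>j k. \<xi> j k \<omega>)) j)"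

definition weyl_chamber :: "nat \<Rightarrow> (nat \<Rightarrow> real) set" where
  "weyl_chamber N = {x. \<forall>k\<in>{1..N}. \<forall>l\<in>{1..N}. k < l \<longrightarrow> x k < x l}"

definition hamiltonian :: "(real \<Rightarrow> real) \<Rightarrow> nat \<Rightarrow> (nat \<Rightarrow> real) \<Rightarrow> real" where
  "hamiltonian V N x =
     1 / 2 * (\<Sum>k=1..N. V (x k)) - 1 / real N * (\<Sum>k=1..N. \<Sum>l=Suc k..N. ln (x l - x k))"

definition partial_deriv :: "nat \<Rightarrow> ((nat \<Rightarrow> real) \<Rightarrow> real) \<Rightarrow> (nat \<Rightarrow> real) \<Rightarrow> real" where
  "partial_deriv i F x = deriv (\<lambda>t. F (x(i := t))) (x i)"

text \<open>
  \<open>F'' \<ge> a Id\<close> at \<open>x\<close>, i.e. the Hessian matrix minus \<open>a Id\<close> is positive semidefinite.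
\<close>

definition hessian_ge :: "nat \<Rightarrow> ((nat \<Rightarrow> real) \<Rightarrow> real) \<Rightarrow> (nat \<Rightarrow> real) \<Rightarrow> real \<Rightarrow> bool" where
  "hessian_ge N F x a \<longleftrightarrow>
     (\<forall>v :: nat \<Rightarrow> real.
        (\<Sum>i=1..N. \<Sum>j=1..N. v i * partial_deriv i (partial_deriv j F) x * v j)
          \<ge> a * (\<Sum>i=1..N. (v i)\<^sup>2))"

definition beta_weight :: "real \<Rightarrow> (real \<Rightarrow> real) \<Rightarrow> nat \<Rightarrow> (nat \<Rightarrow> real) \<Rightarrow> ennreal" where
  "beta_weight \<beta> V N x =
     ennreal (indicator (weyl_chamber N) x * exp (- \<beta> * real N * hamiltonian V N x))"

definition beta_partition :: "real \<Rightarrow> (real \<Rightarrow> real) \<Rightarrow> nat \<Rightarrow> ennreal" where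
  "beta_partition \<beta> V N = (\<integral>\<^sup>+x. beta_weight \<beta> V N x \<partial>(\<Pi>\<^sub>M j\<in>{1..N}. lborel))"

definition beta_ensemble :: "real \<Rightarrow> (real \<Rightarrow> real) \<Rightarrow> nat \<Rightarrow> (nat \<Rightarrow> real) measure" where
  "beta_ensemble \<beta> V N =
     density (\<Pi>\<^sub>M j\<in>{1..N}. lborel) (\<lambda>x. beta_weight \<beta> V N x / beta_partition \<beta> V N)"

definition lin_stat :: "nat \<Rightarrow> (nat \<Rightarrow> real) measure \<Rightarrow> (real \<Rightarrow> real) \<Rightarrow> (nat \<Rightarrow> real) \<Rightarrow> real" where
  "lin_stat N \<mu> f x = (\<Sum>j=1..N. f (x j) - (\<integral>y. f (y j) \<partial>\<mu>))"

definition lin_stat_tilde ::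
  "nat \<Rightarrow> (nat \<Rightarrow> real) measure \<Rightarrow> (real \<Rightarrow> real) \<Rightarrow> (nat \<Rightarrow> real) \<Rightarrow> real" where
  "lin_stat_tilde N \<mu> f x =
     lin_stat N \<mu> f x - (\<Sum>j=1..N. (x j - (\<integral>y. y j \<partial>\<mu>)) * (\<integral>y. deriv f (y j) \<partial>\<mu>))"

end

theory Submission
  imports Defs
begin

text \<open>
  Both laws \<open>\<mu>\<close> satisfy Maurey's property (tau) with a quadratic cost whose strength grows with \<open>N\<close>:
  if \<open>F x * G y \<le> exp (\<kappa> N |x - y|\<^sup>2)\<close> for all \<open>x\<close>, \<open>y\<close>, then \<open>(\<integral>F d\<mu>) (\<integral>G d\<mu>) \<le> 1\<close>. This one
  inequality gives the theorem. Let \<open>T\<close> be the corrected linear statistic and \<open>K = \<kappa> N\<close>. Taylor's formula for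
  \<open>f\<close> at \<open>y j\<close> writes \<open>T x - T y\<close> as a linear form in \<open>x - y\<close> with coefficients
  \<open>f' (y j) - \<mu>[f' (y j)]\<close>, which the subtracted linear term has centred, plus a remainder of size at most
  \<open>\<gamma> / 2 |x - y|\<^sup>2\<close>. By Young's inequality, for \<open>s = (\<kappa> / \<gamma>) sqrt N\<close>,

  \<open>s T x \<le> s T y + s\<^sup>2 / (2 K) * (\<Sum>j. (f' (y j) - \<mu>[f' (y j)])\<^sup>2) + K |x - y|\<^sup>2\<close>.

  Property (tau) for \<open>F = exp (s T)\<close> and for \<open>G\<close> the exponential of minus the first two terms on the right,
  followed by Jensen's inequality for the integral of \<open>G\<close>, bounds \<open>\<integral>exp (s T) d\<mu>\<close> by the exponential of
  \<open>s\<^sup>2 / (2 K)\<close> times the sum of the variances of the \<open>f' (y j)\<close>. As \<open>f'\<close> is Lipschitz, property (tau) also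
  bounds each variance by \<open>\<gamma>\<^sup>2 / K\<close>, so this exponent is at most \<open>1/2\<close>, whatever \<open>N\<close> is
  (\<open>second_order_concentration\<close>).

  For Wigner matrices, a logarithmic Sobolev inequality on the line implies property (tau) on the line: along
  the Hopf-Lax semigroup, the inequality is exactly the differential inequality that makes a normalized
  log-Laplace functional monotone (\<open>log_P_step\<close>, \<open>log_sobolev_measure.property_tau\<close>). Property (tau) passes to
  products with the same constant (\<open>property_tau_PiM\<close>) and to images under Lipschitz maps; the ordered
  eigenvalues are a Lipschitz function of the matrix entries by \<open>hoffman_wielandt\<close>, and the factor
  \<open>1 / sqrt N\<close> in the matrix produces the factor \<open>N\<close> in the cost.

  For beta-ensembles, property (tau) is an instance of the Prekopa-Leindler inequality
  (\<open>prekopa_leindler_midpoint\<close>), as the energy is uniformly midpoint convex on the Weyl chamber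
  (\<open>hamiltonian_midpoint\<close>). The convexity comes from \<open>V'' \<ge> 2 a\<close> (\<open>second_deriv_lower_bound\<close>): the logarithmic
  interaction is translation invariant, so the Hessian of the energy in the direction \<open>(1, \<dots>, 1)\<close> sees \<open>V\<close> alone.
\<close>

section \<open>Property (tau)\<close>

text \<open>
  The two functions stand for the exponentials of an infimal convolution and of minus the original function.
  Quantifying over both, instead of forming the infimal convolution, avoids the question whether the latter
  is measurable and makes the behaviour under products a matter of Fubini's theorem.
\<close>
definition property_tau :: "'a measure \<Rightarrow> ('a \<Rightarrow> 'a \<Rightarrow> real) \<Rightarrow> bool" where
  "property_tau \<mu> w \<longleftrightarrow>
     (\<forall>F G. F \<in> borel_measurable \<mu> \<longrightarrow> G \<in> borel_measurable \<mu> \<longrightarrow>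
        (\<forall>x\<in>space \<mu>. \<forall>y\<in>space \<mu>. F x * G y \<le> ennreal (exp (w x y))) \<longrightarrow>
        (\<integral>\<^sup>+x. F x \<partial>\<mu>) * (\<integral>\<^sup>+x. G x \<partial>\<mu>) \<le> 1)"

definition sq_dist :: "'i set \<Rightarrow> ('i \<Rightarrow> real) \<Rightarrow> ('i \<Rightarrow> real) \<Rightarrow> real" where
  "sq_dist I x y = (\<Sum>i\<in>I. (x i - y i)\<^sup>2)"

lemma property_tau_distr:
  assumes tau: "property_tau M w" and T [measurable]: "T \<in> measurable M N"
    and le: "\<And>x y. x \<in> space M \<Longrightarrow> y \<in> space M \<Longrightarrow> w' (T x) (T y) \<le> w x y"
  shows "property_tau (distr M N T) w'"
  unfolding property_tau_def
proof (intro allI impI)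
  fix F G :: "'b \<Rightarrow> ennreal"
  assume F: "F \<in> borel_measurable (distr M N T)" and G: "G \<in> borel_measurable (distr M N T)"
    and FG: "\<forall>x\<in>space (distr M N T). \<forall>y\<in>space (distr M N T). F x * G y \<le> ennreal (exp (w' x y))"
  have [measurable]: "F \<in> borel_measurable N" "G \<in> borel_measurable N" using F G by auto
  have "F (T x) * G (T y) \<le> ennreal (exp (w x y))" if "x \<in> space M" "y \<in> space M" for x y
  proof -
    have "F (T x) * G (T y) \<le> ennreal (exp (w' (T x) (T y)))"
      using FG that measurable_space[OF T] by auto
    also have "\<dots> \<le> ennreal (exp (w x y))" using le[OF that] by simp
    finally show ?thesis .
  qed
  then have "(\<integral>\<^sup>+x. F (T x) \<partial>M) * (\<integral>\<^sup>+x. G (T x) \<partial>M) \<le> 1"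
    using tau unfolding property_tau_def by auto
  then show "(\<integral>\<^sup>+x. F x \<partial>distr M N T) * (\<integral>\<^sup>+x. G x \<partial>distr M N T) \<le> 1"
    by (simp add: nn_integral_distr)
qed

text \<open>
  Tensorization with the same constant. Integrating \<open>F\<close> and \<open>G\<close> over the old coordinates, with the new
  coordinate frozen at \<open>a\<close> and \<open>b\<close>, leaves two functions of one variable whose product at \<open>(a, b)\<close> is
  at most \<open>exp (K (a - b)\<^sup>2)\<close> by the induction hypothesis, so that the one-dimensional inequality applies to them.
\<close>
lemma property_tau_PiM:
  fixes M :: "'i \<Rightarrow> real measure"
  assumes prob: "\<And>i. prob_space (M i)" and fin: "finite I"
    and tau: "\<And>i. i \<in> I \<Longrightarrow> property_tau (M i) (\<lambda>x y. K * (x - y)\<^sup>2)"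
  shows "property_tau (PiM I M) (\<lambda>x y. K * sq_dist I x y)"
  using fin tau
proof (induction I rule: finite_induct)
  case empty
  interpret product_prob_space M by (intro product_prob_spaceI prob)
  show ?case by (auto simp: property_tau_def sq_dist_def PiM_empty nn_integral_count_space_finite)
next
  case (insert i I)
  interpret product_prob_space M by (intro product_prob_spaceI prob)
  interpret I: prob_space "PiM I M" by (intro prob_space_PiM prob)
  note [simp] = insert.hyps
  show ?case
    unfolding property_tau_def
  proof (intro allI impI)
    fix F G :: "('i \<Rightarrow> real) \<Rightarrow> ennreal"
    assume F [measurable]: "F \<in> borel_measurable (Pi\<^sub>M (insert i I) M)"
      and G [measurable]: "G \<in> borel_measurable (Pi\<^sub>M (insert i I) M)"
      and FG: "\<forall>x\<in>space (Pi\<^sub>M (insert i I) M). \<forall>y\<in>space (Pi\<^sub>M (insert i I) M).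
          F x * G y \<le> ennreal (exp (K * sq_dist (insert i I) x y))"
    define A where "A a = (\<integral>\<^sup>+x. F (x(i := a)) \<partial>PiM I M)" for a
    define B where "B a = (\<integral>\<^sup>+x. G (x(i := a)) \<partial>PiM I M)" for a
    have [measurable]: "A \<in> borel_measurable (M i)" "B \<in> borel_measurable (M i)"
      unfolding A_def B_def by measurable
    have upd: "x(i := a) \<in> space (Pi\<^sub>M (insert i I) M)" if "x \<in> space (PiM I M)" "a \<in> space (M i)" for x a
      using that by (auto simp: space_PiM PiE_def extensional_def)
    have "A a * B b \<le> ennreal (exp (K * (a - b)\<^sup>2))"
      if ab: "a \<in> space (M i)" "b \<in> space (M i)" for a b
    proof -
      have [measurable]: "(\<lambda>x. F (x(i := a))) \<in> borel_measurable (PiM I M)"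
           "(\<lambda>x. G (x(i := b))) \<in> borel_measurable (PiM I M)"
        using ab by measurable
      let ?e = "exp (K * (a - b)\<^sup>2)"
      have "ennreal (inverse ?e) * F (x(i := a)) * G (y(i := b)) \<le> ennreal (exp (K * sq_dist I x y))"
        if "x \<in> space (PiM I M)" "y \<in> space (PiM I M)" for x y
      proof -
        have sq: "sq_dist (insert i I) (x(i := a)) (y(i := b)) = (a - b)\<^sup>2 + sq_dist I x y"
          unfolding sq_dist_def by (subst sum.insert) (auto intro!: sum.cong)
        have "F (x(i := a)) * G (y(i := b)) \<le> ennreal (exp (K * sq_dist (insert i I) (x(i := a)) (y(i := b))))"
          using FG upd that ab by blast
        then have "ennreal (inverse ?e) * (F (x(i := a)) * G (y(i := b)))
            \<le> ennreal (inverse ?e) * ennreal (exp (K * ((a - b)\<^sup>2 + sq_dist I x y)))"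
          unfolding sq by (intro mult_left_mono) auto
        also have "\<dots> = ennreal (exp (K * sq_dist I x y))"
          by (simp add: ennreal_mult[symmetric] exp_minus[symmetric] exp_add[symmetric] distrib_left)
        finally show ?thesis unfolding mult.assoc .
      qed
      then have "(\<integral>\<^sup>+x. ennreal (inverse ?e) * F (x(i := a)) \<partial>PiM I M) * (\<integral>\<^sup>+y. G (y(i := b)) \<partial>PiM I M) \<le> 1"
        using insert.IH insert.prems unfolding property_tau_def by simp
      then have "ennreal (inverse ?e) * (A a * B b) \<le> 1"
        by (simp add: nn_integral_cmult A_def B_def mult.assoc)
      then have "ennreal ?e * (ennreal (inverse ?e) * (A a * B b)) \<le> ennreal ?e * 1"
        by (intro mult_left_mono) auto
      then show ?thesis by (simp add: mult.assoc[symmetric] ennreal_mult[symmetric])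
    qed
    then have "(\<integral>\<^sup>+a. A a \<partial>M i) * (\<integral>\<^sup>+b. B b \<partial>M i) \<le> 1"
      using insert.prems unfolding property_tau_def by simp
    then show "integral\<^sup>N (Pi\<^sub>M (insert i I) M) F * integral\<^sup>N (Pi\<^sub>M (insert i I) M) G \<le> 1"
      by (simp add: product_nn_integral_insert_rev A_def B_def)
  qed
qed

section \<open>Second-order concentration from property (tau)\<close>

lemma property_tau_exp_bound:
  fixes T q :: "'a \<Rightarrow> real"
  assumes tau: "property_tau \<mu> w"
    and [measurable]: "T \<in> borel_measurable \<mu>" "q \<in> borel_measurable \<mu>"
    and le: "\<And>x y. x \<in> space \<mu> \<Longrightarrow> y \<in> space \<mu> \<Longrightarrow> T x \<le> T y + q y + w x y"
  shows "(\<integral>\<^sup>+x. ennreal (exp (T x)) \<partial>\<mu>) * (\<integral>\<^sup>+x. ennreal (exp (- T x - q x)) \<partial>\<mu>) \<le> 1"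
proof -
  have "ennreal (exp (T x)) * ennreal (exp (- T y - q y)) \<le> ennreal (exp (w x y))"
    if "x \<in> space \<mu>" "y \<in> space \<mu>" for x y
    using le[OF that] by (simp add: ennreal_mult[symmetric] exp_add[symmetric])
  then show ?thesis
    using tau unfolding property_tau_def by auto
qed

lemma (in prob_space) nn_integral_exp_pos:
  fixes T :: "'a \<Rightarrow> real"
  assumes [measurable]: "T \<in> borel_measurable M"
  shows "(\<integral>\<^sup>+x. ennreal (exp (T x)) \<partial>M) \<noteq> 0"
proof
  assume "(\<integral>\<^sup>+x. ennreal (exp (T x)) \<partial>M) = 0"
  then have "AE x in M. ennreal (exp (T x)) = 0" by (subst (asm) nn_integral_0_iff_AE) auto
  then have "AE x in M. False" by eventually_elim (simp add: ennreal_eq_0_iff not_le)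
  then show False by simp
qed

text \<open>
  Jensen's inequality, where the right-hand side may be infinite: compare the exponential with its tangent at
  the mean of \<open>T\<close>.
\<close>
lemma (in prob_space) exp_integral_le_nn_integral_exp:
  fixes T :: "'a \<Rightarrow> real"
  assumes T: "integrable M T"
  shows "ennreal (exp (\<integral>x. T x \<partial>M)) \<le> (\<integral>\<^sup>+x. ennreal (exp (T x)) \<partial>M)"
proof (cases "\<integral>\<^sup>+x. ennreal (exp (T x)) \<partial>M")
  case (real r)
  define m where "m = (\<integral>x. T x \<partial>M)"
  have "exp m = (\<integral>x. exp m * (1 + (T x - m)) \<partial>M)"
    using T by (simp add: m_def prob_space)
  also have "\<dots> \<le> r"
  proof (rule integral_real_bounded)
    show "(\<integral>\<^sup>+x. ennreal (exp m * (1 + (T x - m))) \<partial>M) \<le> ennreal r"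
      unfolding real(2)[symmetric]
    proof (intro nn_integral_mono ennreal_leI)
      fix x
      have "exp m * (1 + (T x - m)) \<le> exp m * exp (T x - m)"
        by (intro mult_left_mono) auto
      then show "exp m * (1 + (T x - m)) \<le> exp (T x)" by (simp add: exp_add[symmetric])
    qed
  qed (fact real)
  finally show ?thesis using real by (simp add: m_def)
qed simp

lemma (in prob_space) property_tau_integrable_exp:
  fixes T :: "'a \<Rightarrow> real"
  assumes tau: "property_tau M w"
    and [measurable]: "T \<in> borel_measurable M"
    and le: "\<And>x y. x \<in> space M \<Longrightarrow> y \<in> space M \<Longrightarrow> T x \<le> T y + b + w x y"
  shows "integrable M (\<lambda>x. exp (T x))"
proof (rule integrableI_bounded)
  have "(\<integral>\<^sup>+x. ennreal (exp (T x)) \<partial>M) * (\<integral>\<^sup>+x. ennreal (exp (- T x - b)) \<partial>M) \<le> 1"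
    by (rule property_tau_exp_bound[OF tau]) (use le in auto)
  moreover have "(\<integral>\<^sup>+x. ennreal (exp (- T x - b)) \<partial>M) \<noteq> 0"
    by (rule nn_integral_exp_pos) auto
  ultimately have "(\<integral>\<^sup>+x. ennreal (exp (T x)) \<partial>M) \<noteq> \<infinity>"
    by (auto simp: ennreal_top_mult top_unique)
  then show "(\<integral>\<^sup>+x. ennreal (norm (exp (T x))) \<partial>M) < \<infinity>"
    by (simp add: less_top)
qed auto

lemma one_plus_sq_le_cosh: "2 + u\<^sup>2 \<le> exp u + exp (- u)" for u :: real
proof -
  have *: "2 + u\<^sup>2 \<le> exp u + exp (- u)" if "u \<ge> 0" for u :: real
  proof -
    have "exp u + exp (-u) - 2 = (exp (u/2) - exp (-(u/2)))\<^sup>2"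
      by (simp add: power2_eq_square algebra_simps exp_add[symmetric])
    moreover have "exp (u/2) - exp (-(u/2)) \<ge> u"
    proof -
      have "(\<lambda>u::real. exp (u/2) - exp (-(u/2)) - u) 0 \<le> exp (u/2) - exp (-(u/2)) - u"
      proof (rule DERIV_nonneg_imp_nondecreasing[OF that])
        fix x :: real
        have "((\<lambda>u::real. exp (u/2) - exp (-(u/2)) - u) has_real_derivative (exp (x/2) + exp (-(x/2)))/2 - 1) (at x)"
          by (auto intro!: derivative_eq_intros simp: field_simps)
        moreover have "(exp (x/2) + exp (-(x/2)))/2 - 1 \<ge> 0"
        proof -
          have "(exp (x/4) - exp (-(x/4)))\<^sup>2 = exp (x/2) + exp (-(x/2)) - 2"
            by (simp add: power2_eq_square algebra_simps exp_add[symmetric])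
          then have "0 \<le> exp (x/2) + exp (-(x/2)) - 2" by (metis zero_le_power2)
          then show ?thesis by simp
        qed
        ultimately show "\<exists>y. ((\<lambda>u::real. exp (u/2) - exp (-(u/2)) - u) has_real_derivative y) (at x) \<and> 0 \<le> y"
          by blast
      qed
      then show ?thesis by simp
    qed
    then have "(exp (u/2) - exp (-(u/2)))\<^sup>2 \<ge> u\<^sup>2" using that by (intro power_mono) auto
    ultimately show ?thesis by linarith
  qed
  show ?thesis using *[of u] *[of "-u"] by (cases "u \<ge> 0") auto
qed

text \<open>
  The hypothesis is what a Lipschitz function satisfies for a quadratic cost \<open>w\<close>, by Young's inequality. It
  gives \<open>Z s * Z (- s) \<le> exp (s\<^sup>2 v)\<close> for the Laplace transform \<open>Z\<close> of the centred function; as both factors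
  are at least \<open>1\<close>, each is at most \<open>exp (s\<^sup>2 v)\<close>, and \<open>2 + u\<^sup>2 \<le> exp u + exp (- u)\<close> extracts the variance.
\<close>
lemma (in prob_space) property_tau_lipschitz:
  fixes \<phi> :: "'a \<Rightarrow> real"
  assumes tau: "property_tau M w"
    and [measurable]: "\<phi> \<in> borel_measurable M"
    and v: "v > 0"
    and le: "\<And>x y s. x \<in> space M \<Longrightarrow> y \<in> space M \<Longrightarrow> s * (\<phi> x - \<phi> y) \<le> s\<^sup>2 * v + w x y"
  shows "integrable M \<phi>" "integrable M (\<lambda>x. (\<phi> x)\<^sup>2)"
    and "(\<integral>x. (\<phi> x - (\<integral>y. \<phi> y \<partial>M))\<^sup>2 \<partial>M) \<le> 4 * v"
proof -
  have exp_int: "integrable M (\<lambda>x. exp (s * \<phi> x))" for s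
  proof (rule property_tau_integrable_exp[OF tau])
    show "s * \<phi> x \<le> s * \<phi> y + s\<^sup>2 * v + w x y" if "x \<in> space M" "y \<in> space M" for x y
      using le[OF that, of s] by (simp add: algebra_simps)
  qed auto
  have sq: "integrable M (\<lambda>x. (\<phi> x)\<^sup>2)"
  proof (rule Bochner_Integration.integrable_bound)
    show "integrable M (\<lambda>x. exp (1 * \<phi> x) + exp (-1 * \<phi> x))" by (intro Bochner_Integration.integrable_add exp_int)
    show "AE x in M. norm ((\<phi> x)\<^sup>2) \<le> norm (exp (1 * \<phi> x) + exp (-1 * \<phi> x))"
    proof (rule AE_I2)
      fix x
      have "(\<phi> x)\<^sup>2 \<le> exp (1 * \<phi> x) + exp (-1 * \<phi> x)"
        using one_plus_sq_le_cosh[of "\<phi> x"] by simp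
      then show "norm ((\<phi> x)\<^sup>2) \<le> norm (exp (1 * \<phi> x) + exp (-1 * \<phi> x))" by simp
    qed
  qed auto
  show int: "integrable M \<phi>"
    by (rule square_integrable_imp_integrable[OF _ sq]) auto
  show "integrable M (\<lambda>x. (\<phi> x)\<^sup>2)" by (fact sq)
  define m where "m = (\<integral>y. \<phi> y \<partial>M)"
  (* The value of s for which the exponent s^2 v equals 1. *)
  define s where "s = 1 / sqrt v"
  have s2: "s\<^sup>2 * v = 1" "s \<noteq> 0" using v by (auto simp: s_def power_divide)
  define Z where "Z r = (\<integral>x. exp (r * (\<phi> x - m)) \<partial>M)" for r
  have Zint: "integrable M (\<lambda>x. exp (r * (\<phi> x - m)))" for r
    using integrable_mult_left[OF exp_int[of r], of "exp (- r * m)"]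
    by (simp add: exp_add[symmetric] algebra_simps)
  have Z1: "Z r \<ge> 1" for r
  proof -
    have "(\<integral>x. 1 + r * (\<phi> x - m) \<partial>M) \<le> Z r"
      unfolding Z_def using int Zint by (intro integral_mono) auto
    then show ?thesis using int by (simp add: m_def prob_space)
  qed
  have ZZ: "Z r * Z (- r) \<le> exp 1" if "r\<^sup>2 * v = 1" for r
  proof -
    have "(\<integral>\<^sup>+x. ennreal (exp (r * (\<phi> x - m))) \<partial>M) * (\<integral>\<^sup>+x. ennreal (exp (- (r * (\<phi> x - m)) - 1)) \<partial>M) \<le> 1"
    proof (rule property_tau_exp_bound[OF tau])
      show "r * (\<phi> x - m) \<le> r * (\<phi> y - m) + 1 + w x y" if "x \<in> space M" "y \<in> space M" for x y
        using le[OF that, of r] \<open>r\<^sup>2 * v = 1\<close> by (simp add: algebra_simps)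
    qed auto
    moreover have "(\<integral>\<^sup>+x. ennreal (exp (r * (\<phi> x - m))) \<partial>M) = ennreal (Z r)"
      unfolding Z_def by (intro nn_integral_eq_integral Zint) auto
    moreover have "(\<integral>\<^sup>+x. ennreal (exp (- (r * (\<phi> x - m)) - 1)) \<partial>M) = ennreal (exp (-1) * Z (-r))"
    proof -
      have "(\<integral>\<^sup>+x. ennreal (exp (- (r * (\<phi> x - m)) - 1)) \<partial>M)
          = (\<integral>\<^sup>+x. ennreal (exp (-1) * exp (- r * (\<phi> x - m))) \<partial>M)"
        by (intro nn_integral_cong) (simp add: exp_add[symmetric] algebra_simps)
      also have "\<dots> = ennreal (\<integral>x. exp (-1) * exp (- r * (\<phi> x - m)) \<partial>M)"
        by (intro nn_integral_eq_integral integrable_mult_right Zint) auto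
      finally show ?thesis by (simp add: Z_def)
    qed
    ultimately have "ennreal (Z r) * ennreal (exp (-1) * Z (- r)) \<le> 1" by simp
    then have "Z r * (exp (-1) * Z (- r)) \<le> 1"
      using Z1[of r] Z1[of "-r"] by (simp add: ennreal_mult[symmetric])
    then show ?thesis by (simp add: exp_minus field_simps)
  qed
  have Zle: "Z r \<le> exp 1" if "r\<^sup>2 * v = 1" for r
  proof -
    have "Z r * 1 \<le> Z r * Z (-r)" using Z1[of r] Z1[of "-r"] by (intro mult_left_mono) auto
    then show ?thesis using ZZ[OF that] by simp
  qed
  have vint: "integrable M (\<lambda>x. (\<phi> x - m)\<^sup>2)"
    using int sq by (simp add: power2_diff)
  have "2 + s\<^sup>2 * (\<integral>x. (\<phi> x - m)\<^sup>2 \<partial>M) = (\<integral>x. 2 + (s * (\<phi> x - m))\<^sup>2 \<partial>M)"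
    using vint by (simp add: prob_space power_mult_distrib)
  also have "\<dots> \<le> (\<integral>x. exp (s * (\<phi> x - m)) + exp (- s * (\<phi> x - m)) \<partial>M)"
  proof (rule integral_mono)
    show "integrable M (\<lambda>x. 2 + (s * (\<phi> x - m))\<^sup>2)" using vint by (simp add: power_mult_distrib)
    show "integrable M (\<lambda>x. exp (s * (\<phi> x - m)) + exp (- s * (\<phi> x - m)))"
      by (intro Bochner_Integration.integrable_add Zint)
    show "2 + (s * (\<phi> x - m))\<^sup>2 \<le> exp (s * (\<phi> x - m)) + exp (- s * (\<phi> x - m))" for x
      using one_plus_sq_le_cosh[of "s * (\<phi> x - m)"] by simp
  qed
  also have "\<dots> = Z s + Z (- s)"
    unfolding Z_def by (intro Bochner_Integration.integral_add Zint)
  also have "\<dots> \<le> exp 1 + exp 1" using Zle[of s] Zle[of "-s"] s2 by (intro add_mono) auto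
  also have "\<dots> \<le> 6" using exp_le by simp
  finally have "s\<^sup>2 * (\<integral>x. (\<phi> x - m)\<^sup>2 \<partial>M) \<le> 4" by simp
  then have "v * (s\<^sup>2 * (\<integral>x. (\<phi> x - m)\<^sup>2 \<partial>M)) \<le> v * 4" using v by (intro mult_left_mono) auto
  moreover have "v * (s\<^sup>2 * (\<integral>x. (\<phi> x - m)\<^sup>2 \<partial>M)) = (s\<^sup>2 * v) * (\<integral>x. (\<phi> x - m)\<^sup>2 \<partial>M)" by simp
  ultimately show "(\<integral>x. (\<phi> x - (\<integral>y. \<phi> y \<partial>M))\<^sup>2 \<partial>M) \<le> 4 * v" unfolding s2 m_def by simp
qed

text \<open>
  Here \<open>q\<close> is the squared-gradient term: the exponential moment of a centred function is controlled by
  the mean of its squared gradient alone.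
\<close>
lemma (in prob_space) property_tau_centered_exp_le:
  fixes T q :: "'a \<Rightarrow> real"
  assumes tau: "property_tau M w"
    and T: "integrable M T" "(\<integral>x. T x \<partial>M) = 0"
    and q: "integrable M q" "(\<integral>x. q x \<partial>M) \<le> b"
    and le: "\<And>x y. x \<in> space M \<Longrightarrow> y \<in> space M \<Longrightarrow> T x \<le> T y + q y + w x y"
  shows "(\<integral>\<^sup>+x. ennreal (exp (T x)) \<partial>M) \<le> ennreal (exp b)"
proof -
  let ?E = "\<integral>\<^sup>+x. ennreal (exp (T x)) \<partial>M"
  have "exp (- b) \<le> exp (\<integral>x. - T x - q x \<partial>M)" using T q by simp
  then have "ennreal (exp (- b)) \<le> ennreal (exp (\<integral>x. - T x - q x \<partial>M))" by (rule ennreal_leI)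
  also have "\<dots> \<le> (\<integral>\<^sup>+x. ennreal (exp (- T x - q x)) \<partial>M)"
    by (rule exp_integral_le_nn_integral_exp) (use T q in auto)
  finally have "ennreal (exp (- b)) \<le> (\<integral>\<^sup>+x. ennreal (exp (- T x - q x)) \<partial>M)" .
  then have "?E * ennreal (exp (- b)) \<le> ?E * (\<integral>\<^sup>+x. ennreal (exp (- T x - q x)) \<partial>M)"
    by (intro mult_left_mono) auto
  also have "\<dots> \<le> 1"
    by (rule property_tau_exp_bound[OF tau]) (use T q le in auto)
  finally have "?E * ennreal (exp (- b)) * ennreal (exp b) \<le> 1 * ennreal (exp b)"
    by (rule mult_right_mono) auto
  then show ?thesis by (simp add: mult.assoc ennreal_mult[symmetric] exp_add[symmetric])
qed

lemma C2_imp_derivatives: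
  assumes "C2 f"
  shows "(f has_real_derivative deriv f x) (at x)"
    and "(deriv f has_real_derivative deriv (deriv f) x) (at x)"
    and "continuous_on UNIV (deriv (deriv f))"
proof -
  have D: "g differentiable at x" if "g C1_differentiable_on UNIV" for g :: "real \<Rightarrow> real" and x
    using that by (auto simp: C1_differentiable_on_eq)
  show "(f has_real_derivative deriv f x) (at x)" "(deriv f has_real_derivative deriv (deriv f) x) (at x)"
    using assms unfolding C2_def
    by (auto intro!: DERIV_deriv_iff_real_differentiable[THEN iffD2] D)
  have "vector_derivative (deriv f) (at x) = deriv (deriv f) x" for x
    using D[of "deriv f" x] assms unfolding C2_def
    by (metis DERIV_deriv_iff_real_differentiable has_real_derivative_iff_has_vector_derivative vector_derivative_at)
  then show "continuous_on UNIV (deriv (deriv f))"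
    using assms unfolding C2_def C1_differentiable_on_eq by simp
qed

lemma C2_taylor_bound:
  assumes f: "C2 f" and b: "\<And>t. \<bar>deriv (deriv f) t\<bar> \<le> \<gamma>"
  shows "\<bar>f x - f y - (x - y) * deriv f y\<bar> \<le> \<gamma> / 2 * (x - y)\<^sup>2"
proof (cases "x = y")
  case False
  define df where "df m = (if m = 0 then f else if m = 1 then deriv f else deriv (deriv f))" for m :: nat
  have "\<exists>t. (if x < y then x < t \<and> t < y else y < t \<and> t < x) \<and>
     f x = (\<Sum>m<2. df m y / fact m * (x - y) ^ m) + df 2 t / fact 2 * (x - y) ^ 2"
  proof (rule Taylor[where a = "min x y" and b = "max x y"])
    show "\<forall>m t. m < 2 \<and> min x y \<le> t \<and> t \<le> max x y \<longrightarrow> DERIV (df m) t :> df (Suc m) t"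
      using C2_imp_derivatives[OF f] by (auto simp: df_def less_2_cases_iff)
  qed (use False in \<open>auto simp: df_def\<close>)
  then obtain t where "f x = f y + deriv f y * (x - y) + deriv (deriv f) t / 2 * (x - y)\<^sup>2"
    by (auto simp: df_def numeral_2_eq_2)
  then have "\<bar>f x - f y - (x - y) * deriv f y\<bar> = \<bar>deriv (deriv f) t\<bar> / 2 * (x - y)\<^sup>2"
    by (simp add: abs_mult algebra_simps)
  also have "\<dots> \<le> \<gamma> / 2 * (x - y)\<^sup>2"
    using b[of t] by (intro mult_right_mono) auto
  finally show ?thesis .
qed simp

lemma C2_deriv_lipschitz:
  assumes f: "C2 f" and b: "\<And>t. \<bar>deriv (deriv f) t\<bar> \<le> \<gamma>"
  shows "\<bar>deriv f x - deriv f y\<bar> \<le> \<gamma> * \<bar>x - y\<bar>"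
proof -
  have "norm (deriv f x - deriv f y) \<le> \<gamma> * norm (x - y)"
    by (rule field_differentiable_bound[of UNIV])
       (use C2_imp_derivatives(2)[OF f] b in \<open>auto simp: has_field_derivative_at_within\<close>)
  then show ?thesis by simp
qed

text \<open>
  The exponent \<open>\<kappa> / (2 \<gamma>)\<close> is half of the one for which the squared-gradient term has mean at most \<open>1/2\<close>:
  the sum of the two one-sided exponential moments is then at most \<open>2 * exp (1/2) \<le> 4\<close>, and halving the
  exponent turns the bound \<open>4\<close> into \<open>2\<close>.
\<close>
theorem second_order_concentration:
  fixes \<mu> :: "(nat \<Rightarrow> real) measure"
  assumes N: "N \<ge> 1" and pos: "\<kappa> > 0" "\<gamma> > 0"
    and prob: "prob_space \<mu>"
    and sets: "sets \<mu> = sets (\<Pi>\<^sub>M j\<in>{1..N}. borel)"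
    and tau: "property_tau \<mu> (\<lambda>x y. \<kappa> * real N * sq_dist {1..N} x y)"
    and f: "C2 f" and b: "\<And>t. \<bar>deriv (deriv f) t\<bar> \<le> \<gamma>"
  shows "(\<integral>\<^sup>+x. ennreal (exp (\<kappa> / (2 * \<gamma>) * sqrt (real N) * \<bar>lin_stat_tilde N \<mu> f x\<bar>)) \<partial>\<mu>) \<le> 2"
proof -
  interpret prob_space \<mu> by fact
  define K where "K = \<kappa> * real N"
  have K: "K > 0" using N pos by (simp add: K_def)
  define s where "s = \<kappa> / \<gamma> * sqrt (real N)"
  have s0: "s > 0" using N pos by (simp add: s_def)
  have s2: "s\<^sup>2 = \<kappa> * K / \<gamma>\<^sup>2"
    by (simp add: s_def K_def power_mult_distrib power_divide power2_eq_square)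
  (* The Taylor remainder may use up only one half of the cost. *)
  have sK: "s * \<gamma> \<le> K"
  proof -
    have "sqrt (real N) \<le> real N" using N by (intro real_le_lsqrt) (auto simp: power2_eq_square)
    then show ?thesis using pos by (simp add: s_def K_def)
  qed
  have space: "space \<mu> = space (\<Pi>\<^sub>M j\<in>{1..N}. borel)" by (rule sets_eq_imp_space_eq[OF sets])
  have coord [measurable]: "(\<lambda>x. x j) \<in> borel_measurable \<mu>" if "j \<in> {1..N}" for j
    using measurable_component_singleton[OF that, of "\<lambda>_. borel :: real measure"]
    by (simp add: measurable_cong_sets[OF sets refl])
  have f_meas [measurable]: "f \<in> borel_measurable borel" "deriv f \<in> borel_measurable borel"
    by (auto intro!: borel_measurable_continuous_onI continuous_at_imp_continuous_on
             DERIV_isCont C2_imp_derivatives[OF f])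
  have sep: "(x j - y j)\<^sup>2 \<le> sq_dist {1..N} x y" if "j \<in> {1..N}" for x y :: "nat \<Rightarrow> real" and j
    unfolding sq_dist_def using that by (intro member_le_sum) auto
  have tau': "property_tau \<mu> (\<lambda>x y. K * sq_dist {1..N} x y)" using tau by (simp add: K_def)
  (* Young's inequality: a Lipschitz function of one coordinate satisfies the hypothesis of property_tau_lipschitz. *)
  have lip: "r * (\<phi> (x j) - \<phi> (y j)) \<le> r\<^sup>2 * (L\<^sup>2 / (4 * K)) + K * sq_dist {1..N} x y"
    if j: "j \<in> {1..N}" and L: "\<And>u v. \<bar>\<phi> u - \<phi> v\<bar> \<le> L * \<bar>u - v\<bar>"
    for r L j \<phi> and x y :: "nat \<Rightarrow> real"
  proof -
    define d where "d = \<bar>x j - y j\<bar>"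
    have "r * (\<phi> (x j) - \<phi> (y j)) \<le> \<bar>r\<bar> * \<bar>\<phi> (x j) - \<phi> (y j)\<bar>"
      by (metis abs_ge_self abs_mult)
    also have "\<dots> \<le> \<bar>r\<bar> * (L * d)" unfolding d_def by (intro mult_left_mono L) auto
    also have "\<dots> \<le> r\<^sup>2 * (L\<^sup>2 / (4 * K)) + K * d\<^sup>2"
    proof -
      have "0 \<le> (\<bar>r\<bar> * L - 2 * K * d)\<^sup>2" by simp
      then have "4 * K * (\<bar>r\<bar> * (L * d)) \<le> 4 * K * (r\<^sup>2 * (L\<^sup>2 / (4 * K)) + K * d\<^sup>2)"
        using K by (simp add: power2_eq_square algebra_simps)
      then show ?thesis using K by (subst (asm) mult_le_cancel_left_pos) auto
    qed
    also have "K * d\<^sup>2 \<le> K * sq_dist {1..N} x y"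
      using sep[OF j, of x y] K by (simp add: d_def)
    finally show ?thesis by simp
  qed
  have id_int: "integrable \<mu> (\<lambda>x. x j)" "integrable \<mu> (\<lambda>x. (x j)\<^sup>2)" if j: "j \<in> {1..N}" for j
    using property_tau_lipschitz[OF tau' coord[OF j], of "1 / (4 * K)"] lip[OF j, of id 1] K by auto
  have df_int: "integrable \<mu> (\<lambda>x. deriv f (x j))" "integrable \<mu> (\<lambda>x. (deriv f (x j))\<^sup>2)"
    and df_var: "(\<integral>x. (deriv f (x j) - (\<integral>y. deriv f (y j) \<partial>\<mu>))\<^sup>2 \<partial>\<mu>) \<le> \<gamma>\<^sup>2 / K" if j: "j \<in> {1..N}" for j
  proof -
    have [measurable]: "(\<lambda>x. x j) \<in> borel_measurable \<mu>" by (rule coord[OF j])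
    note * = property_tau_lipschitz[OF tau', of "\<lambda>x. deriv f (x j)" "\<gamma>\<^sup>2 / (4 * K)",
        OF _ _ lip[OF j C2_deriv_lipschitz[OF f b]]]
    show "integrable \<mu> (\<lambda>x. deriv f (x j))" "integrable \<mu> (\<lambda>x. (deriv f (x j))\<^sup>2)"
      using *(1,2) pos K by auto
    show "(\<integral>x. (deriv f (x j) - (\<integral>y. deriv f (y j) \<partial>\<mu>))\<^sup>2 \<partial>\<mu>) \<le> \<gamma>\<^sup>2 / K"
      using *(3) pos K by auto
  qed
  have f_int: "integrable \<mu> (\<lambda>x. f (x j))" if j: "j \<in> {1..N}" for j
  proof (rule Bochner_Integration.integrable_bound)
    have [measurable]: "(\<lambda>x. x j) \<in> borel_measurable \<mu>" by (rule coord[OF j])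
    show "integrable \<mu> (\<lambda>x. \<bar>f 0\<bar> + \<bar>deriv f 0\<bar> * \<bar>x j\<bar> + \<gamma> / 2 * (x j)\<^sup>2)"
      using id_int[OF j] by auto
    show "(\<lambda>x. f (x j)) \<in> borel_measurable \<mu>" by measurable
    show "AE x in \<mu>. norm (f (x j)) \<le> norm (\<bar>f 0\<bar> + \<bar>deriv f 0\<bar> * \<bar>x j\<bar> + \<gamma> / 2 * (x j)\<^sup>2)"
    proof (rule AE_I2)
      fix x :: "nat \<Rightarrow> real"
      have "\<bar>f (x j) - f 0 - x j * deriv f 0\<bar> \<le> \<gamma> / 2 * (x j)\<^sup>2"
        using C2_taylor_bound[OF f b, of "x j" 0] by simp
      moreover have "\<bar>x j * deriv f 0\<bar> = \<bar>deriv f 0\<bar> * \<bar>x j\<bar>" by (simp add: abs_mult)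
      ultimately have "\<bar>f (x j)\<bar> \<le> \<bar>f 0\<bar> + \<bar>deriv f 0\<bar> * \<bar>x j\<bar> + \<gamma> / 2 * (x j)\<^sup>2"
        by linarith
      also have "\<dots> \<le> \<bar>\<dots>\<bar>" by (rule abs_ge_self)
      finally show "norm (f (x j)) \<le> norm (\<bar>f 0\<bar> + \<bar>deriv f 0\<bar> * \<bar>x j\<bar> + \<gamma> / 2 * (x j)\<^sup>2)"
        by simp
    qed
  qed
  define m where "m j = (\<integral>y. deriv f (y j) \<partial>\<mu>)" for j
  define T where "T x = lin_stat_tilde N \<mu> f x" for x
  define q where "q x = s\<^sup>2 / (2 * K) * (\<Sum>j=1..N. (deriv f (x j) - m j)\<^sup>2)" for x
  have T_eq: "T x = (\<Sum>j=1..N. (f (x j) - (\<integral>y. f (y j) \<partial>\<mu>)) - (x j - (\<integral>y. y j \<partial>\<mu>)) * m j)" for x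
    by (simp add: T_def lin_stat_tilde_def lin_stat_def m_def sum_subtractf)
  have T_int: "integrable \<mu> T"
    unfolding T_eq[abs_def]
    by (intro Bochner_Integration.integrable_sum Bochner_Integration.integrable_diff integrable_mult_left f_int id_int) auto
  have T_mean: "(\<integral>x. T x \<partial>\<mu>) = 0"
  proof -
    have "(\<integral>x. T x \<partial>\<mu>) = (\<Sum>j=1..N. (\<integral>x. (f (x j) - (\<integral>y. f (y j) \<partial>\<mu>)) - (x j - (\<integral>y. y j \<partial>\<mu>)) * m j \<partial>\<mu>))"
      unfolding T_eq
      by (intro Bochner_Integration.integral_sum Bochner_Integration.integrable_diff integrable_mult_left f_int id_int) auto
    also have "\<dots> = 0"
      using f_int id_int by (intro sum.neutral) (auto simp: prob_space)
    finally show ?thesis .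
  qed
  have v_int: "integrable \<mu> (\<lambda>x. (deriv f (x j) - m j)\<^sup>2)" if "j \<in> {1..N}" for j
    using df_int[OF that] by (simp add: power2_diff)
  have q_int: "integrable \<mu> q"
    unfolding q_def by (intro integrable_mult_right Bochner_Integration.integrable_sum v_int) auto
  have q_mean: "(\<integral>x. q x \<partial>\<mu>) \<le> 1 / 2"
  proof -
    have "(\<integral>x. q x \<partial>\<mu>) = s\<^sup>2 / (2 * K) * (\<Sum>j=1..N. (\<integral>x. (deriv f (x j) - m j)\<^sup>2 \<partial>\<mu>))"
      unfolding q_def by (simp add: Bochner_Integration.integral_sum v_int)
    also have "\<dots> \<le> s\<^sup>2 / (2 * K) * (\<Sum>j=1..N. \<gamma>\<^sup>2 / K)"
      using K df_var unfolding m_def by (intro mult_left_mono sum_mono) auto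
    also have "\<dots> = (s\<^sup>2 * \<gamma>\<^sup>2) * real N / (2 * K * K)" by simp
    also have "s\<^sup>2 * \<gamma>\<^sup>2 = \<kappa> * K" using s2 pos by simp
    also have "\<kappa> * K * real N / (2 * K * K) = 1 / 2" using pos N by (simp add: K_def)
    finally show ?thesis .
  qed
  have main: "e * (s * T x) \<le> e * (s * T y) + q y + K * sq_dist {1..N} x y" if e: "e = 1 \<or> e = -1" for x y e
  proof -
    have "e * (s * T x) - e * (s * T y) = (\<Sum>j=1..N. e * s * ((f (x j) - f (y j)) - (x j - y j) * m j))"
      unfolding T_eq by (simp add: sum_distrib_left sum_subtractf[symmetric] algebra_simps)
    also have "\<dots> \<le> (\<Sum>j=1..N. s\<^sup>2 / (2 * K) * (deriv f (y j) - m j)\<^sup>2 + K * (x j - y j)\<^sup>2)"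
    proof (rule sum_mono)
      fix j
      define d where "d = x j - y j"
      define g where "g = deriv f (y j) - m j"
      define R where "R = f (x j) - f (y j) - (x j - y j) * deriv f (y j)"
      have R: "\<bar>R\<bar> \<le> \<gamma> / 2 * d\<^sup>2" using C2_taylor_bound[OF f b] by (simp add: R_def d_def)
      have "e * s * ((f (x j) - f (y j)) - (x j - y j) * m j) = e * s * (d * g) + e * (s * R)"
        by (simp add: R_def d_def g_def algebra_simps)
      moreover have "e * (s * R) \<le> K / 2 * d\<^sup>2"
      proof -
        have "e * (s * R) \<le> s * \<bar>R\<bar>" using e s0 by (auto simp: abs_if)
        also have "\<dots> \<le> s * (\<gamma> / 2 * d\<^sup>2)" using R s0 by (intro mult_left_mono) auto
        also have "\<dots> = (s * \<gamma>) * (d\<^sup>2 / 2)" by simp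
        also have "\<dots> \<le> K * (d\<^sup>2 / 2)" using sK by (intro mult_right_mono) auto
        finally show ?thesis by simp
      qed
      moreover have "e * s * (d * g) \<le> s\<^sup>2 / (2 * K) * g\<^sup>2 + K / 2 * d\<^sup>2"
      proof -
        have "0 \<le> (e * s * g - K * d)\<^sup>2" by simp
        then have "2 * K * (e * s * (d * g)) \<le> 2 * K * (s\<^sup>2 / (2 * K) * g\<^sup>2 + K / 2 * d\<^sup>2)"
          using K e by (auto simp: power2_eq_square algebra_simps)
        then show ?thesis using K by (subst (asm) mult_le_cancel_left_pos) auto
      qed
      ultimately show "e * s * ((f (x j) - f (y j)) - (x j - y j) * m j)
          \<le> s\<^sup>2 / (2 * K) * (deriv f (y j) - m j)\<^sup>2 + K * (x j - y j)\<^sup>2"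
        unfolding d_def[symmetric] g_def[symmetric] by linarith
    qed
    also have "\<dots> = q y + K * sq_dist {1..N} x y"
      by (simp add: q_def sq_dist_def sum.distrib sum_distrib_left)
    finally show ?thesis by simp
  qed
  have bound: "(\<integral>\<^sup>+x. ennreal (exp (e * (s * T x))) \<partial>\<mu>) \<le> ennreal (exp (1/2))" if "e = 1 \<or> e = -1" for e
    by (rule property_tau_centered_exp_le[OF tau', where q = q])
       (use T_int T_mean q_int q_mean main[OF that] in auto)
  have Tm [measurable]: "T \<in> borel_measurable \<mu>" using T_int by auto
  have e2: "exp (1/2) \<le> (2::real)"
  proof -
    have "(exp (1/2))\<^sup>2 \<le> (2::real)\<^sup>2" using exp_le by (simp add: power2_eq_square exp_add[symmetric])
    then show ?thesis by (rule power2_le_imp_le) auto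
  qed
  have "(\<integral>\<^sup>+x. ennreal (exp (\<kappa> / (2 * \<gamma>) * sqrt (real N) * \<bar>T x\<bar>)) \<partial>\<mu>)
      \<le> (\<integral>\<^sup>+x. ennreal 1 + ennreal (1/4) * (ennreal (exp (1 * (s * T x))) + ennreal (exp (-1 * (s * T x)))) \<partial>\<mu>)"
  proof (rule nn_integral_mono)
    fix x
    define v where "v = s * \<bar>T x\<bar> / 2"
    (* The arithmetic-geometric mean inequality in the form exp v <= 1 + exp (2 v) / 4. *)
    have "0 \<le> (exp v / 2 - 1)\<^sup>2" by simp
    then have "exp v \<le> 1 + 1/4 * exp (2 * v)"
      by (simp add: power2_eq_square algebra_simps exp_add[symmetric] mult_2)
    also have "exp (2 * v) \<le> exp (1 * (s * T x)) + exp (-1 * (s * T x))"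
      by (cases "T x \<ge> 0") (auto simp: v_def)
    finally have "exp v \<le> 1 + 1/4 * (exp (1 * (s * T x)) + exp (-1 * (s * T x)))" by simp
    then have "ennreal (exp v) \<le> ennreal (1 + 1/4 * (exp (1 * (s * T x)) + exp (-1 * (s * T x))))"
      by (rule ennreal_leI)
    also have "ennreal (1 + 1/4 * (a + b)) = ennreal 1 + ennreal (1/4) * (ennreal a + ennreal b)"
      if "0 \<le> a" "0 \<le> b" for a b :: real
      using that by (subst ennreal_plus, simp, simp, subst ennreal_mult, simp, simp, subst ennreal_plus, simp_all)
    finally show "ennreal (exp (\<kappa> / (2 * \<gamma>) * sqrt (real N) * \<bar>T x\<bar>))
      \<le> ennreal 1 + ennreal (1/4) * (ennreal (exp (1 * (s * T x))) + ennreal (exp (-1 * (s * T x))))"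
      by (simp add: v_def s_def mult_ac)
  qed
  also have "\<dots> = 1 + ennreal (1/4) * ((\<integral>\<^sup>+x. ennreal (exp (1 * (s * T x))) \<partial>\<mu>) + (\<integral>\<^sup>+x. ennreal (exp (-1 * (s * T x))) \<partial>\<mu>))"
    by (simp add: nn_integral_add nn_integral_cmult emeasure_space_1)
  also have "\<dots> \<le> 1 + ennreal (1/4) * (ennreal (exp (1/2)) + ennreal (exp (1/2)))"
    by (intro add_left_mono mult_left_mono add_mono bound) auto
  also have "\<dots> = ennreal (1 + 1/4 * (exp (1/2) + exp (1/2)))"
    by (subst ennreal_plus, simp, simp, subst ennreal_mult, simp, simp, subst ennreal_plus, simp_all)
  also have "\<dots> \<le> ennreal 2" using e2 by (intro ennreal_leI) simp
  finally show ?thesis by (simp add: T_def)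
qed

section \<open>Logarithmic Sobolev inequality implies property (tau) on the line\<close>

text \<open>
  The Hopf-Lax formula at time \<open>1 / (2 c)\<close>.
\<close>
definition inf_conv :: "real \<Rightarrow> (real \<Rightarrow> real) \<Rightarrow> real \<Rightarrow> real" where
  "inf_conv c g x = (INF y. g y + c * (x - y)\<^sup>2)"

context
  fixes c B :: real and g :: "real \<Rightarrow> real"
  assumes c: "c > 0" and B: "\<And>y. \<bar>g y\<bar> \<le> B"
begin

lemma inf_conv_lower: "inf_conv c g x \<le> g y + c * (x - y)\<^sup>2"
proof -
  have "bdd_below (range (\<lambda>y. g y + c * (x - y)\<^sup>2))"
  proof (rule bdd_belowI2)
    fix y
    have "0 \<le> c * (x - y)\<^sup>2" "- B \<le> g y" using c B[of y] by auto
    then show "- B \<le> g y + c * (x - y)\<^sup>2" by linarith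
  qed
  then show ?thesis unfolding inf_conv_def by (rule cINF_lower) simp
qed

lemma inf_conv_greatest: "(\<And>y. m \<le> g y + c * (x - y)\<^sup>2) \<Longrightarrow> m \<le> inf_conv c g x"
  unfolding inf_conv_def by (rule cINF_greatest) auto

lemma inf_conv_near:
  assumes "e > 0" obtains y where "g y + c * (x - y)\<^sup>2 < inf_conv c g x + e"
proof -
  have "Inf (range (\<lambda>y. g y + c * (x - y)\<^sup>2)) < inf_conv c g x + e"
    using assms unfolding inf_conv_def by simp
  from cInf_lessD[OF _ this] show ?thesis using that by blast
qed

lemma inf_conv_bounded: "\<bar>inf_conv c g x\<bar> \<le> B"
proof -
  have "inf_conv c g x \<le> g x" using inf_conv_lower[of x x] by simp
  moreover have "- B \<le> inf_conv c g x"
  proof (rule inf_conv_greatest)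
    fix y
    have "0 \<le> c * (x - y)\<^sup>2" "- B \<le> g y" using c B[of y] by auto
    then show "- B \<le> g y + c * (x - y)\<^sup>2" by linarith
  qed
  ultimately show ?thesis using B[of x] by (simp add: abs_le_iff)
qed

text \<open>
  The increment of an infimal convolution is governed by how far near-minimizers \<open>y\<close> at \<open>x'\<close> lie from
  \<open>x'\<close>: the same \<open>y\<close> is a competitor at \<open>x\<close>.
\<close>
lemma inf_conv_diff_le:
  assumes E: "\<And>e. e > 0 \<Longrightarrow> \<exists>y. g y + c * (x' - y)\<^sup>2 < inf_conv c g x' + e \<and> \<bar>x' - y\<bar> \<le> E + e"
  shows "inf_conv c g x - inf_conv c g x' \<le> c * \<bar>x - x'\<bar> * (2 * E + \<bar>x - x'\<bar>)"
proof (rule field_le_epsilon)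
  fix d :: real assume d: "d > 0"
  define e where "e = d / (1 + 2 * c * \<bar>x - x'\<bar>)"
  have pos: "1 + 2 * c * \<bar>x - x'\<bar> > 0" using c by (smt (verit) mult_nonneg_nonneg)
  then have e: "e > 0" "e * (1 + 2 * c * \<bar>x - x'\<bar>) = d" using d by (auto simp: e_def)
  obtain y where y: "g y + c * (x' - y)\<^sup>2 < inf_conv c g x' + e" "\<bar>x' - y\<bar> \<le> E + e"
    using E[OF e(1)] by blast
  have "inf_conv c g x - inf_conv c g x' \<le> c * ((x - y)\<^sup>2 - (x' - y)\<^sup>2) + e"
    using inf_conv_lower[of x y] y(1) by (simp add: right_diff_distrib)
  also have "(x - y)\<^sup>2 - (x' - y)\<^sup>2 = (x - x') * ((x - x') + 2 * (x' - y))"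
    by (simp add: power2_eq_square algebra_simps)
  also have "\<dots> \<le> \<bar>x - x'\<bar> * \<bar>(x - x') + 2 * (x' - y)\<bar>"
    by (metis abs_ge_self abs_mult)
  also have "\<dots> \<le> \<bar>x - x'\<bar> * (\<bar>x - x'\<bar> + 2 * (E + e))"
    using y(2) by (intro mult_left_mono) auto
  finally have "inf_conv c g x - inf_conv c g x' \<le> c * (\<bar>x - x'\<bar> * (\<bar>x - x'\<bar> + 2 * (E + e))) + e"
    using c by (simp add: mult_left_mono)
  also have "\<dots> = c * \<bar>x - x'\<bar> * (2 * E + \<bar>x - x'\<bar>) + e * (1 + 2 * c * \<bar>x - x'\<bar>)"
    by (simp add: algebra_simps)
  finally show "inf_conv c g x - inf_conv c g x' \<le> c * \<bar>x - x'\<bar> * (2 * E + \<bar>x - x'\<bar>) + d"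
    by (simp add: e)
qed

text \<open>
  Boundedness of \<open>g\<close> keeps every near-minimizer at bounded distance.
\<close>
lemma inf_conv_lipschitz_on_unit:
  assumes "\<bar>x - x'\<bar> \<le> 2"
  shows "\<bar>inf_conv c g x - inf_conv c g x'\<bar> \<le> c * (2 * sqrt ((2 * B + 1) / c) + 2) * \<bar>x - x'\<bar>"
proof -
  let ?E = "sqrt ((2 * B + 1) / c)"
  have "B \<ge> 0" using B[of 0] by linarith
  then have E0: "?E \<ge> 0" using c by simp
  have "\<exists>y. g y + c * (x - y)\<^sup>2 < inf_conv c g x + e \<and> \<bar>x - y\<bar> \<le> ?E + e" if "e > 0" for x e
  proof -
    obtain y where y: "g y + c * (x - y)\<^sup>2 < inf_conv c g x + min e 1"
      using inf_conv_near[of "min e 1" x] \<open>e > 0\<close> by auto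
    then have "c * (x - y)\<^sup>2 \<le> 2 * B + 1"
      using inf_conv_bounded[of x] B[of y] by linarith
    then have "(x - y)\<^sup>2 \<le> (2 * B + 1) / c" using c by (simp add: field_simps)
    then have "\<bar>x - y\<bar> \<le> ?E" using real_sqrt_le_mono by fastforce
    then show ?thesis using y \<open>e > 0\<close> by (intro exI[of _ y]) auto
  qed
  then have "inf_conv c g x - inf_conv c g x' \<le> c * \<bar>x - x'\<bar> * (2 * ?E + \<bar>x - x'\<bar>)"
    and "inf_conv c g x' - inf_conv c g x \<le> c * \<bar>x' - x\<bar> * (2 * ?E + \<bar>x' - x\<bar>)"
    by (intro inf_conv_diff_le; blast)+
  then have "\<bar>inf_conv c g x - inf_conv c g x'\<bar> \<le> c * \<bar>x - x'\<bar> * (2 * ?E + \<bar>x - x'\<bar>)"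
    by (simp add: abs_le_iff abs_minus_commute)
  also have "\<dots> \<le> c * \<bar>x - x'\<bar> * (2 * ?E + 2)" using assms c by (intro mult_left_mono) auto
  finally show ?thesis by (simp add: mult_ac)
qed

lemma inf_conv_continuous: "continuous_on UNIV (inf_conv c g)"
proof (rule continuous_at_imp_continuous_on, rule ballI)
  fix x :: real
  define L where "L = c * (2 * sqrt ((2 * B + 1) / c) + 2)"
  have "((\<lambda>x'. L * \<bar>x' - x\<bar>) \<longlongrightarrow> L * \<bar>x - x\<bar>) (at x)" by (intro tendsto_intros)
  then have lim: "((\<lambda>x'. L * \<bar>x' - x\<bar>) \<longlongrightarrow> 0) (at x)" by simp
  have "eventually (\<lambda>x'. norm (inf_conv c g x' - inf_conv c g x) \<le> L * \<bar>x' - x\<bar>) (at x)"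
    unfolding eventually_at using inf_conv_lipschitz_on_unit
    by (intro exI[of _ 1]) (auto simp: dist_real_def L_def)
  then have "((\<lambda>x'. inf_conv c g x' - inf_conv c g x) \<longlongrightarrow> 0) (at x)"
    using lim by (rule Lim_null_comparison)
  then show "isCont (inf_conv c g) x" unfolding isCont_def using LIM_zero_iff by blast
qed

end

lemma abs_exp_diff_le: "\<bar>exp a - exp b\<bar> \<le> max (exp a) (exp b) * \<bar>a - b\<bar>" for a b :: real
proof -
  have *: "exp a - exp b \<le> exp a * (a - b)" for a b :: real
  proof -
    have "exp a * (1 + (b - a)) \<le> exp a * exp (b - a)" by (intro mult_left_mono) auto
    then show ?thesis by (simp add: exp_add[symmetric] algebra_simps)
  qed
  show ?thesis
    using *[of a b] *[of b a] by (cases "a \<ge> b") (auto simp: max_def abs_if)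
qed

lemma exp_le_quadratic: "exp z \<le> 1 + z + z\<^sup>2" if "z \<le> 1" for z :: real
proof (cases "z \<ge> 0")
  case True then show ?thesis using that by (rule exp_bound)
next
  case False
  then have z: "z < 0" by simp
  have "exp z \<le> 1 / (1 - z)"
    using exp_ge_add_one_self[of "- z"] z by (simp add: exp_minus field_simps)
  also have "\<dots> \<le> 1 + z + z\<^sup>2"
  proof -
    have "1 \<le> (1 + z + z\<^sup>2) * (1 - z)"
      using z mult_nonpos_nonneg[of z "z\<^sup>2"] by (simp add: algebra_simps power2_eq_square)
    then show ?thesis using z by (simp add: pos_divide_le_eq)
  qed
  finally show ?thesis .
qed

locale log_sobolev_measure = prob_space \<nu> for \<nu> :: "real measure" +
  fixes s :: real
  assumes borel: "sets \<nu> = sets borel" and s: "s > 0" and lsi: "log_sobolev \<nu> s"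
begin

lemma continuous_measurable:
  "continuous_on UNIV (f :: real \<Rightarrow> real) \<Longrightarrow> f \<in> borel_measurable \<nu>"
  using borel_measurable_continuous_onI measurable_cong_sets[OF borel refl] by blast

context
  fixes h :: "real \<Rightarrow> real" and B :: real
  assumes h: "\<And>y. \<bar>h y\<bar> \<le> B"
begin

text \<open>
  Up to the factor \<open>k\<close>, this is the Hopf-Lax semigroup applied to \<open>h\<close> at time \<open>k s\<close>. Multiplied out in this
  way it is an infimum of functions that are affine in \<open>k\<close>, hence concave in \<open>k\<close>, and its \<open>k\<close>-derivative at
  \<open>x\<close> is, formally, \<open>h y\<close> for a minimizer \<open>y\<close>.
\<close>
definition U :: "real \<Rightarrow> real \<Rightarrow> real" where
  "U k = inf_conv (1 / (2 * s)) (\<lambda>y. k * h y)"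

lemma scaled_abs_le: "0 < k \<Longrightarrow> \<bar>k * h y\<bar> \<le> k * B"
  using h[of y] by (simp add: abs_mult)

lemma B_nonneg: "B \<ge> 0" using h[of 0] by linarith

lemma weight_pos: "1 / (2 * s) > 0" using s by simp

lemma U_bounded: "0 < k \<Longrightarrow> \<bar>U k x\<bar> \<le> k * B"
  unfolding U_def by (rule inf_conv_bounded[OF weight_pos scaled_abs_le])

lemma U_continuous: "0 < k \<Longrightarrow> continuous_on UNIV (U k)"
  unfolding U_def by (rule inf_conv_continuous[OF weight_pos scaled_abs_le])

lemma bounded_continuous_integrable:
  fixes f :: "real \<Rightarrow> real"
  assumes "continuous_on UNIV f" "\<And>x. \<bar>f x\<bar> \<le> C"
  shows "integrable \<nu> f"
  by (rule integrable_const_bound[where B = C]) (use assms continuous_measurable in auto)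

definition P :: "real \<Rightarrow> real" where "P k = (\<integral>x. exp (U k x) \<partial>\<nu>)"

lemma expU_integrable: "0 < k \<Longrightarrow> integrable \<nu> (\<lambda>x. exp (U k x))"
proof (rule bounded_continuous_integrable[where C = "exp (k * B)"])
  assume k: "0 < k"
  show "continuous_on UNIV (\<lambda>x. exp (U k x))" using U_continuous[OF k] by (intro continuous_intros) 
  show "\<bar>exp (U k x)\<bar> \<le> exp (k * B)" for x using U_bounded[OF k, of x] by (simp add: abs_le_iff)
qed

lemma P_pos: assumes "0 < k" shows "0 < P k"
proof -
  have "exp (- (k * B)) = (\<integral>x. exp (- (k * B)) \<partial>\<nu>)" by (simp add: prob_space)
  also have "\<dots> \<le> P k"
    unfolding P_def using U_bounded[OF assms] expU_integrable[OF assms]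
    by (intro integral_mono) (auto simp: abs_le_iff minus_le_iff)
  finally show ?thesis using exp_gt_zero by (rule order.strict_trans2[rotated])
qed

text \<open>
  A discrete Hamilton-Jacobi inequality. For a minimizer \<open>y\<close> at \<open>(k, x)\<close> the slope of \<open>U k\<close> at \<open>x\<close> is
  \<open>|x - y| / s\<close>, and \<open>(x - y)\<^sup>2 / (2 s) = U k x - k * h y\<close>. Using \<open>y\<close> as a competitor for \<open>U (k + \<delta>) x\<close>
  gives \<open>W x \<le> h y\<close>, which bounds the slope by \<open>sqrt (S x) / s\<close>. The increment quotient \<open>W\<close> in place of the
  derivative makes this bound continuous in \<open>x\<close>. The proof works with near-minimizers, as an arbitrary bounded
  \<open>h\<close> need not admit minimizers.
\<close>
lemma U_slope_bound:
  assumes k: "0 < k" and \<delta>: "0 < \<delta>"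
  defines "W \<equiv> \<lambda>x. (U (k + \<delta>) x - U k x) / \<delta>"
  defines "S \<equiv> \<lambda>x. 2 * s * (U k x - k * W x)"
  shows "0 \<le> S x" and "\<bar>U k x - U k x'\<bar> \<le> (2 * max (sqrt (S x)) (sqrt (S x')) + \<bar>x - x'\<bar>) / (2 * s) * \<bar>x - x'\<bar>"
proof -
  have near: "\<exists>y. k * h y + 1 / (2 * s) * (x - y)\<^sup>2 < U k x + e \<and> (x - y)\<^sup>2 \<le> S x + e\<^sup>2" if e: "e > 0" for e x
  proof -
    (* Small enough that an error of size e' in the minimization costs at most e^2 in the squared distance. *)
    define e' where "e' = min e (e\<^sup>2 / (2 * s * (1 + k / \<delta>)))"
    have pos: "2 * s * (1 + k / \<delta>) > 0" using k \<delta> s by (simp add: add_pos_pos)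
    then have e': "e' > 0" "e' \<le> e" using e by (auto simp: e'_def)
    have e'2: "e' * (2 * s * (1 + k / \<delta>)) \<le> e\<^sup>2"
    proof -
      have "e' \<le> e\<^sup>2 / (2 * s * (1 + k / \<delta>))" by (simp add: e'_def)
      then show ?thesis using pos by (simp add: pos_le_divide_eq)
    qed
    obtain y where y: "k * h y + 1 / (2 * s) * (x - y)\<^sup>2 < U k x + e'"
      using inf_conv_near[where g = "\<lambda>y. k * h y" and x = x, OF weight_pos scaled_abs_le[OF k] e'(1)] unfolding U_def by blast
    have "U (k + \<delta>) x \<le> (k + \<delta>) * h y + 1 / (2 * s) * (x - y)\<^sup>2"
      unfolding U_def using k \<delta> by (intro inf_conv_lower[OF weight_pos, of _ "(k+\<delta>) * B"] scaled_abs_le) auto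
    moreover have "\<delta> * W x = U (k + \<delta>) x - U k x" using \<delta> by (simp add: W_def)
    ultimately have "\<delta> * W x \<le> \<delta> * h y + e'" using y by (simp add: distrib_right)
    then have "W x - e' / \<delta> \<le> h y" using \<delta> by (simp add: field_simps)
    then have "k * (W x - e' / \<delta>) \<le> k * h y" using k by (intro mult_left_mono) auto
    then have "1 / (2 * s) * (x - y)\<^sup>2 \<le> U k x - k * W x + e' * (1 + k / \<delta>)"
      using y by (simp add: algebra_simps)
    then have "2 * s * (1 / (2 * s) * (x - y)\<^sup>2) \<le> 2 * s * (U k x - k * W x + e' * (1 + k / \<delta>))"
      using s by (intro mult_left_mono) auto
    then have "(x - y)\<^sup>2 \<le> S x + e' * (2 * s * (1 + k / \<delta>))"
      using s by (simp add: S_def algebra_simps)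
    then show ?thesis using y e' e'2 by (intro exI[of _ y]) auto
  qed
  have S0: "0 \<le> S x" for x
  proof (rule ccontr)
    assume *: "\<not> 0 \<le> S x"
    then have "sqrt (- S x / 2) > 0" by simp
    then obtain y where "(x - y)\<^sup>2 \<le> S x + (sqrt (- S x / 2))\<^sup>2" using near by blast
    then show False using * zero_le_power2[of "x - y"] by (simp del: zero_le_power2)
  qed
  then show "0 \<le> S x" .
  have near': "\<exists>y. k * h y + 1 / (2 * s) * (x - y)\<^sup>2 < U k x + e \<and> \<bar>x - y\<bar> \<le> sqrt (S x) + e" if e: "e > 0" for e x
  proof -
    obtain y where y: "k * h y + 1 / (2 * s) * (x - y)\<^sup>2 < U k x + e" "(x - y)\<^sup>2 \<le> S x + e\<^sup>2"
      using near[OF e] by blast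
    have "\<bar>x - y\<bar> \<le> sqrt (S x + e\<^sup>2)" using real_sqrt_le_mono[OF y(2)] by simp
    also have "\<dots> \<le> sqrt (S x) + sqrt (e\<^sup>2)" using S0 by (intro sqrt_add_le_add_sqrt) auto
    finally show ?thesis using y e by auto
  qed
  have "U k x - U k x' \<le> 1 / (2 * s) * \<bar>x - x'\<bar> * (2 * sqrt (S x') + \<bar>x - x'\<bar>)" for x x'
    unfolding U_def by (rule inf_conv_diff_le[OF weight_pos scaled_abs_le[OF k]]) (use near' in \<open>auto simp: U_def\<close>)
  then have *: "U k x - U k x' \<le> 1 / (2 * s) * \<bar>x - x'\<bar> * (2 * sqrt (S x') + \<bar>x - x'\<bar>)"
    "U k x' - U k x \<le> 1 / (2 * s) * \<bar>x - x'\<bar> * (2 * sqrt (S x) + \<bar>x - x'\<bar>)"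
    by (metis abs_minus_commute)+
  have "1 / (2 * s) * \<bar>x - x'\<bar> * (2 * sqrt (S z) + \<bar>x - x'\<bar>)
     \<le> 1 / (2 * s) * \<bar>x - x'\<bar> * (2 * max (sqrt (S x)) (sqrt (S x')) + \<bar>x - x'\<bar>)" if "z = x \<or> z = x'" for z
    using that s by (intro mult_left_mono) auto
  from this[of x] this[of x'] * have "\<bar>U k x - U k x'\<bar> \<le> 1 / (2 * s) * \<bar>x - x'\<bar> * (2 * max (sqrt (S x)) (sqrt (S x')) + \<bar>x - x'\<bar>)"
    by (simp add: abs_le_iff)
  then show "\<bar>U k x - U k x'\<bar> \<le> (2 * max (sqrt (S x)) (sqrt (S x')) + \<bar>x - x'\<bar>) / (2 * s) * \<bar>x - x'\<bar>"
    by (simp add: mult_ac)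
qed

text \<open>
  The logarithmic Sobolev inequality for \<open>exp (U k / 2)\<close>. Since \<open>U_slope_bound\<close> bounds the squared slope of
  this function by \<open>exp (U k x) * S x / (2 s)\<^sup>2\<close>, the terms \<open>U k * exp (U k)\<close> on both sides cancel.
\<close>
lemma entropy_bound:
  assumes k: "0 < k" and \<delta>: "0 < \<delta>"
  defines "W \<equiv> \<lambda>x. (U (k + \<delta>) x - U k x) / \<delta>"
  shows "k * (\<integral>x. W x * exp (U k x) \<partial>\<nu>) \<le> P k * ln (P k)"
proof -
  define S where "S x = 2 * s * (U k x - k * W x)" for x
  define u where "u x = exp (U k x / 2)" for x
  have k\<delta>: "0 < k + \<delta>" using k \<delta> by simp
  note Uc = U_continuous[OF k] U_continuous[OF k\<delta>]
  have Wc: "continuous_on UNIV W"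
    unfolding W_def using \<delta> by (intro continuous_intros Uc) auto
  have Sc: "continuous_on UNIV S" unfolding S_def by (intro continuous_intros Uc Wc)
  have S0: "0 \<le> S x" for x
    using U_slope_bound(1)[OF k \<delta>, of x] by (simp add: S_def W_def)
  have slope: "\<bar>U k x - U k x'\<bar> \<le> (2 * max (sqrt (S x)) (sqrt (S x')) + \<bar>x - x'\<bar>) / (2 * s) * \<bar>x - x'\<bar>" for x x'
    using U_slope_bound(2)[OF k \<delta>, of x x'] by (simp add: S_def W_def)
  have uc: "continuous_on UNIV u" unfolding u_def by (intro continuous_intros Uc) auto
  have u2: "(u x)\<^sup>2 = exp (U k x)" for x
    by (simp add: u_def power2_eq_square exp_add[symmetric])
  have Wb: "\<bar>W x\<bar> \<le> ((k + \<delta>) * B + k * B) / \<delta>" for x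
    using U_bounded[OF k, of x] U_bounded[OF k\<delta>, of x] \<delta>
    by (auto simp: W_def abs_divide intro!: divide_right_mono)
  have ub: "exp (U k x) \<le> exp (k * B)" for x using U_bounded[OF k, of x] by (simp add: abs_le_iff)
  have iU: "integrable \<nu> (\<lambda>x. exp (U k x))" by (rule expU_integrable[OF k])
  have bounded_mult_exp: "integrable \<nu> (\<lambda>x. f x * exp (U k x))"
    if "continuous_on UNIV f" and f: "\<And>x. \<bar>f x\<bar> \<le> C" for f C
  proof (rule bounded_continuous_integrable[where C = "C * exp (k * B)"])
    show "continuous_on UNIV (\<lambda>x. f x * exp (U k x))" by (intro continuous_intros Uc that)
    show "\<bar>f x * exp (U k x)\<bar> \<le> C * exp (k * B)" for x
      unfolding abs_mult abs_exp_cancel using f[of x] ub[of x] by (intro mult_mono) auto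
  qed
  have iUU: "integrable \<nu> (\<lambda>x. U k x * exp (U k x))"
    by (rule bounded_mult_exp[OF Uc(1) U_bounded[OF k]])
  have iW: "integrable \<nu> (\<lambda>x. W x * exp (U k x))"
    by (rule bounded_mult_exp[OF Wc Wb])
  have ll: "locally_lipschitz u"
    unfolding locally_lipschitz_def
  proof
    fix x :: real
    define L where "L = 1 / (2 * s) * (2 * sqrt ((2 * (k * B) + 1) / (1 / (2 * s))) + 2)"
    have L0: "L \<ge> 0" using s B_nonneg k by (simp add: L_def)
    have "(exp (k * B) * L)-lipschitz_on (cball x 1) u"
    proof (rule lipschitz_onI)
      fix y z assume "y \<in> cball x 1" "z \<in> cball x 1"
      then have yz: "\<bar>y - z\<bar> \<le> 2" by (auto simp: dist_real_def)
      have "\<bar>u y - u z\<bar> \<le> max (u y) (u z) * \<bar>U k y / 2 - U k z / 2\<bar>"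
        unfolding u_def by (rule abs_exp_diff_le)
      also have "\<dots> \<le> exp (k * B) * (L * \<bar>y - z\<bar>)"
      proof (rule mult_mono)
        have "\<bar>U k y\<bar> \<le> k * B" "\<bar>U k z\<bar> \<le> k * B" using U_bounded[OF k] by auto
        then show "max (u y) (u z) \<le> exp (k * B)" by (auto simp: u_def abs_le_iff)
        have "\<bar>U k y - U k z\<bar> \<le> L * \<bar>y - z\<bar>"
          unfolding L_def U_def by (rule inf_conv_lipschitz_on_unit[OF weight_pos scaled_abs_le[OF k] yz])
        moreover have "\<bar>U k y / 2 - U k z / 2\<bar> \<le> \<bar>U k y - U k z\<bar>" by linarith
        ultimately show "\<bar>U k y / 2 - U k z / 2\<bar> \<le> L * \<bar>y - z\<bar>" by linarith
      qed auto
      finally show "dist (u y) (u z) \<le> exp (k * B) * L * dist y z" by (simp add: dist_real_def)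
    qed (use L0 in auto)
    then show "\<exists>r>0. \<exists>L. L-lipschitz_on (cball x r) u" by (intro exI[of _ 1]) auto
  qed
  have ad: "(abs_deriv u x)\<^sup>2 \<le> ennreal (exp (U k x) * (S x / (2 * s)\<^sup>2))" for x
  proof -
    (* A continuous majorant of the difference quotient, so that its limit at x bounds the limit superior. *)
    define r where "r y = max (u y) (u x) * ((2 * max (sqrt (S y)) (sqrt (S x)) + \<bar>y - x\<bar>) / (4 * s))" for y
    have rc: "continuous_on UNIV r" unfolding r_def by (intro continuous_intros uc Sc) (use s in auto)
    then have "(r \<longlongrightarrow> r x) (at x)" by (simp add: continuous_on_def)
    then have lim: "((\<lambda>y. ennreal (r y)) \<longlongrightarrow> ennreal (r x)) (at x)" by (rule tendsto_ennrealI)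
    have "abs_deriv u x \<le> Limsup (at x) (\<lambda>y. ennreal (r y))"
      unfolding abs_deriv_def
    proof (rule Limsup_mono)
      show "eventually (\<lambda>y. ennreal (\<bar>u y - u x\<bar> / \<bar>y - x\<bar>) \<le> ennreal (r y)) (at x)"
      proof (rule eventually_at_topological[THEN iffD2], intro exI[of _ UNIV] conjI ballI impI)
        fix y assume "y \<noteq> x"
        have "\<bar>u y - u x\<bar> \<le> max (u y) (u x) * \<bar>U k y / 2 - U k x / 2\<bar>"
          unfolding u_def by (rule abs_exp_diff_le)
        also have "\<bar>U k y / 2 - U k x / 2\<bar> = \<bar>U k y - U k x\<bar> / 2" by (simp add: abs_if)
        also have "max (u y) (u x) * (\<bar>U k y - U k x\<bar> / 2)
          \<le> max (u y) (u x) * (((2 * max (sqrt (S y)) (sqrt (S x)) + \<bar>y - x\<bar>) / (2 * s) * \<bar>y - x\<bar>) / 2)"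
          using slope[of y x] by (intro mult_left_mono divide_right_mono) (auto simp: u_def max_def)
        also have "\<dots> = r y * \<bar>y - x\<bar>" by (simp add: r_def)
        finally have "\<bar>u y - u x\<bar> / \<bar>y - x\<bar> \<le> r y" using \<open>y \<noteq> x\<close> by (simp add: field_simps)
        then show "ennreal (\<bar>u y - u x\<bar> / \<bar>y - x\<bar>) \<le> ennreal (r y)" by (rule ennreal_leI)
      qed auto
    qed
    also have "\<dots> = ennreal (r x)" by (rule lim_imp_Limsup[OF _ lim]) simp
    finally have "(abs_deriv u x)\<^sup>2 \<le> (ennreal (r x))\<^sup>2" by (rule power_mono) simp
    also have "\<dots> = ennreal ((r x)\<^sup>2)" using S0[of x] s by (intro ennreal_power) (auto simp: r_def u_def)
    also have "r x = u x * sqrt (S x) / (2 * s)" by (simp add: r_def)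
    also have "\<dots>\<^sup>2 = exp (U k x) * (S x / (2 * s)\<^sup>2)"
      using S0[of x] by (simp add: power_mult_distrib power_divide u2)
    finally show ?thesis .
  qed
  have nonneg: "0 \<le> U k x * exp (U k x) - k * (W x * exp (U k x))" for x
  proof -
    have "0 \<le> U k x - k * W x" using S0[of x] s by (simp add: S_def zero_le_mult_iff)
    then have "0 \<le> (U k x - k * W x) * exp (U k x)" by simp
    then show ?thesis by (simp add: algebra_simps)
  qed
  have ent: "entropy_functional \<nu> (\<lambda>x. (u x)\<^sup>2) = (\<integral>x. U k x * exp (U k x) \<partial>\<nu>) - P k * ln (P k)"
    by (simp add: entropy_functional_def u2 P_def mult.commute)
  have "ennreal (entropy_functional \<nu> (\<lambda>x. (u x)\<^sup>2)) \<le> ennreal (2 * s) * (\<integral>\<^sup>+x. (abs_deriv u x)\<^sup>2 \<partial>\<nu>)"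
  proof -
    have "integrable \<nu> (\<lambda>x. (u x)\<^sup>2)" using iU by (simp add: u2)
    moreover have "integrable \<nu> (\<lambda>x. (u x)\<^sup>2 * ln ((u x)\<^sup>2))" using iUU by (simp add: u2 mult.commute)
    ultimately show ?thesis using lsi ll unfolding log_sobolev_def by blast
  qed
  also have "\<dots> \<le> ennreal (2 * s) * (\<integral>\<^sup>+x. ennreal (exp (U k x) * (S x / (2 * s)\<^sup>2)) \<partial>\<nu>)"
    by (intro mult_left_mono nn_integral_mono ad) auto
  also have "\<dots> = (\<integral>\<^sup>+x. ennreal (2 * s) * ennreal (exp (U k x) * (S x / (2 * s)\<^sup>2)) \<partial>\<nu>)"
    by (rule nn_integral_cmult[symmetric])
       (intro measurable_compose[OF _ measurable_ennreal] continuous_measurable continuous_intros Uc Sc, use s in auto)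
  also have "\<dots> = (\<integral>\<^sup>+x. ennreal (U k x * exp (U k x) - k * (W x * exp (U k x))) \<partial>\<nu>)"
  proof (rule nn_integral_cong)
    fix x
    have "2 * s * (exp (U k x) * (S x / (2 * s)\<^sup>2)) = U k x * exp (U k x) - k * (W x * exp (U k x))"
      using s by (simp add: S_def power2_eq_square field_simps)
    then show "ennreal (2 * s) * ennreal (exp (U k x) * (S x / (2 * s)\<^sup>2)) = ennreal (U k x * exp (U k x) - k * (W x * exp (U k x)))"
      using s S0[of x] by (simp add: ennreal_mult[symmetric])
  qed
  also have "\<dots> = ennreal (\<integral>x. U k x * exp (U k x) - k * (W x * exp (U k x)) \<partial>\<nu>)"
  proof (rule nn_integral_eq_integral)
    show "AE x in \<nu>. 0 \<le> U k x * exp (U k x) - k * (W x * exp (U k x))"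
      using nonneg by (intro AE_I2)
  qed (use iUU iW in auto)
  finally have le: "ennreal (entropy_functional \<nu> (\<lambda>x. (u x)\<^sup>2)) \<le> ennreal (\<integral>x. U k x * exp (U k x) - k * (W x * exp (U k x)) \<partial>\<nu>)" .
  have nn: "0 \<le> (\<integral>x. U k x * exp (U k x) - k * (W x * exp (U k x)) \<partial>\<nu>)"
    using nonneg by (intro integral_nonneg_AE AE_I2)
  have "entropy_functional \<nu> (\<lambda>x. (u x)\<^sup>2) \<le> (\<integral>x. U k x * exp (U k x) - k * (W x * exp (U k x)) \<partial>\<nu>)"
    using le nn by (simp add: ennreal_le_iff2) (smt (verit))
  also have "\<dots> = (\<integral>x. U k x * exp (U k x) \<partial>\<nu>) - k * (\<integral>x. W x * exp (U k x) \<partial>\<nu>)"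
    using iUU iW by simp
  finally show ?thesis unfolding ent by simp
qed

text \<open>
  With \<open>\<delta> \<rightarrow> 0\<close> this says that \<open>ln (P k) / k\<close> decreases in \<open>k\<close>. The error is quadratic in \<open>\<delta>\<close> with an explicit
  constant, so that the steps can be summed.
\<close>
lemma log_P_step:
  assumes k: "0 < k" and \<delta>: "0 < \<delta>" and small: "\<delta> * B \<le> 1"
  shows "ln (P (k + \<delta>)) / (k + \<delta>) \<le> ln (P k) / k + \<delta>\<^sup>2 * B\<^sup>2 / (k + \<delta>)"
proof -
  define W where "W x = (U (k + \<delta>) x - U k x) / \<delta>" for x
  have k\<delta>: "0 < k + \<delta>" using k \<delta> by simp
  have UW: "U (k + \<delta>) x = U k x + \<delta> * W x" for x using \<delta> by (simp add: W_def)
  have WB: "\<bar>\<delta> * W x\<bar> \<le> \<delta> * B" for x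
  proof -
    have "U (k + \<delta>) x - \<delta> * B \<le> U k x"
      unfolding U_def
    proof (rule inf_conv_greatest[OF weight_pos scaled_abs_le[OF k]])
      fix y
      have "inf_conv (1 / (2 * s)) (\<lambda>y. (k + \<delta>) * h y) x \<le> (k + \<delta>) * h y + 1 / (2 * s) * (x - y)\<^sup>2"
        by (rule inf_conv_lower[OF weight_pos scaled_abs_le[OF k\<delta>]])
      also have "\<dots> \<le> k * h y + \<delta> * B + 1 / (2 * s) * (x - y)\<^sup>2"
        using h[of y] \<delta> by (simp add: distrib_right abs_le_iff)
      finally show "inf_conv (1 / (2 * s)) (\<lambda>y. (k + \<delta>) * h y) x - \<delta> * B \<le> k * h y + 1 / (2 * s) * (x - y)\<^sup>2" by simp
    qed
    moreover have "U k x - \<delta> * B \<le> U (k + \<delta>) x"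
      unfolding U_def
    proof (rule inf_conv_greatest[OF weight_pos scaled_abs_le[OF k\<delta>]])
      fix y
      have "inf_conv (1 / (2 * s)) (\<lambda>y. k * h y) x \<le> k * h y + 1 / (2 * s) * (x - y)\<^sup>2"
        by (rule inf_conv_lower[OF weight_pos scaled_abs_le[OF k]])
      also have "\<dots> \<le> (k + \<delta>) * h y + \<delta> * B + 1 / (2 * s) * (x - y)\<^sup>2"
        using mult_left_mono[of "- h y" B \<delta>] h[of y] \<delta> by (simp add: distrib_right abs_le_iff)
      finally show "inf_conv (1 / (2 * s)) (\<lambda>y. k * h y) x - \<delta> * B \<le> (k + \<delta>) * h y + 1 / (2 * s) * (x - y)\<^sup>2" by simp
    qed
    ultimately show ?thesis by (simp add: UW abs_le_iff)
  qed
  have Wc: "continuous_on UNIV W" unfolding W_def using \<delta> by (intro continuous_intros U_continuous k k\<delta>) auto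
  have iW: "integrable \<nu> (\<lambda>x. W x * exp (U k x))"
  proof (rule bounded_continuous_integrable[where C = "B * exp (k * B)"])
    show "continuous_on UNIV (\<lambda>x. W x * exp (U k x))" by (intro continuous_intros U_continuous k Wc)
    fix x
    have "\<bar>W x\<bar> \<le> B" using WB[of x] \<delta> by (simp add: abs_mult)
    moreover have "exp (U k x) \<le> exp (k * B)" using U_bounded[OF k, of x] by (simp add: abs_le_iff)
    ultimately show "\<bar>W x * exp (U k x)\<bar> \<le> B * exp (k * B)" by (auto simp: abs_mult intro!: mult_mono)
  qed
  have "P (k + \<delta>) \<le> (\<integral>x. (1 + \<delta>\<^sup>2 * B\<^sup>2) * exp (U k x) + \<delta> * (W x * exp (U k x)) \<partial>\<nu>)"
    unfolding P_def
  proof (rule integral_mono)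
    fix x
    have "exp (\<delta> * W x) \<le> 1 + \<delta> * W x + (\<delta> * W x)\<^sup>2"
      using WB[of x] small by (intro exp_le_quadratic) linarith
    also have "(\<delta> * W x)\<^sup>2 \<le> \<delta>\<^sup>2 * B\<^sup>2"
      using power_mono[OF WB[of x], of 2] by (simp add: power_mult_distrib)
    finally have "exp (U k x) * exp (\<delta> * W x) \<le> exp (U k x) * (1 + \<delta> * W x + \<delta>\<^sup>2 * B\<^sup>2)"
      by (simp add: mult_left_mono)
    then show "exp (U (k + \<delta>) x) \<le> (1 + \<delta>\<^sup>2 * B\<^sup>2) * exp (U k x) + \<delta> * (W x * exp (U k x))"
      unfolding UW by (simp add: exp_add algebra_simps)
  qed (use iW expU_integrable k k\<delta> in auto)
  also have "\<dots> = (1 + \<delta>\<^sup>2 * B\<^sup>2) * P k + \<delta> * (\<integral>x. W x * exp (U k x) \<partial>\<nu>)"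
    using iW expU_integrable[OF k] by (simp add: P_def)
  also have "(\<integral>x. W x * exp (U k x) \<partial>\<nu>) \<le> P k * ln (P k) / k"
    using entropy_bound[OF k \<delta>] k by (simp add: W_def field_simps)
  finally have "P (k + \<delta>) \<le> (1 + \<delta>\<^sup>2 * B\<^sup>2) * P k + \<delta> * (P k * ln (P k) / k)"
    using \<delta> by (simp add: mult_left_mono)
  also have "\<dots> = P k * (1 + (\<delta>\<^sup>2 * B\<^sup>2 + \<delta> / k * ln (P k)))" by (simp add: algebra_simps)
  also have "\<dots> \<le> P k * exp (\<delta>\<^sup>2 * B\<^sup>2 + \<delta> / k * ln (P k))"
    using P_pos[OF k] by (intro mult_left_mono exp_ge_add_one_self) auto
  finally have "ln (P (k + \<delta>)) \<le> ln (P k * exp (\<delta>\<^sup>2 * B\<^sup>2 + \<delta> / k * ln (P k)))"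
    using P_pos[OF k\<delta>] by (subst ln_le_cancel_iff) (auto intro: mult_pos_pos P_pos k)
  also have "\<dots> = (k + \<delta>) * (ln (P k) / k) + \<delta>\<^sup>2 * B\<^sup>2"
    using P_pos[OF k] k by (simp add: ln_mult field_simps)
  finally have "ln (P (k + \<delta>)) / (k + \<delta>) \<le> ((k + \<delta>) * (ln (P k) / k) + \<delta>\<^sup>2 * B\<^sup>2) / (k + \<delta>)"
    using k\<delta> by (intro divide_right_mono) auto
  also have "\<dots> = ln (P k) / k + \<delta>\<^sup>2 * B\<^sup>2 / (k + \<delta>)" using k\<delta> by (simp add: add_divide_distrib del: times_divide_eq_right)
  finally show ?thesis .
qed

text \<open>
  At \<open>k = i / n\<close> the error of one step of length \<open>1 / n\<close> is \<open>B\<^sup>2 / n\<close> times \<open>1 / (i + 1)\<close>; the harmonic sum is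
  bounded by the logarithm.
\<close>
lemma log_P_telescope:
  assumes n: "n > 0" "B \<le> real n" and i: "i \<ge> 1"
  shows "ln (P (real i / real n)) / (real i / real n) \<le> ln (P (1 / real n)) / (1 / real n) + B\<^sup>2 / real n * ln (real i)"
  using i
proof (induction i rule: dec_induct)
  case base then show ?case by simp
next
  case (step i)
  have "ln (P (real i / real n + 1 / real n)) / (real i / real n + 1 / real n)
     \<le> ln (P (real i / real n)) / (real i / real n) + (1 / real n)\<^sup>2 * B\<^sup>2 / (real i / real n + 1 / real n)"
    by (rule log_P_step) (use n step in auto)
  also have "real i / real n + 1 / real n = real (Suc i) / real n" by (simp add: add_divide_distrib)
  also have "(1 / real n)\<^sup>2 * B\<^sup>2 / (real (Suc i) / real n) = B\<^sup>2 / real n * (1 / real (Suc i))"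
    using n by (simp add: power2_eq_square field_simps)
  also have "B\<^sup>2 / real n * (1 / real (Suc i)) \<le> B\<^sup>2 / real n * (ln (real (Suc i)) - ln (real i))"
  proof -
    have "ln (real i / real (Suc i)) \<le> real i / real (Suc i) - 1"
      using step by (intro ln_le_minus_one) auto
    then have "1 / real (Suc i) \<le> ln (real (Suc i)) - ln (real i)"
      using step by (simp add: ln_div field_simps)
    then show ?thesis by (rule mult_left_mono) simp
  qed
  finally have "ln (P (real (Suc i) / real n)) / (real (Suc i) / real n)
     \<le> ln (P (real i / real n)) / (real i / real n) + B\<^sup>2 / real n * (ln (real (Suc i)) - ln (real i))"
    by simp
  then show ?case using step.IH by (simp add: right_diff_distrib)
qed

lemma log_P_initial:
  assumes n: "n > 0" "B \<le> real n" and m: "h \<in> borel_measurable \<nu>"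
  shows "ln (P (1 / real n)) / (1 / real n) \<le> (\<integral>x. h x \<partial>\<nu>) + B\<^sup>2 / real n"
proof -
  have n': "0 < 1 / real n" using n by simp
  have ih: "integrable \<nu> h" by (rule integrable_const_bound[where B = B]) (use h m in auto)
  have "P (1 / real n) \<le> (\<integral>x. 1 + h x / real n + B\<^sup>2 / (real n)\<^sup>2 \<partial>\<nu>)"
    unfolding P_def
  proof (rule integral_mono)
    fix x
    have "U (1 / real n) x \<le> 1 / real n * h x + 1 / (2 * s) * (x - x)\<^sup>2"
      unfolding U_def by (rule inf_conv_lower[OF weight_pos scaled_abs_le[OF n']])
    then have "exp (U (1 / real n) x) \<le> exp (h x / real n)" by simp
    also have "\<dots> \<le> 1 + h x / real n + (h x / real n)\<^sup>2"
      using h[of x] n by (intro exp_le_quadratic) auto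
    also have "(h x / real n)\<^sup>2 \<le> B\<^sup>2 / (real n)\<^sup>2"
      using power_mono[OF h[of x], of 2] by (simp add: power_divide divide_right_mono)
    finally show "exp (U (1 / real n) x) \<le> 1 + h x / real n + B\<^sup>2 / (real n)\<^sup>2" by simp
  qed (use ih expU_integrable[OF n'] in auto)
  also have "\<dots> = 1 + ((\<integral>x. h x \<partial>\<nu>) / real n + B\<^sup>2 / (real n)\<^sup>2)" using ih by (simp add: prob_space)
  finally have "P (1 / real n) - 1 \<le> (\<integral>x. h x \<partial>\<nu>) / real n + B\<^sup>2 / (real n)\<^sup>2" by simp
  moreover have "ln (P (1 / real n)) \<le> P (1 / real n) - 1" by (rule ln_le_minus_one[OF P_pos[OF n']])
  ultimately have "ln (P (1 / real n)) * real n \<le> ((\<integral>x. h x \<partial>\<nu>) / real n + B\<^sup>2 / (real n)\<^sup>2) * real n"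
    using n by (intro mult_right_mono) auto
  also have "\<dots> = (\<integral>x. h x \<partial>\<nu>) + B\<^sup>2 / real n" using n by (simp add: field_simps power2_eq_square)
  finally show ?thesis by simp
qed

text \<open>
  The dual form of the quadratic transport-entropy inequality: \<open>ln (P k) / k\<close> decreases from its limit
  \<open>\<integral>h d\<nu>\<close> at \<open>k = 0\<close> to \<open>ln (P 1)\<close>. The total error \<open>(B\<^sup>2 + B\<^sup>2 ln n) / n\<close> of the steps of length \<open>1 / n\<close>
  tends to \<open>0\<close>.
\<close>
lemma transport_dual:
  assumes m: "h \<in> borel_measurable \<nu>"
  shows "(\<integral>\<^sup>+x. ennreal (exp (inf_conv (1 / (2 * s)) h x)) \<partial>\<nu>) \<le> ennreal (exp (\<integral>x. h x \<partial>\<nu>))"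
proof -
  have "ln (P 1) \<le> (\<integral>x. h x \<partial>\<nu>)"
  proof (rule tendsto_lowerbound)
    have "(\<lambda>n. ln (real n) / real n) \<longlonglongrightarrow> 0" by (rule lim_ln_over_n)
    moreover have "(\<lambda>n. 1 / real n) \<longlonglongrightarrow> 0" by (rule lim_1_over_n)
    ultimately have "(\<lambda>n. (\<integral>x. h x \<partial>\<nu>) + B\<^sup>2 * (1 / real n) + B\<^sup>2 * (ln (real n) / real n)) \<longlonglongrightarrow> (\<integral>x. h x \<partial>\<nu>) + B\<^sup>2 * 0 + B\<^sup>2 * 0"
      by (intro tendsto_intros)
    then show "(\<lambda>n. (\<integral>x. h x \<partial>\<nu>) + B\<^sup>2 * (1 / real n) + B\<^sup>2 * (ln (real n) / real n)) \<longlonglongrightarrow> (\<integral>x. h x \<partial>\<nu>)" by simp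
    show "\<forall>\<^sub>F n in sequentially. ln (P 1) \<le> (\<integral>x. h x \<partial>\<nu>) + B\<^sup>2 * (1 / real n) + B\<^sup>2 * (ln (real n) / real n)"
    proof (rule eventually_sequentiallyI)
      fix n :: nat assume "n \<ge> max 1 (nat \<lceil>B\<rceil>)"
      then have n: "n > 0" "B \<le> real n" by linarith+
      show "ln (P 1) \<le> (\<integral>x. h x \<partial>\<nu>) + B\<^sup>2 * (1 / real n) + B\<^sup>2 * (ln (real n) / real n)"
        using log_P_telescope[OF n, of n] log_P_initial[OF n m] n by simp
    qed
  qed simp
  then have "P 1 \<le> exp (\<integral>x. h x \<partial>\<nu>)" using P_pos[of 1] exp_le_cancel_iff[of "ln (P 1)"] by simp
  moreover have "(\<integral>\<^sup>+x. ennreal (exp (inf_conv (1 / (2 * s)) h x)) \<partial>\<nu>) = ennreal (P 1)"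
    using expU_integrable[of 1] by (simp add: P_def U_def nn_integral_eq_integral)
  ultimately show ?thesis by (simp add: ennreal_leI)
qed

end

text \<open>
  Apply \<open>transport_dual\<close> to the infimal convolution \<open>h\<close> of \<open>g\<close> and to \<open>- h\<close>, and multiply the two bounds. The
  way from \<open>x\<close> to \<open>y\<close> is thus split at a point \<open>z\<close> where \<open>h\<close> is evaluated. As
  \<open>(x - y)\<^sup>2 \<le> 2 (x - z)\<^sup>2 + 2 (z - y)\<^sup>2\<close>, the constant of the resulting cost is half of the one for either leg.
\<close>
lemma property_tau_bounded:
  fixes F :: "real \<Rightarrow> ennreal" and g :: "real \<Rightarrow> real"
  assumes g: "\<And>y. \<bar>g y\<bar> \<le> B"
    and F: "\<And>x y. F x \<le> ennreal (exp (g y + (x - y)\<^sup>2 / (4 * s)))"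
  shows "(\<integral>\<^sup>+x. F x \<partial>\<nu>) * (\<integral>\<^sup>+y. ennreal (exp (- g y)) \<partial>\<nu>) \<le> 1"
proof -
  let ?c = "1 / (2 * s)"
  have c: "?c > 0" using s by simp
  define h where "h = inf_conv ?c g"
  have hB: "\<bar>h y\<bar> \<le> B" for y unfolding h_def by (rule inf_conv_bounded[OF c g])
  have hm: "h \<in> borel_measurable \<nu>"
    unfolding h_def by (intro continuous_measurable inf_conv_continuous[OF c g])
  have "(\<integral>\<^sup>+x. F x \<partial>\<nu>) \<le> (\<integral>\<^sup>+x. ennreal (exp (inf_conv ?c h x)) \<partial>\<nu>)"
  proof (rule nn_integral_mono)
    fix x
    show "F x \<le> ennreal (exp (inf_conv ?c h x))"
    proof (cases "F x = 0")
      case False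
      have "F x < \<infinity>" using F[of x x] by (rule order.strict_trans1) simp
      then obtain r where r: "F x = ennreal r" "r > 0"
        using False by (cases "F x") (auto simp: less_le)
      have lnr: "ln r \<le> g y + (x - y)\<^sup>2 / (4 * s)" for y
        using F[of x y] r by (simp add: ln_le_cancel_iff[symmetric] ln_ge_iff[symmetric])
      have "ln r \<le> inf_conv ?c h x"
      proof (rule inf_conv_greatest[OF c hB])
        fix z
        have "ln r - ?c * (x - z)\<^sup>2 \<le> h z"
          unfolding h_def
        proof (rule inf_conv_greatest[OF c g])
          fix y
          have "(x - y)\<^sup>2 \<le> 2 * (x - z)\<^sup>2 + 2 * (z - y)\<^sup>2"
            using zero_le_power2[of "(x - z) - (z - y)"] by (simp add: power2_eq_square algebra_simps)
          then have "(x - y)\<^sup>2 / (4 * s) \<le> (2 * (x - z)\<^sup>2 + 2 * (z - y)\<^sup>2) / (4 * s)"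
            using s by (intro divide_right_mono) auto
          also have "\<dots> = ?c * (x - z)\<^sup>2 + ?c * (z - y)\<^sup>2" using s by (simp add: field_simps)
          finally show "ln r - ?c * (x - z)\<^sup>2 \<le> g y + ?c * (z - y)\<^sup>2" using lnr[of y] by simp
        qed
        then show "ln r \<le> h z + ?c * (x - z)\<^sup>2" by simp
      qed
      then have "r \<le> exp (inf_conv ?c h x)" using r by (metis exp_le_cancel_iff exp_ln)
      then show ?thesis using r by (simp add: ennreal_leI)
    qed simp
  qed
  also have "\<dots> \<le> ennreal (exp (\<integral>x. h x \<partial>\<nu>))" by (rule transport_dual[OF hB hm])
  finally have 1: "(\<integral>\<^sup>+x. F x \<partial>\<nu>) \<le> ennreal (exp (\<integral>x. h x \<partial>\<nu>))" .
  have hB': "\<bar>- h y\<bar> \<le> B" for y using hB by simp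
  have "(\<integral>\<^sup>+y. ennreal (exp (- g y)) \<partial>\<nu>) \<le> (\<integral>\<^sup>+x. ennreal (exp (inf_conv ?c (\<lambda>y. - h y) x)) \<partial>\<nu>)"
  proof (intro nn_integral_mono ennreal_leI)
    fix y
    have "- g y \<le> inf_conv ?c (\<lambda>y. - h y) y"
    proof (rule inf_conv_greatest[OF c hB'])
      fix z
      have "h z \<le> g y + ?c * (z - y)\<^sup>2" unfolding h_def by (rule inf_conv_lower[OF c g])
      then show "- g y \<le> - h z + ?c * (y - z)\<^sup>2" by (simp add: power2_commute)
    qed
    then show "exp (- g y) \<le> exp (inf_conv ?c (\<lambda>y. - h y) y)" by simp
  qed
  also have "\<dots> \<le> ennreal (exp (\<integral>x. - h x \<partial>\<nu>))"
    by (rule transport_dual[OF hB']) (use hm in auto)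
  finally have 2: "(\<integral>\<^sup>+y. ennreal (exp (- g y)) \<partial>\<nu>) \<le> ennreal (exp (- (\<integral>x. h x \<partial>\<nu>)))" by simp
  have "(\<integral>\<^sup>+x. F x \<partial>\<nu>) * (\<integral>\<^sup>+y. ennreal (exp (- g y)) \<partial>\<nu>) \<le> ennreal (exp (\<integral>x. h x \<partial>\<nu>)) * ennreal (exp (- (\<integral>x. h x \<partial>\<nu>)))"
    by (intro mult_mono 1 2) auto
  also have "\<dots> = 1" by (simp add: ennreal_mult[symmetric] exp_add[symmetric])
  finally show ?thesis .
qed

end

lemma SUP_min_of_nat: "(SUP k::nat. min a (of_nat k)) = (a::ennreal)"
proof -
  have "(SUP k::nat. inf a (of_nat k)) = inf a (SUP k::nat. of_nat k)" by (rule inf_SUP[symmetric])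
  then show ?thesis by (simp add: inf_min ennreal_SUP_of_nat_eq_top)
qed

lemma nn_integral_mult_le_truncation:
  fixes F G :: "'a \<Rightarrow> ennreal"
  assumes [measurable]: "F \<in> borel_measurable M" "G \<in> borel_measurable M'"
    and le: "\<And>k::nat. k \<ge> 1 \<Longrightarrow> (\<integral>\<^sup>+x. min (F x) (of_nat k) \<partial>M) * (\<integral>\<^sup>+x. min (G x) (of_nat k) \<partial>M') \<le> C"
  shows "(\<integral>\<^sup>+x. F x \<partial>M) * (\<integral>\<^sup>+x. G x \<partial>M') \<le> C"
proof -
  have sup: "(\<integral>\<^sup>+x. F x \<partial>M) = (SUP k::nat. \<integral>\<^sup>+x. min (F x) (of_nat k) \<partial>M)"
    if [measurable]: "F \<in> borel_measurable M" for F and M :: "'a measure"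
  proof -
    have "incseq (\<lambda>k x. min (F x) (of_nat k))"
      unfolding incseq_def le_fun_def by (intro allI impI min.mono order_refl of_nat_mono)
    then have "(\<integral>\<^sup>+x. (SUP k::nat. min (F x) (of_nat k)) \<partial>M) = (SUP k::nat. \<integral>\<^sup>+x. min (F x) (of_nat k) \<partial>M)"
      by (intro nn_integral_monotone_convergence_SUP) auto
    then show ?thesis by (simp add: SUP_min_of_nat)
  qed
  have "(\<integral>\<^sup>+x. min (F x) (of_nat k) \<partial>M) * (\<integral>\<^sup>+x. min (G x) (of_nat l) \<partial>M') \<le> C" for k l :: nat
  proof -
    let ?m = "max 1 (max k l)"
    have "(\<integral>\<^sup>+x. min (F x) (of_nat k) \<partial>M) * (\<integral>\<^sup>+x. min (G x) (of_nat l) \<partial>M')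
       \<le> (\<integral>\<^sup>+x. min (F x) (of_nat ?m) \<partial>M) * (\<integral>\<^sup>+x. min (G x) (of_nat ?m) \<partial>M')"
      by (intro mult_mono nn_integral_mono min.mono) auto
    also have "\<dots> \<le> C" by (rule le) auto
    finally show ?thesis .
  qed
  then show ?thesis
    unfolding sup[OF assms(1)] sup[OF assms(2)] SUP_mult_left_ennreal SUP_mult_right_ennreal
    by (intro SUP_least)
qed

context log_sobolev_measure
begin

lemma property_tau: "property_tau \<nu> (\<lambda>x y. 1 / (4 * s) * (x - y)\<^sup>2)"
  unfolding property_tau_def
proof (intro allI impI)
  fix F G :: "real \<Rightarrow> ennreal"
  assume F [measurable]: "F \<in> borel_measurable \<nu>" and G [measurable]: "G \<in> borel_measurable \<nu>"
    and FG: "\<forall>x\<in>space \<nu>. \<forall>y\<in>space \<nu>. F x * G y \<le> ennreal (exp (1 / (4 * s) * (x - y)\<^sup>2))"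
  have sp: "space \<nu> = UNIV" using sets_eq_imp_space_eq[OF borel] by simp
  show "(\<integral>\<^sup>+x. F x \<partial>\<nu>) * (\<integral>\<^sup>+x. G x \<partial>\<nu>) \<le> 1"
  proof (rule nn_integral_mult_le_truncation[OF F G])
    fix k :: nat assume k: "k \<ge> 1"
    (* The truncation of G from below at 1/k is harmless: there the product with the truncated F is at most 1. *)
    define r where "r y = enn2real (max (min (G y) (of_nat k)) (ennreal (1 / real k)))" for y
    have kk: "ennreal (real k) = of_nat k" by (simp add: ennreal_of_nat_eq_real_of_nat)
    have r: "ennreal (r y) = max (min (G y) (of_nat k)) (ennreal (1 / real k))" for y
      unfolding r_def by (rule ennreal_enn2real) (unfold max_less_iff_conj min_less_iff_disj, simp add: of_nat_less_top)
    have k1: "1 / real k \<le> real k" 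
    proof -
      have "1 / real k \<le> 1" "1 \<le> real k" using k by auto
      then show ?thesis by linarith
    qed
    have r_lower: "1 / real k \<le> r y" for y
    proof -
      have "ennreal (1 / real k) \<le> ennreal (r y)" by (simp add: r)
      then show ?thesis by (subst (asm) ennreal_le_iff) (auto simp: r_def)
    qed
    have r_upper: "r y \<le> real k" for y
    proof -
      have "ennreal (r y) \<le> ennreal (real k)" using k1 by (simp add: r kk[symmetric] ennreal_leI)
      then show ?thesis by (subst (asm) ennreal_le_iff) auto
    qed
    have "0 < 1 / real k" using k by simp
    then have r_pos: "0 < r y" for y using r_lower[of y] by linarith
    have lnr: "\<bar>- ln (r y)\<bar> \<le> ln (real k)" for y
    proof -
      have "ln (1 / real k) \<le> ln (r y)" using r_lower[of y] r_pos[of y] k by (subst ln_le_cancel_iff) auto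
      moreover have "ln (r y) \<le> ln (real k)" using r_upper[of y] r_pos[of y] k by (subst ln_le_cancel_iff) auto
      ultimately show ?thesis using k by (simp add: ln_div abs_le_iff)
    qed
    have Fr: "min (F x) (of_nat k) \<le> ennreal (exp (- ln (r y) + (x - y)\<^sup>2 / (4 * s)))" for x y
    proof -
      define d where "d = (x - y)\<^sup>2 / (4 * s)"
      have d: "0 \<le> d" using s by (simp add: d_def)
      have "min (F x) (of_nat k) * ennreal (r y) \<le> ennreal (exp d)"
      proof (cases "min (G y) (of_nat k) \<le> ennreal (1 / real k)")
        case True
        then have "min (F x) (of_nat k) * ennreal (r y) \<le> ennreal (real k) * ennreal (1 / real k)"
          by (intro mult_mono) (auto simp: r kk)
        also have "\<dots> = 1" using k by (simp add: ennreal_mult[symmetric])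
        also have "1 \<le> ennreal (exp d)" using d by simp
        finally show ?thesis .
      next
        case False
        then have "ennreal (r y) = min (G y) (of_nat k)" by (simp add: r max_def)
        then have "min (F x) (of_nat k) * ennreal (r y) \<le> F x * G y"
          by (intro mult_mono) auto
        also have "\<dots> \<le> ennreal (exp d)" using FG by (simp add: sp d_def)
        finally show ?thesis .
      qed
      then have "min (F x) (of_nat k) * ennreal (r y) * ennreal (1 / r y) \<le> ennreal (exp d) * ennreal (1 / r y)"
        by (rule mult_right_mono) simp
      moreover have "ennreal (r y) * ennreal (1 / r y) = 1" using r_pos[of y] by (simp add: ennreal_mult[symmetric])
      moreover have "ennreal (exp d) * ennreal (1 / r y) = ennreal (exp (- ln (r y) + d))"
        using r_pos[of y] by (simp add: ennreal_mult[symmetric] exp_diff)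
      ultimately show ?thesis by (simp add: mult.assoc d_def)
    qed
    have "(\<integral>\<^sup>+x. min (F x) (of_nat k) \<partial>\<nu>) * (\<integral>\<^sup>+x. min (G x) (of_nat k) \<partial>\<nu>)
      \<le> (\<integral>\<^sup>+x. min (F x) (of_nat k) \<partial>\<nu>) * (\<integral>\<^sup>+y. ennreal (exp (- (- ln (r y)))) \<partial>\<nu>)"
      using r_pos by (intro mult_left_mono nn_integral_mono) (auto simp: r)
    also have "\<dots> \<le> 1" by (rule property_tau_bounded[OF lnr Fr])
    finally show "(\<integral>\<^sup>+x. min (F x) (of_nat k) \<partial>\<nu>) * (\<integral>\<^sup>+x. min (G x) (of_nat k) \<partial>\<nu>) \<le> 1" .
  qed
qed

end

section \<open>Spectral theorem and the Hoffman-Wielandt inequality\<close>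

definition dot :: "nat \<Rightarrow> (nat \<Rightarrow> real) \<Rightarrow> (nat \<Rightarrow> real) \<Rightarrow> real" where
  "dot n x y = (\<Sum>m<n. x m * y m)"

definition bilin :: "nat \<Rightarrow> (nat \<Rightarrow> nat \<Rightarrow> real) \<Rightarrow> (nat \<Rightarrow> real) \<Rightarrow> (nat \<Rightarrow> real) \<Rightarrow> real" where
  "bilin n A x y = (\<Sum>m<n. \<Sum>l<n. x m * A m l * y l)"

text \<open>
  The \<open>i\<close>-th vector of the family is \<open>u i\<close>, and only its first \<open>n\<close> coordinates matter. Functions on the natural
  numbers are used for the vectors so that families of any size \<open>n\<close> live in one topological space.
\<close>
definition orthonormal :: "nat \<Rightarrow> (nat \<Rightarrow> nat \<Rightarrow> real) \<Rightarrow> bool" where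
  "orthonormal n u \<longleftrightarrow> (\<forall>i<n. \<forall>j<n. dot n (u i) (u j) = (if i = j then 1 else 0))"

lemma dot_commute: "dot n x y = dot n y x"
  by (simp add: dot_def mult.commute)

lemma dot_comb:
  "dot n (\<lambda>m. a * x m + b * y m) (\<lambda>m. c * z m + d * w m)
     = a * c * dot n x z + a * d * dot n x w + b * c * dot n y z + b * d * dot n y w"
  by (simp add: dot_def sum_distrib_left sum.distrib[symmetric] algebra_simps)

lemma bilin_comb:
  "bilin n A (\<lambda>m. a * x m + b * y m) (\<lambda>m. c * z m + d * w m)
     = a * c * bilin n A x z + a * d * bilin n A x w + b * c * bilin n A y z + b * d * bilin n A y w"
  by (simp add: bilin_def sum_distrib_left sum.distrib[symmetric] algebra_simps)

lemma bilin_commute: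
  assumes "\<And>m l. m < n \<Longrightarrow> l < n \<Longrightarrow> A m l = A l m"
  shows "bilin n A x y = bilin n A y x"
  unfolding bilin_def by (subst sum.swap) (auto intro!: sum.cong simp: assms)

lemma quadratic_nonpos_imp_zero:
  fixes P Q :: real
  assumes "\<And>t. t\<^sup>2 * Q + 2 * t * P \<le> 0"
  shows "P = 0"
proof (rule ccontr)
  assume P: "P \<noteq> 0"
  define q where "q = \<bar>Q\<bar> + 1"
  have q: "q > 0" "- Q \<le> q" by (auto simp: q_def)
  have "P\<^sup>2 / q = (P / q)\<^sup>2 * (- q) + 2 * (P / q) * P" using q by (simp add: field_simps power2_eq_square)
  also have "\<dots> \<le> (P / q)\<^sup>2 * Q + 2 * (P / q) * P" using q by (intro add_right_mono mult_left_mono) auto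
  also have "\<dots> \<le> 0" by (rule assms)
  finally show False using P q by (simp add: divide_le_0_iff)
qed

lemma compact_orthonormal_families:
  "compact {U :: nat \<times> nat \<Rightarrow> real. orthonormal n (curry U) \<and> (\<forall>i m. \<not> (i < n \<and> m < n) \<longrightarrow> U (i, m) = 0)}"
  (is "compact ?S")
proof -
  let ?P = "PiE UNIV (\<lambda>_. {-1..1::real}) :: (nat \<times> nat \<Rightarrow> real) set"
  have "compactin (product_topology (\<lambda>_. euclidean) UNIV) ?P"
    by (subst compactin_PiE) auto
  then have P: "compact ?P" by (simp add: euclidean_product_topology)
  have coord: "continuous_on UNIV (\<lambda>U :: nat \<times> nat \<Rightarrow> real. U p)" for p by simp
  have "closed ?S"
    unfolding orthonormal_def dot_def curry_def
    by (intro closed_Collect_conj closed_Collect_all closed_Collect_imp closed_Collect_eq continuous_intros coord) auto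
  moreover have "?S \<subseteq> ?P"
  proof
    fix U assume U: "U \<in> ?S"
    have b: "\<bar>U (i, m)\<bar> \<le> 1" for i m
    proof (cases "i < n \<and> m < n")
      case True
      have "(U (i, m))\<^sup>2 \<le> (\<Sum>m<n. (U (i, m))\<^sup>2)" using True by (intro member_le_sum) auto
      also have "\<dots> = 1" using U True by (simp add: orthonormal_def dot_def power2_eq_square)
      finally show ?thesis by (simp add: abs_square_le_1)
    next
      case False
      then show ?thesis using U by auto
    qed
    have "U p \<in> {-1..1}" for p
      using b[of "fst p" "snd p"] by (simp add: abs_le_iff)
    then show "U \<in> ?P" by auto
  qed
  ultimately have "compact (?P \<inter> ?S)" using P compact_Int_closed by blast
  then show ?thesis using \<open>?S \<subseteq> ?P\<close> by (simp add: Int_absorb1)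
qed

text \<open>
  Maximize \<open>\<Sum>k. k * \<langle>u k, A u k\<rangle>\<close> over the compact set of orthonormal families. Rotating \<open>u i\<close> and \<open>u j\<close> in
  their plane must not increase the sum. For small angles this forces \<open>\<langle>u i, A u j\<rangle> = 0\<close>; a rotation by a right
  angle exchanges the two vectors and forces the diagonal values to be sorted, because the weights increase.
\<close>
theorem sorted_orthonormal_eigenbasis:
  assumes sym: "\<And>m l. m < n \<Longrightarrow> l < n \<Longrightarrow> A m l = A l m"
  obtains u where "orthonormal n u"
    "\<And>i j. i < n \<Longrightarrow> j < n \<Longrightarrow> i \<noteq> j \<Longrightarrow> bilin n A (u i) (u j) = 0"
    "\<And>i j. i \<le> j \<Longrightarrow> j < n \<Longrightarrow> bilin n A (u i) (u i) \<le> bilin n A (u j) (u j)"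
proof -
  define S where "S = {U :: nat \<times> nat \<Rightarrow> real. orthonormal n (curry U) \<and> (\<forall>i m. \<not> (i < n \<and> m < n) \<longrightarrow> U (i, m) = 0)}"
  define \<Phi> where "\<Phi> U = (\<Sum>k<n. real k * bilin n A (curry U k) (curry U k))" for U :: "nat \<times> nat \<Rightarrow> real"
  have "compact S" unfolding S_def by (rule compact_orthonormal_families)
  moreover have "S \<noteq> {}"
  proof -
    have "(\<lambda>(i, m). if i = m \<and> i < n then 1 else 0) \<in> S"
      by (auto simp: S_def orthonormal_def dot_def curry_def if_distrib[of "\<lambda>x. x * _"] cong: if_cong)
    then show ?thesis by blast
  qed
  moreover have "continuous_on S \<Phi>"
  proof -
    have coord: "continuous_on S (\<lambda>U :: nat \<times> nat \<Rightarrow> real. U p)" for p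
      by (rule continuous_on_subset[OF continuous_on_product_coordinates]) auto
    show ?thesis unfolding \<Phi>_def bilin_def curry_def by (intro continuous_intros coord)
  qed
  ultimately obtain U where U: "U \<in> S" and max: "\<And>V. V \<in> S \<Longrightarrow> \<Phi> V \<le> \<Phi> U"
    using continuous_attains_sup[of S \<Phi>] by blast
  define u where "u = curry U"
  have on: "orthonormal n u" using U by (simp add: S_def u_def)
  have rot: "(real i - real j) * (s\<^sup>2 * (bilin n A (u j) (u j) - bilin n A (u i) (u i)) + 2 * c * s * bilin n A (u i) (u j)) \<le> 0"
    if ij: "i < n" "j < n" "i \<noteq> j" and cs: "c\<^sup>2 + s\<^sup>2 = 1" for i j c s
  proof -
    define v where "v k = (if k = i then (\<lambda>m. c * u i m + s * u j m)
        else if k = j then (\<lambda>m. (- s) * u i m + c * u j m) else u k)" for k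
    have com: "bilin n A (u j) (u i) = bilin n A (u i) (u j)" by (rule bilin_commute[OF sym])
    have dots: "dot n (u k) (u l) = (if k = l then 1 else 0)" if "k < n" "l < n" for k l
      using on that by (auto simp: orthonormal_def)
    have vi: "v i = (\<lambda>m. c * u i m + s * u j m)" and vj: "v j = (\<lambda>m. (- s) * u i m + c * u j m)"
      and vk: "k \<noteq> i \<Longrightarrow> k \<noteq> j \<Longrightarrow> v k = u k" for k
      using ij by (auto simp: v_def)
    have vk': "v k = (\<lambda>m. 1 * u k m + 0 * u k m)" if "k \<noteq> i" "k \<noteq> j" for k
      using vk[OF that] by simp
    have "dot n (v k) (v l) = (if k = l then 1 else 0)" if "k < n" "l < n" for k l
    proof -
      consider "k = i" "l = i" | "k = i" "l = j" | "k = j" "l = i" | "k = j" "l = j"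
        | "k = i" "l \<noteq> i" "l \<noteq> j" | "k = j" "l \<noteq> i" "l \<noteq> j" | "k \<noteq> i" "k \<noteq> j" "l = i" | "k \<noteq> i" "k \<noteq> j" "l = j"
        | "k \<noteq> i" "k \<noteq> j" "l \<noteq> i" "l \<noteq> j" by blast
      then show ?thesis
        by cases (use ij cs that in \<open>simp_all only: vi vj vk' dot_comb not_False_eq_True, simp_all add: dots power2_eq_square\<close>)
    qed
    then have "orthonormal n v" by (simp add: orthonormal_def)
    moreover have "\<not> (k < n \<and> m < n) \<Longrightarrow> v k m = 0" for k m
      using U ij by (auto simp: v_def S_def u_def)
    ultimately have "(\<lambda>(k, m). v k m) \<in> S" by (auto simp: S_def curry_def)
    then have "\<Phi> (\<lambda>(k, m). v k m) \<le> \<Phi> U" by (rule max)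
    then have "(\<Sum>k<n. real k * (bilin n A (v k) (v k) - bilin n A (u k) (u k))) \<le> 0"
      by (simp add: \<Phi>_def u_def curry_def right_diff_distrib sum_subtractf)
    also have "(\<Sum>k<n. real k * (bilin n A (v k) (v k) - bilin n A (u k) (u k)))
        = (\<Sum>k\<in>{i, j}. real k * (bilin n A (v k) (v k) - bilin n A (u k) (u k)))"
      by (rule sum.mono_neutral_right) (use ij vk in auto)
    also have "\<dots> = real i * (bilin n A (v i) (v i) - bilin n A (u i) (u i)) + real j * (bilin n A (v j) (v j) - bilin n A (u j) (u j))"
      using ij by simp
    also have "bilin n A (v i) (v i) = c\<^sup>2 * bilin n A (u i) (u i) + 2 * c * s * bilin n A (u i) (u j) + s\<^sup>2 * bilin n A (u j) (u j)"
      unfolding vi bilin_comb com by (simp add: power2_eq_square algebra_simps)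
    also have "bilin n A (v j) (v j) = s\<^sup>2 * bilin n A (u i) (u i) - 2 * c * s * bilin n A (u i) (u j) + c\<^sup>2 * bilin n A (u j) (u j)"
      unfolding vj bilin_comb com by (simp add: power2_eq_square algebra_simps)
    also have "c\<^sup>2 = 1 - s\<^sup>2" using cs by simp
    finally show ?thesis by (simp add: algebra_simps)
  qed
  show thesis
  proof (rule that[OF on])
    fix i j assume ij: "i < n" "j < n" "i \<noteq> j"
    define P where "P = (real i - real j) * bilin n A (u i) (u j)"
    define Q where "Q = (real i - real j) * (bilin n A (u j) (u j) - bilin n A (u i) (u i))"
    have "t\<^sup>2 * Q + 2 * t * P \<le> 0" for t
    proof -
      (* The rotation by the angle with tangent t, scaled so that its effect is a polynomial in t. *)
      define h where "h = sqrt (1 + t\<^sup>2)"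
      have h: "h > 0" "h\<^sup>2 = 1 + t\<^sup>2"
        unfolding h_def by (intro real_sqrt_gt_zero add_pos_nonneg, simp_all)
      have "(1 / h)\<^sup>2 + (t / h)\<^sup>2 = (1 + t\<^sup>2) / h\<^sup>2"
        by (simp add: power_divide add_divide_distrib)
      also have "\<dots> = 1" unfolding h(2)[symmetric] using h(1) by simp
      finally have "(1 / h)\<^sup>2 + (t / h)\<^sup>2 = 1" .
      from rot[OF ij this] have "(t / h)\<^sup>2 * Q + 2 * (1 / h) * (t / h) * P \<le> 0"
        by (simp only: P_def Q_def distrib_left mult.left_commute)
      then have "h\<^sup>2 * ((t / h)\<^sup>2 * Q + 2 * (1 / h) * (t / h) * P) \<le> 0"
        by (intro mult_nonneg_nonpos) auto
      also have "h\<^sup>2 * ((t / h)\<^sup>2 * Q + 2 * (1 / h) * (t / h) * P) = t\<^sup>2 * Q + 2 * t * P"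
        using h(1) by (simp add: power2_eq_square distrib_left)
      finally show ?thesis .
    qed
    then have "P = 0" by (rule quadratic_nonpos_imp_zero)
    then show "bilin n A (u i) (u j) = 0" using ij by (simp add: P_def)
  next
    fix i j assume ij: "i \<le> j" "j < n"
    show "bilin n A (u i) (u i) \<le> bilin n A (u j) (u j)"
    proof (cases "i = j")
      case False
      then have "(real i - real j) * (bilin n A (u j) (u j) - bilin n A (u i) (u i)) \<le> 0"
        using rot[of i j 0 1] ij by simp
      then show ?thesis using ij False by (simp add: mult_le_0_iff)
    qed simp
  qed
qed

text \<open>
  For square matrices a left inverse is a right inverse: orthonormal columns have orthonormal rows.
\<close>
lemma orthonormal_dual:
  assumes "orthonormal n u"
  shows "orthonormal n (\<lambda>m i. u i m)"
proof -
  define Q where "Q = mat n n (\<lambda>(m, i). u i m)"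
  have Q: "Q \<in> carrier_mat n n" by (simp add: Q_def)
  have "transpose_mat Q * Q = 1\<^sub>m n"
  proof (rule eq_matI)
    fix i j assume ij: "i < dim_row (1\<^sub>m n)" "j < dim_col (1\<^sub>m n)"
    then have "(transpose_mat Q * Q) $$ (i, j) = dot n (u i) (u j)"
      by (simp add: Q_def scalar_prod_def dot_def atLeast0LessThan)
    then show "(transpose_mat Q * Q) $$ (i, j) = 1\<^sub>m n $$ (i, j)"
      using assms ij by (simp add: orthonormal_def)
  qed (auto simp: Q_def)
  then have QQ: "Q * transpose_mat Q = 1\<^sub>m n"
    using mat_mult_left_right_inverse[of "transpose_mat Q" n Q] Q by simp
  show ?thesis
    unfolding orthonormal_def
  proof (intro allI impI)
    fix m l assume ml: "m < n" "l < n"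
    have "(Q * transpose_mat Q) $$ (m, l) = dot n (\<lambda>i. u i m) (\<lambda>i. u i l)"
      using ml by (simp add: Q_def scalar_prod_def dot_def atLeast0LessThan)
    then show "dot n (\<lambda>i. u i m) (\<lambda>i. u i l) = (if m = l then 1 else 0)" using ml by (simp add: QQ)
  qed
qed

lemma ordered_eigenvalue_eq_bilin:
  assumes on: "orthonormal n u"
    and off: "\<And>i j. i < n \<Longrightarrow> j < n \<Longrightarrow> i \<noteq> j \<Longrightarrow> bilin n A (u i) (u j) = 0"
    and srt: "\<And>i j. i \<le> j \<Longrightarrow> j < n \<Longrightarrow> bilin n A (u i) (u i) \<le> bilin n A (u j) (u j)"
    and k: "k \<in> {1..n}"
  shows "ordered_eigenvalue (mat n n (\<lambda>(i, j). A i j)) k = bilin n A (u (k - 1)) (u (k - 1))"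
proof -
  define Q where "Q = mat n n (\<lambda>(m, i). u i m)"
  define M where "M = mat n n (\<lambda>(i, j). A i j)"
  define d where "d i = bilin n A (u i) (u i)" for i
  define D where "D = mat n n (\<lambda>(i, j). if i = j then d i else 0)"
  have car: "Q \<in> carrier_mat n n" "M \<in> carrier_mat n n" "D \<in> carrier_mat n n" by (auto simp: Q_def M_def D_def)
  have QQ: "Q * transpose_mat Q = 1\<^sub>m n"
  proof (rule eq_matI)
    fix m l assume ml: "m < dim_row (1\<^sub>m n)" "l < dim_col (1\<^sub>m n)"
    then have "(Q * transpose_mat Q) $$ (m, l) = dot n (\<lambda>i. u i m) (\<lambda>i. u i l)"
      by (simp add: Q_def scalar_prod_def dot_def atLeast0LessThan)
    then show "(Q * transpose_mat Q) $$ (m, l) = 1\<^sub>m n $$ (m, l)"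
      using orthonormal_dual[OF on] ml by (simp add: orthonormal_def)
  qed (auto simp: Q_def)
  then have QQ': "transpose_mat Q * Q = 1\<^sub>m n"
    using mat_mult_left_right_inverse[of Q n "transpose_mat Q"] car by simp
  have "D = transpose_mat Q * M * Q"
  proof (rule eq_matI)
    fix i j assume ij: "i < dim_row (transpose_mat Q * M * Q)" "j < dim_col (transpose_mat Q * M * Q)"
    then have ij': "i < n" "j < n" by (auto simp: Q_def)
    have "(transpose_mat Q * M * Q) $$ (i, j) = (\<Sum>l<n. (\<Sum>m<n. u i m * A m l) * u j l)"
      using ij' by (simp add: Q_def M_def scalar_prod_def atLeast0LessThan)
    also have "\<dots> = bilin n A (u i) (u j)"
      unfolding bilin_def sum_distrib_right by (rule sum.swap)
    finally show "D $$ (i, j) = (transpose_mat Q * M * Q) $$ (i, j)"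
      using off[of i j] ij' by (auto simp: D_def d_def)
  qed (auto simp: D_def Q_def)
  then have "similar_mat D M"
    unfolding similar_mat_def similar_mat_wit_def Let_def
    using car QQ QQ' by (intro exI[of _ "transpose_mat Q"] exI[of _ Q]) auto
  then have "char_poly M = char_poly D" by (rule char_poly_similar[symmetric])
  also have "\<dots> = (\<Prod>a\<leftarrow>diag_mat D. [:- a, 1:])"
    by (rule char_poly_upper_triangular[OF car(3)]) (auto simp: D_def)
  also have "diag_mat D = map d [0..<n]"
    by (auto simp: diag_mat_def D_def)
  finally have "proots (char_poly M) = proots (\<Prod>p\<leftarrow>map (\<lambda>a. [:- a, 1:]) (map d [0..<n]). p)"
    by simp
  also have "\<dots> = (\<Sum>p\<leftarrow>map (\<lambda>a. [:- a, 1:]) (map d [0..<n]). proots p)"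
    by (rule proots_prod_list) auto
  also have "\<dots> = mset (map d [0..<n])"
  proof -
    have "(\<Sum>p\<leftarrow>map (\<lambda>a. [:- a, 1:]) xs. proots p) = mset xs" for xs :: "real list"
      by (induction xs) auto
    then show ?thesis by blast
  qed
  finally have "sorted_list_of_multiset (proots (char_poly M)) = sort (map d [0..<n])"
    by (simp only: sorted_list_of_multiset_mset)
  also have "\<dots> = map d [0..<n]"
    using srt by (intro sorted_sort_id) (auto simp: sorted_iff_nth_mono d_def)
  finally have "ordered_eigenvalue M k = map d [0..<n] ! (k - 1)" by (simp add: ordered_eigenvalue_def)
  moreover have "k - 1 < n" using k by auto
  ultimately show ?thesis by (simp add: M_def d_def)
qed

lemma parseval:
  assumes "orthonormal n u"
  shows "(\<Sum>i<n. (dot n (u i) x)\<^sup>2) = dot n x x"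
proof -
  have "(\<Sum>i<n. (dot n (u i) x)\<^sup>2) = (\<Sum>i<n. \<Sum>m<n. \<Sum>l<n. u i m * x m * (u i l * x l))"
    by (simp add: dot_def power2_eq_square sum_product)
  also have "\<dots> = (\<Sum>m<n. \<Sum>l<n. \<Sum>i<n. u i m * x m * (u i l * x l))"
    by (subst sum.swap) (intro sum.cong refl sum.swap)
  also have "\<dots> = (\<Sum>m<n. \<Sum>l<n. dot n (\<lambda>i. u i m) (\<lambda>i. u i l) * (x m * x l))"
    by (simp add: dot_def sum_distrib_right sum_distrib_left mult_ac)
  also have "\<dots> = (\<Sum>m<n. \<Sum>l<n. if m = l then x m * x l else 0)"
    using orthonormal_dual[OF assms] by (intro sum.cong refl) (auto simp: orthonormal_def)
  also have "\<dots> = dot n x x" by (simp add: dot_def)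
  finally show ?thesis .
qed

lemma bilin_eigenvector:
  assumes on: "orthonormal n u"
    and off: "\<And>i j. i < n \<Longrightarrow> j < n \<Longrightarrow> i \<noteq> j \<Longrightarrow> bilin n A (u i) (u j) = 0"
    and i: "i < n"
  shows "bilin n A (u i) y = bilin n A (u i) (u i) * dot n (u i) y"
proof -
  have y: "y l = (\<Sum>k<n. dot n (u k) y * u k l)" if "l < n" for l
  proof -
    have "(\<Sum>k<n. dot n (u k) y * u k l) = (\<Sum>k<n. \<Sum>m<n. u k m * y m * u k l)"
      by (simp add: dot_def sum_distrib_right)
    also have "\<dots> = (\<Sum>m<n. \<Sum>k<n. u k m * y m * u k l)" by (rule sum.swap)
    also have "\<dots> = (\<Sum>m<n. dot n (\<lambda>k. u k m) (\<lambda>k. u k l) * y m)"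
      unfolding dot_def sum_distrib_right by (intro sum.cong refl) (simp add: mult_ac)
    also have "\<dots> = (\<Sum>m<n. if m = l then y m else 0)"
      using orthonormal_dual[OF on] that by (intro sum.cong refl) (auto simp: orthonormal_def)
    also have "\<dots> = y l" using that by simp
    finally show ?thesis by simp
  qed
  have "bilin n A (u i) y = (\<Sum>m<n. \<Sum>l<n. u i m * A m l * (\<Sum>k<n. dot n (u k) y * u k l))"
    unfolding bilin_def by (intro sum.cong refl) (use y in auto)
  also have "\<dots> = (\<Sum>m<n. \<Sum>l<n. \<Sum>k<n. dot n (u k) y * (u i m * A m l * u k l))"
    by (simp add: sum_distrib_left mult_ac)
  also have "\<dots> = (\<Sum>m<n. \<Sum>k<n. \<Sum>l<n. dot n (u k) y * (u i m * A m l * u k l))"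
    by (intro sum.cong refl sum.swap)
  also have "\<dots> = (\<Sum>k<n. \<Sum>m<n. \<Sum>l<n. dot n (u k) y * (u i m * A m l * u k l))"
    by (rule sum.swap)
  also have "\<dots> = (\<Sum>k<n. dot n (u k) y * bilin n A (u i) (u k))"
    by (simp add: bilin_def sum_distrib_left)
  also have "\<dots> = (\<Sum>k<n. if k = i then dot n (u k) y * bilin n A (u i) (u k) else 0)"
    using off i by (intro sum.cong refl) auto
  also have "\<dots> = dot n (u i) y * bilin n A (u i) (u i)" using i by simp
  finally show ?thesis by simp
qed

lemma frobenius_orthonormal:
  assumes "orthonormal n u" "orthonormal n v"
  shows "(\<Sum>i<n. \<Sum>j<n. (bilin n M (u i) (v j))\<^sup>2) = (\<Sum>m<n. \<Sum>l<n. (M m l)\<^sup>2)"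
proof -
  have "bilin n M (u i) (v j) = dot n (v j) (\<lambda>l. dot n (u i) (\<lambda>m. M m l))" for i j
    unfolding bilin_def dot_def sum_distrib_left by (subst sum.swap) (simp add: mult_ac)
  then have "(\<Sum>i<n. \<Sum>j<n. (bilin n M (u i) (v j))\<^sup>2)
      = (\<Sum>i<n. \<Sum>j<n. (dot n (v j) (\<lambda>l. dot n (u i) (\<lambda>m. M m l)))\<^sup>2)" by simp
  also have "\<dots> = (\<Sum>i<n. \<Sum>l<n. (dot n (u i) (\<lambda>m. M m l))\<^sup>2)"
    by (rule sum.cong[OF refl], subst parseval[OF assms(2)], simp add: dot_def power2_eq_square)
  also have "\<dots> = (\<Sum>l<n. \<Sum>i<n. (dot n (u i) (\<lambda>m. M m l))\<^sup>2)" by (rule sum.swap)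
  also have "\<dots> = (\<Sum>l<n. \<Sum>m<n. (M m l)\<^sup>2)"
    by (simp add: parseval[OF assms(1)]) (simp add: dot_def power2_eq_square)
  also have "\<dots> = (\<Sum>m<n. \<Sum>l<n. (M m l)\<^sup>2)" by (rule sum.swap)
  finally show ?thesis .
qed

text \<open>
  Among all couplings of two sorted lists, the monotone one has the smallest quadratic cost. The functions
  \<open>\<phi>\<close> and \<open>\<psi>\<close> are optimal dual potentials: \<open>a i * b j \<le> \<phi> i + \<psi> j\<close> with equality for \<open>i = j\<close>. Integrating this
  bound against \<open>P\<close> uses only the row and column sums.
\<close>
lemma sum_sq_diff_le_doubly_stochastic:
  fixes a b :: "nat \<Rightarrow> real" and P :: "nat \<Rightarrow> nat \<Rightarrow> real"
  assumes P: "\<And>i j. P i j \<ge> 0"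
    and row: "\<And>i. i < n \<Longrightarrow> (\<Sum>j<n. P i j) = 1" and col: "\<And>j. j < n \<Longrightarrow> (\<Sum>i<n. P i j) = 1"
    and a: "\<And>i j. i \<le> j \<Longrightarrow> j < n \<Longrightarrow> a i \<le> a j" and b: "\<And>i j. i \<le> j \<Longrightarrow> j < n \<Longrightarrow> b i \<le> b j"
  shows "(\<Sum>i<n. (a i - b i)\<^sup>2) \<le> (\<Sum>i<n. \<Sum>j<n. P i j * (a i - b j)\<^sup>2)"
proof -
  define \<psi> where "\<psi> j = (\<Sum>k<j. a k * (b (Suc k) - b k))" for j
  define \<phi> where "\<phi> i = a i * b i - \<psi> i" for i
  have up: "\<psi> i - \<psi> j \<le> a i * (b i - b j)" if "j \<le> i" "i < n" for i j
  proof -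
    have "\<psi> i - \<psi> j = (\<Sum>k=j..<i. a k * (b (Suc k) - b k))"
      unfolding \<psi>_def using sum_diff_nat_ivl[of 0 j i "\<lambda>k. a k * (b (Suc k) - b k)"] that
      by (simp add: atLeast0LessThan)
    also have "\<dots> \<le> (\<Sum>k=j..<i. a i * (b (Suc k) - b k))"
      using that by (intro sum_mono mult_right_mono a) (auto intro!: b)
    also have "\<dots> = a i * (b i - b j)"
      using that by (simp add: sum_distrib_left[symmetric] sum_Suc_diff')
    finally show ?thesis .
  qed
  have dn: "a i * (b j - b i) \<le> \<psi> j - \<psi> i" if "i \<le> j" "j < n" for i j
  proof -
    have "a i * (b j - b i) = (\<Sum>k=i..<j. a i * (b (Suc k) - b k))"
      using that by (simp add: sum_distrib_left[symmetric] sum_Suc_diff')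
    also have "\<dots> \<le> (\<Sum>k=i..<j. a k * (b (Suc k) - b k))"
      using that by (intro sum_mono mult_right_mono a) (auto intro!: b)
    also have "\<dots> = \<psi> j - \<psi> i"
      unfolding \<psi>_def using sum_diff_nat_ivl[of 0 i j "\<lambda>k. a k * (b (Suc k) - b k)"] that
      by (simp add: atLeast0LessThan)
    finally show ?thesis .
  qed
  have dual: "a i * b j \<le> \<phi> i + \<psi> j" if "i < n" "j < n" for i j
    using up[of j i] dn[of i j] that by (cases "j \<le> i") (auto simp: \<phi>_def algebra_simps)
  have "(\<Sum>i<n. \<Sum>j<n. P i j * (a i * b j)) \<le> (\<Sum>i<n. \<Sum>j<n. P i j * (\<phi> i + \<psi> j))"
    using dual P by (intro sum_mono mult_left_mono) auto
  also have "\<dots> = (\<Sum>i<n. \<Sum>j<n. P i j * \<phi> i) + (\<Sum>j<n. \<Sum>i<n. P i j * \<psi> j)"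
    by (subst (2) sum.swap) (simp add: distrib_left sum.distrib)
  also have "\<dots> = (\<Sum>i<n. \<phi> i) + (\<Sum>j<n. \<psi> j)"
    by (simp add: sum_distrib_right[symmetric] row col)
  also have "\<dots> = (\<Sum>i<n. a i * b i)" by (simp add: \<phi>_def sum_subtractf)
  finally have cross: "(\<Sum>i<n. \<Sum>j<n. P i j * (a i * b j)) \<le> (\<Sum>i<n. a i * b i)" .
  have "(\<Sum>i<n. \<Sum>j<n. P i j * (a i - b j)\<^sup>2)
     = (\<Sum>i<n. \<Sum>j<n. P i j * (a i)\<^sup>2) + (\<Sum>i<n. \<Sum>j<n. P i j * (b j)\<^sup>2) - 2 * (\<Sum>i<n. \<Sum>j<n. P i j * (a i * b j))"
    by (simp add: sum_distrib_left sum.distrib[symmetric] sum_subtractf[symmetric] power2_eq_square algebra_simps)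
  also have "(\<Sum>i<n. \<Sum>j<n. P i j * (b j)\<^sup>2) = (\<Sum>j<n. \<Sum>i<n. P i j * (b j)\<^sup>2)" by (rule sum.swap)
  also have "\<dots> = (\<Sum>j<n. (b j)\<^sup>2)" by (simp add: sum_distrib_right[symmetric] col)
  also have "(\<Sum>i<n. \<Sum>j<n. P i j * (a i)\<^sup>2) = (\<Sum>i<n. (a i)\<^sup>2)" by (simp add: sum_distrib_right[symmetric] row)
  finally have "(\<Sum>i<n. \<Sum>j<n. P i j * (a i - b j)\<^sup>2) \<ge> (\<Sum>i<n. (a i)\<^sup>2) + (\<Sum>j<n. (b j)\<^sup>2) - 2 * (\<Sum>i<n. a i * b i)"
    using cross by simp
  also have "(\<Sum>i<n. (a i)\<^sup>2) + (\<Sum>j<n. (b j)\<^sup>2) - 2 * (\<Sum>i<n. a i * b i) = (\<Sum>i<n. (a i - b i)\<^sup>2)"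
    by (simp add: sum_distrib_left sum.distrib[symmetric] sum_subtractf[symmetric] power2_eq_square algebra_simps)
  finally show ?thesis .
qed

text \<open>
  In sorted eigenbases \<open>u\<close> of \<open>A\<close> and \<open>v\<close> of \<open>B\<close> the squared entries of \<open>A - B\<close> are
  \<open>\<langle>u i, v j\<rangle>\<^sup>2 (a i - b j)\<^sup>2\<close>, and the numbers \<open>\<langle>u i, v j\<rangle>\<^sup>2\<close> form a doubly stochastic matrix.
\<close>
theorem hoffman_wielandt:
  assumes A: "\<And>m l. m < n \<Longrightarrow> l < n \<Longrightarrow> A m l = A l m" and B: "\<And>m l. m < n \<Longrightarrow> l < n \<Longrightarrow> B m l = B l m"
  shows "(\<Sum>k=1..n. (ordered_eigenvalue (mat n n (\<lambda>(i, j). A i j)) k - ordered_eigenvalue (mat n n (\<lambda>(i, j). B i j)) k)\<^sup>2)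
       \<le> (\<Sum>m<n. \<Sum>l<n. (A m l - B m l)\<^sup>2)"
proof -
  obtain u where u: "orthonormal n u"
    "\<And>i j. i < n \<Longrightarrow> j < n \<Longrightarrow> i \<noteq> j \<Longrightarrow> bilin n A (u i) (u j) = 0"
    "\<And>i j. i \<le> j \<Longrightarrow> j < n \<Longrightarrow> bilin n A (u i) (u i) \<le> bilin n A (u j) (u j)"
    using sorted_orthonormal_eigenbasis[where n = n and A = A] A by blast
  obtain v where v: "orthonormal n v"
    "\<And>i j. i < n \<Longrightarrow> j < n \<Longrightarrow> i \<noteq> j \<Longrightarrow> bilin n B (v i) (v j) = 0"
    "\<And>i j. i \<le> j \<Longrightarrow> j < n \<Longrightarrow> bilin n B (v i) (v i) \<le> bilin n B (v j) (v j)"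
    using sorted_orthonormal_eigenbasis[where n = n and A = B] B by blast
  define a where "a i = bilin n A (u i) (u i)" for i
  define b where "b i = bilin n B (v i) (v i)" for i
  have "(\<Sum>k=1..n. (ordered_eigenvalue (mat n n (\<lambda>(i, j). A i j)) k - ordered_eigenvalue (mat n n (\<lambda>(i, j). B i j)) k)\<^sup>2)
      = (\<Sum>k=1..n. (a (k - 1) - b (k - 1))\<^sup>2)"
    by (intro sum.cong refl) (simp add: ordered_eigenvalue_eq_bilin[OF u] ordered_eigenvalue_eq_bilin[OF v] a_def b_def)
  also have "\<dots> = (\<Sum>i<n. (a i - b i)\<^sup>2)"
    by (rule sum.reindex_bij_witness[of _ Suc "\<lambda>k. k - 1"]) auto
  also have "\<dots> \<le> (\<Sum>i<n. \<Sum>j<n. (dot n (u i) (v j))\<^sup>2 * (a i - b j)\<^sup>2)"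
  proof (rule sum_sq_diff_le_doubly_stochastic)
    show "(\<Sum>j<n. (dot n (u i) (v j))\<^sup>2) = 1" if "i < n" for i
    proof -
      have "(\<Sum>j<n. (dot n (u i) (v j))\<^sup>2) = (\<Sum>j<n. (dot n (v j) (u i))\<^sup>2)"
        by (intro sum.cong refl arg_cong[where f = "\<lambda>x. x\<^sup>2"] dot_commute)
      then show ?thesis using parseval[OF v(1), of "u i"] u(1) that by (simp add: orthonormal_def)
    qed
    show "(\<Sum>i<n. (dot n (u i) (v j))\<^sup>2) = 1" if "j < n" for j
      using parseval[OF u(1), of "v j"] v(1) that by (simp add: orthonormal_def)
  qed (use u v in \<open>auto simp: a_def b_def\<close>)
  also have "\<dots> = (\<Sum>i<n. \<Sum>j<n. (bilin n (\<lambda>m l. A m l - B m l) (u i) (v j))\<^sup>2)"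
  proof (intro sum.cong refl)
    fix i j assume ij: "i \<in> {..<n}" "j \<in> {..<n}"
    have "bilin n (\<lambda>m l. A m l - B m l) (u i) (v j) = bilin n A (u i) (v j) - bilin n B (u i) (v j)"
      by (simp add: bilin_def sum_subtractf[symmetric] algebra_simps)
    also have "bilin n A (u i) (v j) = a i * dot n (u i) (v j)"
      unfolding a_def by (rule bilin_eigenvector[OF u(1,2)]) (use ij in auto)
    also have "bilin n B (u i) (v j) = bilin n B (v j) (u i)" by (rule bilin_commute[OF B])
    also have "\<dots> = b j * dot n (v j) (u i)"
      unfolding b_def by (rule bilin_eigenvector[OF v(1,2)]) (use ij in auto)
    also have "dot n (v j) (u i) = dot n (u i) (v j)" by (rule dot_commute)
    finally show "(dot n (u i) (v j))\<^sup>2 * (a i - b j)\<^sup>2 = (bilin n (\<lambda>m l. A m l - B m l) (u i) (v j))\<^sup>2"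
      by (simp add: left_diff_distrib[symmetric] power_mult_distrib mult.commute)
  qed
  also have "\<dots> = (\<Sum>m<n. \<Sum>l<n. (A m l - B m l)\<^sup>2)" by (rule frobenius_orthonormal[OF u(1) v(1)])
  finally show ?thesis .
qed

section \<open>Eigenvalues of Wigner matrices\<close>

text \<open>
  A function of one family indexed by pairs, so that its domain contains the product space over
  \<open>upper_indices N\<close>.
\<close>
definition wigner_eigenvalue :: "nat \<Rightarrow> (nat \<times> nat \<Rightarrow> real) \<Rightarrow> nat \<Rightarrow> real" where
  "wigner_eigenvalue N x j = ordered_eigenvalue (wigner_matrix N (\<lambda>j k. x (j, k))) j"

lemma finite_upper_indices: "finite (upper_indices N)"
proof (rule finite_subset)
  show "upper_indices N \<subseteq> {0..N} \<times> {0..N}" by (auto simp: upper_indices_def)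
qed auto

text \<open>
  The map to the upper triangle is injective on the upper triangle and on the strict lower one.
\<close>
lemma sum_symmetrized_le:
  fixes h :: "nat \<times> nat \<Rightarrow> real"
  assumes h: "\<And>p. h p \<ge> 0"
  shows "(\<Sum>m<N. \<Sum>l<N. h (min (Suc m) (Suc l), max (Suc m) (Suc l))) \<le> 2 * (\<Sum>p\<in>upper_indices N. h p)"
proof -
  define \<phi> where "\<phi> = (\<lambda>(m, l). (min (Suc m) (Suc l), max (Suc m) (Suc l)))"
  define U where "U = {(m, l). m < N \<and> l < N \<and> m \<le> l}"
  define L where "L = {(m, l). m < N \<and> l < N \<and> l < m}"
  have fin: "finite U" "finite L"
    by (rule finite_subset[of _ "{..<N} \<times> {..<N}"]; auto simp: U_def L_def)+
  have half: "(\<Sum>p\<in>S. h (\<phi> p)) \<le> (\<Sum>p\<in>upper_indices N. h p)"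
    if inj: "inj_on \<phi> S" and sub: "S \<subseteq> {..<N} \<times> {..<N}" for S
  proof -
    have "(\<Sum>p\<in>S. h (\<phi> p)) = (\<Sum>p\<in>\<phi> ` S. h p)" by (simp add: sum.reindex[OF inj])
    also have "\<dots> \<le> (\<Sum>p\<in>upper_indices N. h p)"
      by (rule sum_mono2) (use finite_upper_indices h sub in \<open>auto simp: \<phi>_def upper_indices_def\<close>)
    finally show ?thesis .
  qed
  have "(\<Sum>m<N. \<Sum>l<N. h (min (Suc m) (Suc l), max (Suc m) (Suc l))) = (\<Sum>p\<in>{..<N} \<times> {..<N}. h (\<phi> p))"
    by (simp add: sum.cartesian_product \<phi>_def case_prod_unfold)
  also have "{..<N} \<times> {..<N} = U \<union> L" by (auto simp: U_def L_def)
  also have "(\<Sum>p\<in>U \<union> L. h (\<phi> p)) = (\<Sum>p\<in>U. h (\<phi> p)) + (\<Sum>p\<in>L. h (\<phi> p))"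
    by (rule sum.union_disjoint) (use fin in \<open>auto simp: U_def L_def\<close>)
  also have "\<dots> \<le> (\<Sum>p\<in>upper_indices N. h p) + (\<Sum>p\<in>upper_indices N. h p)"
    by (intro add_mono half) (auto simp: U_def L_def \<phi>_def inj_on_def)
  finally show ?thesis by simp
qed

lemma wigner_eigenvalue_lipschitz:
  "real N * sq_dist {1..N} (wigner_eigenvalue N x) (wigner_eigenvalue N y) \<le> 2 * sq_dist (upper_indices N) x y"
proof (cases "N = 0")
  case False
  define A where "A x m l = x (min (Suc m) (Suc l), max (Suc m) (Suc l)) / sqrt (real N)"
    for x :: "nat \<times> nat \<Rightarrow> real" and m l
  have wm: "wigner_matrix N (\<lambda>j k. x (j, k)) = mat N N (\<lambda>(i, j). A x i j)" for x
    by (simp add: wigner_matrix_def A_def)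
  have sym: "A x m l = A x l m" for x m l by (simp add: A_def min.commute max.commute)
  have "sq_dist {1..N} (wigner_eigenvalue N x) (wigner_eigenvalue N y) \<le> (\<Sum>m<N. \<Sum>l<N. (A x m l - A y m l)\<^sup>2)"
    unfolding sq_dist_def wigner_eigenvalue_def wm by (rule hoffman_wielandt) (rule sym)+
  then have "real N * sq_dist {1..N} (wigner_eigenvalue N x) (wigner_eigenvalue N y)
      \<le> real N * (\<Sum>m<N. \<Sum>l<N. (A x m l - A y m l)\<^sup>2)"
    by (rule mult_left_mono) simp
  also have "\<dots> = (\<Sum>m<N. \<Sum>l<N. real N * (A x m l - A y m l)\<^sup>2)"
    by (simp add: sum_distrib_left)
  also have "\<dots> = (\<Sum>m<N. \<Sum>l<N. (\<lambda>p. (x p - y p)\<^sup>2) (min (Suc m) (Suc l), max (Suc m) (Suc l)))"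
    using False by (simp add: A_def diff_divide_distrib[symmetric] power_divide)
  also have "\<dots> \<le> 2 * (\<Sum>p\<in>upper_indices N. (x p - y p)\<^sup>2)"
    by (rule sum_symmetrized_le) simp
  finally show ?thesis by (simp add: sq_dist_def)
qed (simp add: sq_dist_def sum_nonneg)

lemma wigner_eigenvalue_diff_le:
  assumes j: "j \<in> {1..N}"
  shows "\<bar>wigner_eigenvalue N x j - wigner_eigenvalue N y j\<bar> \<le> sqrt (2 * sq_dist (upper_indices N) x y)"
proof -
  have "(wigner_eigenvalue N x j - wigner_eigenvalue N y j)\<^sup>2 \<le> sq_dist {1..N} (wigner_eigenvalue N x) (wigner_eigenvalue N y)"
    unfolding sq_dist_def by (rule member_le_sum[OF j]) auto
  also have "\<dots> \<le> real N * sq_dist {1..N} (wigner_eigenvalue N x) (wigner_eigenvalue N y)"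
    using j mult_right_mono[of 1 "real N" "sq_dist {1..N} (wigner_eigenvalue N x) (wigner_eigenvalue N y)"]
    by (simp add: sq_dist_def sum_nonneg)
  also have "\<dots> \<le> 2 * sq_dist (upper_indices N) x y" by (rule wigner_eigenvalue_lipschitz)
  finally show ?thesis by (rule real_le_rsqrt[of "\<bar>_\<bar>", simplified])
qed

text \<open>
  A consequence of the Lipschitz bound, as the two points have distance \<open>0\<close> over \<open>upper_indices N\<close>.
\<close>
lemma wigner_eigenvalue_cong:
  assumes "j \<in> {1..N}" "\<And>p. p \<in> upper_indices N \<Longrightarrow> x p = y p"
  shows "wigner_eigenvalue N x j = wigner_eigenvalue N y j"
proof -
  have "sq_dist (upper_indices N) x y = 0" by (simp add: sq_dist_def assms(2))
  then show ?thesis using wigner_eigenvalue_diff_le[OF assms(1), of x y] by simp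
qed

lemma wigner_eigenvalue_continuous:
  assumes j: "j \<in> {1..N}"
  shows "continuous_on UNIV (\<lambda>x. wigner_eigenvalue N x j)"
proof (rule continuous_at_imp_continuous_on, rule ballI)
  fix x :: "nat \<times> nat \<Rightarrow> real"
  define g where "g y = sqrt (2 * sq_dist (upper_indices N) y x)" for y
  have "continuous_on UNIV g"
    unfolding g_def sq_dist_def by (intro continuous_intros continuous_on_product_coordinates)
  then have "(g \<longlongrightarrow> g x) (at x)" by (simp add: continuous_on_def)
  then have lim: "(g \<longlongrightarrow> 0) (at x)" by (simp add: g_def sq_dist_def)
  have "((\<lambda>y. wigner_eigenvalue N y j - wigner_eigenvalue N x j) \<longlongrightarrow> 0) (at x)"
    by (rule Lim_null_comparison[OF always_eventually lim])
       (auto simp: g_def intro!: wigner_eigenvalue_diff_le[OF j])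
  then show "isCont (\<lambda>x. wigner_eigenvalue N x j) x"
    unfolding isCont_def using LIM_zero_iff by blast
qed

lemma wigner_eigenvalue_measurable:
  assumes j: "j \<in> {1..N}"
  shows "(\<lambda>x. wigner_eigenvalue N x j) \<in> borel_measurable (\<Pi>\<^sub>M p\<in>upper_indices N. borel)"
proof -
  let ?I = "upper_indices N"
  have "(\<lambda>x p. if p \<in> ?I then x p else 0) \<in> (\<Pi>\<^sub>M p\<in>?I. borel) \<rightarrow>\<^sub>M (borel :: (nat \<times> nat \<Rightarrow> real) measure)"
  proof (rule measurable_coordinatewise_then_product)
    fix p :: "nat \<times> nat"
    show "(\<lambda>x. if p \<in> ?I then x p else 0) \<in> (\<Pi>\<^sub>M p\<in>?I. borel) \<rightarrow>\<^sub>M (borel :: real measure)"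
      by (cases "p \<in> ?I") auto
  qed
  from measurable_compose[OF this borel_measurable_continuous_onI[OF wigner_eigenvalue_continuous[OF j]]]
  show ?thesis
    by (rule measurable_cong[THEN iffD1, rotated]) (auto intro!: wigner_eigenvalue_cong[OF j])
qed

text \<open>
  Each entry contributes the cost \<open>(x - y)\<^sup>2 / (4 s)\<close>. By \<open>wigner_eigenvalue_lipschitz\<close> the pushforward
  turns it into \<open>N |x - y|\<^sup>2 / (8 s)\<close>, half of the constant being lost because every off-diagonal entry occurs
  twice in the matrix.
\<close>
theorem wigner_eigenvalue_law_property_tau:
  assumes M: "prob_space M" and N: "N \<ge> 1" and s: "s > 0"
    and indep: "prob_space.indep_vars M (\<lambda>_. borel) (\<lambda>(j, k). \<xi> j k) (upper_indices N)"
    and lsi: "\<forall>(j, k) \<in> upper_indices N. log_sobolev (distr M borel (\<xi> j k)) s"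
  defines "\<mu> \<equiv> wigner_eigenvalue_law N M \<xi>"
  shows "prob_space \<mu>" and "sets \<mu> = sets (\<Pi>\<^sub>M j\<in>{1..N}. borel)"
    and "property_tau \<mu> (\<lambda>x y. 1 / (8 * s) * real N * sq_dist {1..N} x y)"
proof -
  interpret prob_space M by fact
  let ?I = "upper_indices N"
  define X where "X = (\<lambda>(j, k). \<xi> j k)"
  define T where "T x = (\<lambda>j\<in>{1..N}. wigner_eigenvalue N x j)" for x
  (* Outside of the index set any probability measure does; it makes every factor of the product a probability space. *)
  define \<nu> where "\<nu> p = (if p \<in> ?I then distr M borel (X p) else return borel 0)" for p
  have ind: "indep_vars (\<lambda>_. borel) X ?I" using indep by (simp add: X_def)
  then have X [measurable]: "random_variable borel (X p)" if "p \<in> ?I" for p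
    using that by (auto simp: indep_vars_def)
  have XI: "(\<lambda>\<omega>. \<lambda>p\<in>?I. X p \<omega>) \<in> M \<rightarrow>\<^sub>M (\<Pi>\<^sub>M p\<in>?I. borel)"
    by (rule measurable_restrict) (rule X)
  have T: "T \<in> (\<Pi>\<^sub>M p\<in>?I. borel) \<rightarrow>\<^sub>M (\<Pi>\<^sub>M j\<in>{1..N}. borel)"
    unfolding T_def by (rule measurable_restrict) (rule wigner_eigenvalue_measurable)
  have "(1, 1) \<in> ?I" using N by (simp add: upper_indices_def)
  then have "distr M (\<Pi>\<^sub>M p\<in>?I. borel) (\<lambda>\<omega>. \<lambda>p\<in>?I. X p \<omega>) = (\<Pi>\<^sub>M p\<in>?I. distr M borel (X p))"
    using ind X by (subst (asm) indep_vars_iff_distr_eq_PiM') auto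
  also have "\<dots> = PiM ?I \<nu>" by (rule PiM_cong) (auto simp: \<nu>_def)
  finally have joint: "distr M (\<Pi>\<^sub>M p\<in>?I. borel) (\<lambda>\<omega>. \<lambda>p\<in>?I. X p \<omega>) = PiM ?I \<nu>" .
  have sets_\<nu>: "sets (PiM ?I \<nu>) = sets (\<Pi>\<^sub>M p\<in>?I. borel)"
    by (simp add: joint[symmetric])
  have T': "T \<in> PiM ?I \<nu> \<rightarrow>\<^sub>M (\<Pi>\<^sub>M j\<in>{1..N}. borel)"
    using T by (simp add: measurable_cong_sets[OF sets_\<nu> refl])
  have "\<mu> = distr M (\<Pi>\<^sub>M j\<in>{1..N}. borel) (T \<circ> (\<lambda>\<omega>. \<lambda>p\<in>?I. X p \<omega>))"
    unfolding \<mu>_def wigner_eigenvalue_law_def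
  proof (intro arg_cong[where f = "distr M _"] ext)
    fix \<omega> j
    have "ordered_eigenvalue (wigner_matrix N (\<lambda>j k. \<xi> j k \<omega>)) j = wigner_eigenvalue N (\<lambda>p. X p \<omega>) j"
      by (simp add: wigner_eigenvalue_def X_def)
    also have "\<dots> = wigner_eigenvalue N (\<lambda>p\<in>?I. X p \<omega>) j" if "j \<in> {1..N}"
      by (rule wigner_eigenvalue_cong[OF that]) simp
    finally show "(\<lambda>j\<in>{1..N}. ordered_eigenvalue (wigner_matrix N (\<lambda>j k. \<xi> j k \<omega>)) j) j
        = (T \<circ> (\<lambda>\<omega>. \<lambda>p\<in>?I. X p \<omega>)) \<omega> j"
      by (simp add: T_def)
  qed
  also have "\<dots> = distr (PiM ?I \<nu>) (\<Pi>\<^sub>M j\<in>{1..N}. borel) T"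
    unfolding joint[symmetric] by (rule distr_distr[OF T XI, symmetric])
  finally have \<mu>: "\<mu> = distr (PiM ?I \<nu>) (\<Pi>\<^sub>M j\<in>{1..N}. borel) T" .
  have prob_\<nu>: "prob_space (\<nu> p)" for p
    using X by (auto simp: \<nu>_def intro!: prob_space_distr prob_space_return)
  show "prob_space \<mu>" unfolding \<mu> by (rule prob_space.prob_space_distr[OF prob_space_PiM[OF prob_\<nu>] T'])
  show "sets \<mu> = sets (\<Pi>\<^sub>M j\<in>{1..N}. borel)" by (simp add: \<mu>)
  have "property_tau (PiM ?I \<nu>) (\<lambda>x y. 1 / (4 * s) * sq_dist ?I x y)"
  proof (rule property_tau_PiM[OF prob_\<nu> finite_upper_indices])
    fix p assume p: "p \<in> ?I"
    have "log_sobolev (\<nu> p) s" using lsi p by (auto simp: \<nu>_def X_def split: prod.splits)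
    then have "log_sobolev_measure (\<nu> p) s"
      unfolding log_sobolev_measure_def log_sobolev_measure_axioms_def
      using prob_\<nu> s by (auto simp: \<nu>_def)
    then show "property_tau (\<nu> p) (\<lambda>x y. 1 / (4 * s) * (x - y)\<^sup>2)"
      by (rule log_sobolev_measure.property_tau)
  qed
  then show "property_tau \<mu> (\<lambda>x y. 1 / (8 * s) * real N * sq_dist {1..N} x y)"
    unfolding \<mu>
  proof (rule property_tau_distr[OF _ T'])
    fix x y :: "nat \<times> nat \<Rightarrow> real"
    have "sq_dist {1..N} (T x) (T y) = sq_dist {1..N} (wigner_eigenvalue N x) (wigner_eigenvalue N y)"
      by (simp add: sq_dist_def T_def)
    then have "1 / (8 * s) * (real N * sq_dist {1..N} (T x) (T y)) \<le> 1 / (8 * s) * (2 * sq_dist ?I x y)"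
      using s wigner_eigenvalue_lipschitz[of N x y] by (intro mult_left_mono) auto
    then show "1 / (8 * s) * real N * sq_dist {1..N} (T x) (T y) \<le> 1 / (4 * s) * sq_dist ?I x y"
      by simp
  qed
qed

section \<open>The Prekopa-Leindler inequality at midpoints\<close>

lemma emeasure_lborel_affine_vimage:
  fixes A :: "real set"
  assumes A: "A \<in> sets borel" and c: "c \<noteq> 0"
  shows "emeasure lborel A = ennreal \<bar>c\<bar> * emeasure lborel {z. t + c * z \<in> A}"
proof -
  have [measurable]: "A \<in> sets borel" by fact
  have "emeasure lborel A = (\<integral>\<^sup>+x. indicator A x \<partial>lborel)" by simp
  also have "\<dots> = ennreal \<bar>c\<bar> * (\<integral>\<^sup>+z. indicator A (t + c * z) \<partial>lborel)"
    by (rule nn_integral_real_affine[OF _ c]) measurable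
  also have "(\<integral>\<^sup>+z. indicator A (t + c * z) \<partial>lborel) = (\<integral>\<^sup>+z. indicator {z. t + c * z \<in> A} z \<partial>lborel)"
    by (intro nn_integral_cong) (auto simp: indicator_def)
  also have "\<dots> = emeasure lborel {z. t + c * z \<in> A}"
    by (rule nn_integral_indicator) measurable
  finally show ?thesis .
qed

text \<open>
  The summand \<open>T\<close> is carried along because subtracting it from \<open>S\<close> is awkward when measures may be infinite.
\<close>
lemma emeasure_le_cofinal:
  fixes A :: "real set"
  assumes A [measurable]: "A \<in> sets borel" and ne: "A \<noteq> {}"
    and le: "\<And>a. a \<in> A \<Longrightarrow> emeasure lborel (A \<inter> {..a}) + T \<le> S"
  shows "emeasure lborel A + T \<le> S"
proof -
  have bounded: "emeasure lborel A + T \<le> S"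
    if A [measurable]: "A \<in> sets borel" and ne: "A \<noteq> {}" and bdd: "bdd_above A"
      and le: "\<And>a. a \<in> A \<Longrightarrow> emeasure lborel (A \<inter> {..a}) + T \<le> S" for A :: "real set"
  proof (rule ennreal_le_epsilon)
    fix e :: real assume e: "0 < e"
    obtain a where a: "a \<in> A" "Sup A - e < a"
      using less_cSupE[of "Sup A - e" A] ne e by auto
    have "A \<subseteq> (A \<inter> {..a}) \<union> {a..Sup A}" using cSup_upper[OF _ bdd] by force
    then have "emeasure lborel A \<le> emeasure lborel ((A \<inter> {..a}) \<union> {a..Sup A})"
      by (rule emeasure_mono) measurable
    also have "\<dots> \<le> emeasure lborel (A \<inter> {..a}) + emeasure lborel {a..Sup A}"
      by (rule emeasure_subadditive) auto
    also have "emeasure lborel {a..Sup A} \<le> ennreal e"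
      using a cSup_upper[OF a(1) bdd] by (simp add: ennreal_leI)
    finally have "emeasure lborel A + T \<le> (emeasure lborel (A \<inter> {..a}) + ennreal e) + T"
      by (simp add: add_mono)
    also have "\<dots> = (emeasure lborel (A \<inter> {..a}) + T) + ennreal e" by (simp add: add_ac)
    also have "\<dots> \<le> S + ennreal e" using le[OF a(1)] by (rule add_right_mono)
    finally show "emeasure lborel A + T \<le> S + ennreal e" .
  qed
  have "emeasure lborel (A \<inter> {..real n}) + T \<le> S" for n
  proof (cases "A \<inter> {..real n} = {}")
    case True
    obtain a where "a \<in> A" using ne by blast
    have "T \<le> emeasure lborel (A \<inter> {..a}) + T" by simp
    also have "\<dots> \<le> S" by (rule le) fact
    finally show ?thesis using True by simp
  next
    case False
    show ?thesis
    proof (rule bounded[OF _ False])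
      fix a assume a: "a \<in> A \<inter> {..real n}"
      have "emeasure lborel (A \<inter> {..real n} \<inter> {..a}) + T \<le> emeasure lborel (A \<inter> {..a}) + T"
        by (intro add_right_mono emeasure_mono) auto
      also have "\<dots> \<le> S" using a by (intro le) auto
      finally show "emeasure lborel (A \<inter> {..real n} \<inter> {..a}) + T \<le> S" .
    qed auto
  qed
  then have "(SUP n. emeasure lborel (A \<inter> {..real n}) + T) \<le> S" by (rule SUP_least)
  also have "(SUP n. emeasure lborel (A \<inter> {..real n}) + T) = (SUP n. emeasure lborel (A \<inter> {..real n})) + T"
    by (rule ennreal_SUP_add_left) simp
  also have "(SUP n. emeasure lborel (A \<inter> {..real n})) = emeasure lborel (\<Union>n. A \<inter> {..real n})"
    by (rule SUP_emeasure_incseq) (auto simp: incseq_def)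
  also have "(\<Union>n. A \<inter> {..real n}) = A" by (auto intro: real_arch_simple)
  finally show ?thesis .
qed

text \<open>
  Fix \<open>a \<in> A\<close> and \<open>b \<in> B\<close>. Translating the part of \<open>A\<close> below \<open>a\<close> by \<open>b\<close>, and the part of \<open>B\<close> above \<open>b\<close> by \<open>a\<close>,
  gives two subsets of \<open>2 C\<close> that meet at most in \<open>a + b\<close>. Then let \<open>a\<close> increase and \<open>b\<close> decrease.
\<close>
lemma brunn_minkowski_real:
  fixes A B C :: "real set"
  assumes [measurable]: "A \<in> sets borel" "B \<in> sets borel" "C \<in> sets borel"
    and ne: "A \<noteq> {}" "B \<noteq> {}"
    and mid: "\<And>x y. x \<in> A \<Longrightarrow> y \<in> B \<Longrightarrow> (x + y) / 2 \<in> C"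
  shows "emeasure lborel A + emeasure lborel B \<le> 2 * emeasure lborel C"
proof -
  have cut: "emeasure lborel (A \<inter> {..a}) + emeasure lborel (B \<inter> {b..}) \<le> 2 * emeasure lborel C"
    if ab: "a \<in> A" "b \<in> B" for a b
  proof -
    define L where "L = {z. - b + 1 * z \<in> A \<inter> {..a}}"
    define R where "R = {z. - a + 1 * z \<in> B \<inter> {b..}}"
    define D where "D = {z. 0 + 1 / 2 * z \<in> C}"
    have [measurable]: "L \<in> sets borel" "R \<in> sets borel" "D \<in> sets borel"
      unfolding L_def R_def D_def by measurable
    have "emeasure lborel (A \<inter> {..a}) = ennreal \<bar>1\<bar> * emeasure lborel L"
      unfolding L_def by (rule emeasure_lborel_affine_vimage) auto
    then have L: "emeasure lborel (A \<inter> {..a}) = emeasure lborel L" by simp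
    have "emeasure lborel (B \<inter> {b..}) = ennreal \<bar>1\<bar> * emeasure lborel R"
      unfolding R_def by (rule emeasure_lborel_affine_vimage) auto
    also have "\<dots> = emeasure lborel (R - {a + b})"
      by (simp add: emeasure_Diff_null_set finite_imp_null_set_lborel)
    finally have R: "emeasure lborel (B \<inter> {b..}) = emeasure lborel (R - {a + b})" .
    have D: "2 * emeasure lborel C = emeasure lborel D"
    proof -
      have "emeasure lborel C = ennreal \<bar>1 / 2\<bar> * emeasure lborel D"
        unfolding D_def by (rule emeasure_lborel_affine_vimage) auto
      then have "2 * emeasure lborel C = (ennreal 2 * ennreal (1 / 2)) * emeasure lborel D"
        by (simp add: mult.assoc)
      also have "ennreal 2 * ennreal (1 / 2) = ennreal 1" by (subst ennreal_mult[symmetric]) auto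
      finally show ?thesis by simp
    qed
    have "L \<union> (R - {a + b}) \<subseteq> D"
      using ab mid[of _ b] mid[of a] by (auto simp: L_def R_def D_def) (force simp: field_simps)+
    have "emeasure lborel L + emeasure lborel (R - {a + b}) = emeasure lborel (L \<union> (R - {a + b}))"
      by (rule plus_emeasure) (auto simp: L_def R_def)
    also have "\<dots> \<le> emeasure lborel D"
      by (rule emeasure_mono) (fact, measurable)
    finally show ?thesis by (simp add: L R D)
  qed
  define B' where "B' = {z. 0 + (- 1) * z \<in> B}"
  have [measurable]: "B' \<in> sets borel" unfolding B'_def by measurable
  have B'_ne: "B' \<noteq> {}" using ne(2) by (auto simp: B'_def intro: exI[of _ "- _"])
  have "emeasure lborel B = ennreal \<bar>-1\<bar> * emeasure lborel B'"
    unfolding B'_def by (rule emeasure_lborel_affine_vimage) auto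
  then have B': "emeasure lborel B = emeasure lborel B'" by simp
  have "emeasure lborel A + emeasure lborel (B \<inter> {b..}) \<le> 2 * emeasure lborel C" if "b \<in> B" for b
    by (rule emeasure_le_cofinal[OF _ ne(1)]) (use cut that in auto)
  then have *: "emeasure lborel (B' \<inter> {..b}) + emeasure lborel A \<le> 2 * emeasure lborel C" if "b \<in> B'" for b
  proof -
    have "emeasure lborel (B \<inter> {- b..}) = ennreal \<bar>-1\<bar> * emeasure lborel {z. 0 + (- 1) * z \<in> B \<inter> {- b..}}"
      by (rule emeasure_lborel_affine_vimage) auto
    also have "{z. 0 + (- 1) * z \<in> B \<inter> {- b..}} = B' \<inter> {..b}" by (auto simp: B'_def)
    finally have "emeasure lborel (B \<inter> {- b..}) = emeasure lborel (B' \<inter> {..b})" by simp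
    moreover have "- b \<in> B" using that by (simp add: B'_def)
    ultimately show ?thesis
      using \<open>\<And>b. b \<in> B \<Longrightarrow> emeasure lborel A + emeasure lborel (B \<inter> {b..}) \<le> 2 * emeasure lborel C\<close>[of "- b"]
      by (simp add: add.commute)
  qed
  have "emeasure lborel B' + emeasure lborel A \<le> 2 * emeasure lborel C"
    by (rule emeasure_le_cofinal[OF _ B'_ne *]) auto
  then show ?thesis by (simp add: B' add.commute)
qed

text \<open>
  The hypothesis says that midpoints of the level sets of \<open>f\<close> and \<open>g\<close> at height \<open>t\<close> lie in that of \<open>h\<close>. The
  normalization makes the level sets of \<open>f\<close> and \<open>g\<close> nonempty for all \<open>t < 1\<close>, so \<open>brunn_minkowski_real\<close> applies to
  them; integrate over \<open>t\<close>.
\<close>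
lemma prekopa_leindler_normalized:
  fixes f g h :: "real \<Rightarrow> ennreal"
  assumes [measurable]: "f \<in> borel_measurable borel" "g \<in> borel_measurable borel" "h \<in> borel_measurable borel"
    and f: "(SUP x. f x) = 1" and g: "(SUP x. g x) = 1"
    and le: "\<And>x y. f x * g y \<le> (h ((x + y) / 2))\<^sup>2"
  shows "(\<integral>\<^sup>+x. f x \<partial>lborel) + (\<integral>\<^sup>+x. g x \<partial>lborel) \<le> 2 * (\<integral>\<^sup>+x. h x \<partial>lborel)"
proof -
  have layer: "(\<integral>\<^sup>+x. f x \<partial>lborel) = (\<integral>\<^sup>+t. indicator {0<..<1} t * emeasure lborel {x. ennreal t < f x} \<partial>lborel)"
    if [measurable]: "f \<in> borel_measurable borel" and f1: "\<And>x. f x \<le> 1" for f :: "real \<Rightarrow> ennreal"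
  proof -
    have "f x = (\<integral>\<^sup>+t. indicator {0<..<1} t * indicator {x. ennreal t < f x} x \<partial>lborel)" for x
    proof -
      obtain r where r: "f x = ennreal r" "0 \<le> r" "r \<le> 1"
        using f1[of x] by (cases "f x") (auto simp: top_unique)
      have "(\<integral>\<^sup>+t. indicator {0<..<1} t * indicator {x. ennreal t < f x} x \<partial>lborel)
          = (\<integral>\<^sup>+t. indicator {0<..<r} t \<partial>lborel)"
        using r by (intro nn_integral_cong) (auto simp: indicator_def ennreal_less_iff)
      also have "\<dots> = f x" using r by simp
      finally show ?thesis by simp
    qed
    then have "(\<integral>\<^sup>+x. f x \<partial>lborel) = (\<integral>\<^sup>+x. \<integral>\<^sup>+t. indicator {0<..<1} t * indicator {x. ennreal t < f x} x \<partial>lborel \<partial>lborel)"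
      by (rule nn_integral_cong)
    also have "\<dots> = (\<integral>\<^sup>+t. \<integral>\<^sup>+x. indicator {0<..<1} t * indicator {x. ennreal t < f x} x \<partial>lborel \<partial>lborel)"
      by (rule lborel_pair.Fubini') measurable
    also have "\<dots> = (\<integral>\<^sup>+t. indicator {0<..<1} t * emeasure lborel {x. ennreal t < f x} \<partial>lborel)"
      by (simp add: nn_integral_cmult)
    finally show ?thesis .
  qed
  have layer_le: "(\<integral>\<^sup>+t. indicator {0<..<1} t * emeasure lborel {x. ennreal t \<le> h x} \<partial>lborel) \<le> (\<integral>\<^sup>+x. h x \<partial>lborel)"
  proof -
    have "(\<integral>\<^sup>+t. indicator {0<..<1} t * indicator {x. ennreal t \<le> h x} x \<partial>lborel) \<le> h x" for x
    proof (cases "h x")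
      case (real r)
      have "(\<integral>\<^sup>+t. indicator {0<..<1} t * indicator {x. ennreal t \<le> h x} x \<partial>lborel)
          \<le> (\<integral>\<^sup>+t. indicator {0<..r} t \<partial>lborel)"
        using real by (intro nn_integral_mono) (auto simp: indicator_def)
      also have "\<dots> = h x" using real by simp
      finally show ?thesis .
    qed simp
    then have "(\<integral>\<^sup>+x. \<integral>\<^sup>+t. indicator {0<..<1} t * indicator {x. ennreal t \<le> h x} x \<partial>lborel \<partial>lborel) \<le> (\<integral>\<^sup>+x. h x \<partial>lborel)"
      by (rule nn_integral_mono)
    also have "(\<integral>\<^sup>+x. \<integral>\<^sup>+t. indicator {0<..<1} t * indicator {x. ennreal t \<le> h x} x \<partial>lborel \<partial>lborel)
       = (\<integral>\<^sup>+t. \<integral>\<^sup>+x. indicator {0<..<1} t * indicator {x. ennreal t \<le> h x} x \<partial>lborel \<partial>lborel)"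
      by (rule lborel_pair.Fubini') measurable
    also have "\<dots> = (\<integral>\<^sup>+t. indicator {0<..<1} t * emeasure lborel {x. ennreal t \<le> h x} \<partial>lborel)"
      by (simp add: nn_integral_cmult)
    finally show ?thesis .
  qed
  have f1: "f x \<le> 1" for x unfolding f[symmetric] by (rule SUP_upper) simp
  have g1: "g x \<le> 1" for x unfolding g[symmetric] by (rule SUP_upper) simp
  have level_measurable: "(\<lambda>t. indicator {0<..<1} t * emeasure lborel {x. P (ennreal t) (k x)}) \<in> borel_measurable lborel"
    if P: "{p \<in> space (lborel \<Otimes>\<^sub>M lborel). P (ennreal (fst p)) (k (snd p))} \<in> sets (lborel \<Otimes>\<^sub>M (lborel :: real measure))"
    for P and k :: "real \<Rightarrow> ennreal"
  proof (rule borel_measurable_times_ennreal)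
    have "(\<lambda>t. emeasure lborel (Pair t -` {p \<in> space (lborel \<Otimes>\<^sub>M lborel). P (ennreal (fst p)) (k (snd p))})) \<in> borel_measurable (lborel :: real measure)"
      by (rule lborel.measurable_emeasure_Pair[OF P])
    then show "(\<lambda>t. emeasure lborel {x. P (ennreal t) (k x)}) \<in> borel_measurable lborel"
      by (simp add: vimage_def space_pair_measure)
  qed simp
  have "(\<integral>\<^sup>+x. f x \<partial>lborel) + (\<integral>\<^sup>+x. g x \<partial>lborel)
     = (\<integral>\<^sup>+t. indicator {0<..<1} t * (emeasure lborel {x. ennreal t < f x} + emeasure lborel {x. ennreal t < g x}) \<partial>lborel)"
    unfolding layer[OF assms(1) f1] layer[OF assms(2) g1] distrib_left
    by (rule nn_integral_add[symmetric]; rule level_measurable; measurable)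
  also have "\<dots> \<le> (\<integral>\<^sup>+t. 2 * (indicator {0<..<1} t * emeasure lborel {x. ennreal t \<le> h x}) \<partial>lborel)"
  proof (rule nn_integral_mono)
    fix t :: real
    show "indicator {0<..<1} t * (emeasure lborel {x. ennreal t < f x} + emeasure lborel {x. ennreal t < g x})
      \<le> 2 * (indicator {0<..<1} t * emeasure lborel {x. ennreal t \<le> h x})"
    proof (cases "0 < t \<and> t < 1")
      case True
      then have t1: "ennreal t < 1" by (simp add: ennreal_less_iff del: ennreal_1 flip: ennreal_1)
      have "emeasure lborel {x. ennreal t < f x} + emeasure lborel {x. ennreal t < g x} \<le> 2 * emeasure lborel {x. ennreal t \<le> h x}"
      proof (rule brunn_minkowski_real)
        show "{x. ennreal t < f x} \<noteq> {}" using t1 unfolding f[symmetric] less_SUP_iff by auto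
        show "{x. ennreal t < g x} \<noteq> {}" using t1 unfolding g[symmetric] less_SUP_iff by auto
        fix x y assume "x \<in> {x. ennreal t < f x}" "y \<in> {x. ennreal t < g x}"
        then have "ennreal t * ennreal t \<le> f x * g y" by (intro mult_mono) auto
        also have "\<dots> \<le> (h ((x + y) / 2))\<^sup>2" by (rule le)
        finally have sq: "ennreal t * ennreal t \<le> (h ((x + y) / 2))\<^sup>2" .
        have "ennreal t \<le> h ((x + y) / 2)"
        proof (cases "h ((x + y) / 2)")
          case (real r)
          then have "t\<^sup>2 \<le> r\<^sup>2" using sq True by (simp add: ennreal_mult[symmetric] ennreal_power power2_eq_square)
          then show ?thesis using real True by (simp add: power2_le_iff_abs_le ennreal_leI)
        qed simp
        then show "(x + y) / 2 \<in> {x. ennreal t \<le> h x}" by simp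
      qed measurable
      then show ?thesis using True by simp
    qed simp
  qed
  also have "\<dots> = 2 * (\<integral>\<^sup>+t. indicator {0<..<1} t * emeasure lborel {x. ennreal t \<le> h x} \<partial>lborel)"
    by (rule nn_integral_cmult, rule level_measurable, measurable)
  also have "\<dots> \<le> 2 * (\<integral>\<^sup>+x. h x \<partial>lborel)" by (intro mult_left_mono layer_le) simp
  finally show ?thesis .
qed

text \<open>
  Divide \<open>f\<close>, \<open>g\<close> and \<open>h\<close> by \<open>a = sup f\<close>, \<open>b = sup g\<close> and \<open>sqrt (a b)\<close>, and pass from the arithmetic mean of the
  integrals to their geometric mean.
\<close>
lemma prekopa_leindler_bounded:
  fixes f g h :: "real \<Rightarrow> ennreal"
  assumes [measurable]: "f \<in> borel_measurable borel" "g \<in> borel_measurable borel" "h \<in> borel_measurable borel"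
    and f: "\<And>x. f x \<le> ennreal K" and g: "\<And>x. g x \<le> ennreal K"
    and le: "\<And>x y. f x * g y \<le> (h ((x + y) / 2))\<^sup>2"
  shows "(\<integral>\<^sup>+x. f x \<partial>lborel) * (\<integral>\<^sup>+x. g x \<partial>lborel) \<le> (\<integral>\<^sup>+x. h x \<partial>lborel)\<^sup>2"
proof (cases "(SUP x. f x) = 0 \<or> (SUP x. g x) = 0")
  case True
  then have "(\<forall>x. f x = 0) \<or> (\<forall>x. g x = 0)" by (auto simp: SUP_eq_iff bot_ennreal)
  then show ?thesis by auto
next
  case False
  have finite_sup: "\<exists>a>0. (SUP x. f x) = ennreal a"
    if "\<And>x. f x \<le> ennreal K" "(SUP x. f x) \<noteq> 0" for f :: "real \<Rightarrow> ennreal"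
  proof -
    have "(SUP x. f x) \<le> ennreal K" using that by (intro SUP_least)
    then show ?thesis using that(2) by (cases "SUP x. f x") (auto simp: top_unique less_le)
  qed
  obtain a where a: "a > 0" "(SUP x. f x) = ennreal a" using finite_sup[of f, OF f] False by blast
  obtain b where b: "b > 0" "(SUP x. g x) = ennreal b" using finite_sup[of g, OF g] False by blast
  define c where "c = sqrt (a * b)"
  have c: "c > 0" "c\<^sup>2 = a * b" using a b by (auto simp: c_def)
  have "(\<integral>\<^sup>+x. ennreal (1 / a) * f x \<partial>lborel) + (\<integral>\<^sup>+x. ennreal (1 / b) * g x \<partial>lborel)
    \<le> 2 * (\<integral>\<^sup>+x. ennreal (1 / c) * h x \<partial>lborel)"
  proof (rule prekopa_leindler_normalized)
    show "(SUP x. ennreal (1 / a) * f x) = 1"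
      using a by (simp add: SUP_mult_left_ennreal[symmetric] ennreal_mult[symmetric])
    show "(SUP x. ennreal (1 / b) * g x) = 1"
      using b by (simp add: SUP_mult_left_ennreal[symmetric] ennreal_mult[symmetric])
    fix x y
    have "ennreal (1 / a) * f x * (ennreal (1 / b) * g y) = (ennreal (1 / a) * ennreal (1 / b)) * (f x * g y)"
      by (simp add: mult_ac)
    also have "\<dots> \<le> (ennreal (1 / a) * ennreal (1 / b)) * (h ((x + y) / 2))\<^sup>2"
      by (intro mult_left_mono le) simp
    also have "ennreal (1 / a) * ennreal (1 / b) = (ennreal (1 / c))\<^sup>2"
      using a b c by (simp add: ennreal_mult[symmetric] ennreal_power power_divide)
    finally show "ennreal (1 / a) * f x * (ennreal (1 / b) * g y) \<le> (ennreal (1 / c) * h ((x + y) / 2))\<^sup>2"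
      by (simp add: power_mult_distrib)
  qed measurable
  then have *: "ennreal (1 / a) * (\<integral>\<^sup>+x. f x \<partial>lborel) + ennreal (1 / b) * (\<integral>\<^sup>+x. g x \<partial>lborel)
    \<le> 2 * (ennreal (1 / c) * (\<integral>\<^sup>+x. h x \<partial>lborel))"
    by (simp add: nn_integral_cmult)
  show ?thesis
  proof (cases "(\<integral>\<^sup>+x. h x \<partial>lborel)")
    case (real H)
    have rhs: "2 * (ennreal (1 / c) * (\<integral>\<^sup>+x. h x \<partial>lborel)) = ennreal (2 * (1 / c * H))"
      using real c by (simp add: ennreal_mult[symmetric] flip: ennreal_numeral)
    have "ennreal (1 / a) * (\<integral>\<^sup>+x. f x \<partial>lborel) \<le> ennreal (2 * (1 / c * H))"
      using * unfolding rhs by (rule order_trans[rotated]) simp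
    then have "(\<integral>\<^sup>+x. f x \<partial>lborel) \<noteq> \<top>" using a by (auto simp: ennreal_mult_top top_unique)
    then obtain F where F: "(\<integral>\<^sup>+x. f x \<partial>lborel) = ennreal F" "F \<ge> 0"
      by (cases "\<integral>\<^sup>+x. f x \<partial>lborel") auto
    have "ennreal (1 / b) * (\<integral>\<^sup>+x. g x \<partial>lborel) \<le> ennreal (2 * (1 / c * H))"
      using * unfolding rhs by (rule order_trans[rotated]) simp
    then have "(\<integral>\<^sup>+x. g x \<partial>lborel) \<noteq> \<top>" using b by (auto simp: ennreal_mult_top top_unique)
    then obtain G where G: "(\<integral>\<^sup>+x. g x \<partial>lborel) = ennreal G" "G \<ge> 0"
      by (cases "\<integral>\<^sup>+x. g x \<partial>lborel") auto
    have "ennreal (1 / a * F + 1 / b * G) = ennreal (1 / a) * ennreal F + ennreal (1 / b) * ennreal G"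
      using a b F G by (subst ennreal_plus, simp, simp, subst ennreal_mult, simp, simp, subst ennreal_mult, simp_all)
    also have "\<dots> \<le> ennreal (2 * (1 / c * H))" using * unfolding rhs F(1) G(1) .
    finally have "ennreal (1 / a * F + 1 / b * G) \<le> ennreal (2 * (1 / c * H))" .
    then have le2: "1 / a * F + 1 / b * G \<le> 2 * (1 / c * H)"
      using real c by (subst (asm) ennreal_le_iff) auto
    define p q r where "p = 1 / a * F" and "q = 1 / b * G" and "r = 1 / c * H"
    have pq: "p \<ge> 0" "q \<ge> 0" using F G a b by (auto simp: p_def q_def)
    have "(p + q)\<^sup>2 = 4 * (p * q) + (p - q)\<^sup>2" by (simp add: power2_eq_square algebra_simps)
    then have "4 * (p * q) \<le> (p + q)\<^sup>2" by simp
    also have "\<dots> \<le> (2 * r)\<^sup>2" using le2 pq by (intro power_mono) (auto simp: p_def q_def r_def)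
    finally have "p * q \<le> r\<^sup>2" by (simp add: power2_eq_square)
    then have "c\<^sup>2 * (p * q) \<le> c\<^sup>2 * r\<^sup>2" by (rule mult_left_mono) simp
    moreover have "c\<^sup>2 * (p * q) = F * G" unfolding c using a b by (simp add: p_def q_def)
    moreover have "c\<^sup>2 * r\<^sup>2 = H\<^sup>2" using c(1) by (simp add: r_def power_divide)
    ultimately have "F * G \<le> H\<^sup>2" by simp
    then have "ennreal (F * G) \<le> ennreal (H\<^sup>2)" by (rule ennreal_leI)
    then show ?thesis using F G real by (simp add: ennreal_mult ennreal_power[symmetric])
  qed (simp add: power2_eq_square ennreal_top_mult)
qed

lemma prekopa_leindler_real:
  fixes f g h :: "real \<Rightarrow> ennreal"
  assumes [measurable]: "f \<in> borel_measurable borel" "g \<in> borel_measurable borel" "h \<in> borel_measurable borel"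
    and le: "\<And>x y. f x * g y \<le> (h ((x + y) / 2))\<^sup>2"
  shows "(\<integral>\<^sup>+x. f x \<partial>lborel) * (\<integral>\<^sup>+x. g x \<partial>lborel) \<le> (\<integral>\<^sup>+x. h x \<partial>lborel)\<^sup>2"
proof (rule nn_integral_mult_le_truncation)
  fix k :: nat
  show "(\<integral>\<^sup>+x. min (f x) (of_nat k) \<partial>lborel) * (\<integral>\<^sup>+x. min (g x) (of_nat k) \<partial>lborel) \<le> (\<integral>\<^sup>+x. h x \<partial>lborel)\<^sup>2"
  proof (rule prekopa_leindler_bounded)
    show "min (f x) (of_nat k) \<le> ennreal (real k)" "min (g x) (of_nat k) \<le> ennreal (real k)" for x
      unfolding ennreal_of_nat_eq_real_of_nat[symmetric] by (rule min.cobounded2)+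
    fix x y
    have "min (f x) (of_nat k) * min (g y) (of_nat k) \<le> f x * g y" by (intro mult_mono) auto
    also have "\<dots> \<le> (h ((x + y) / 2))\<^sup>2" by (rule le)
    finally show "min (f x) (of_nat k) * min (g y) (of_nat k) \<le> (h ((x + y) / 2))\<^sup>2" .
  qed measurable
qed auto

text \<open>
  Written with squares instead of square roots, since the functions take values in the extended half-line.
\<close>
theorem prekopa_leindler_midpoint:
  fixes f g h :: "('i \<Rightarrow> real) \<Rightarrow> ennreal"
  assumes fin: "finite I"
    and "f \<in> borel_measurable (\<Pi>\<^sub>M i\<in>I. lborel)" "g \<in> borel_measurable (\<Pi>\<^sub>M i\<in>I. lborel)"
      "h \<in> borel_measurable (\<Pi>\<^sub>M i\<in>I. lborel)"
    and "\<And>x y. x \<in> extensional I \<Longrightarrow> y \<in> extensional I \<Longrightarrow> f x * g y \<le> (h (\<lambda>i\<in>I. (x i + y i) / 2))\<^sup>2"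
  shows "(\<integral>\<^sup>+x. f x \<partial>(\<Pi>\<^sub>M i\<in>I. lborel)) * (\<integral>\<^sup>+x. g x \<partial>(\<Pi>\<^sub>M i\<in>I. lborel)) \<le> (\<integral>\<^sup>+x. h x \<partial>(\<Pi>\<^sub>M i\<in>I. lborel))\<^sup>2"
  using assms
proof (induction I arbitrary: f g h rule: finite_induct)
  case empty
  interpret product_sigma_finite "\<lambda>_ :: 'i. lborel :: real measure" ..
  have "(\<lambda>i\<in>{}. (x i + y i) / 2) = (\<lambda>_. undefined)" for x y :: "'i \<Rightarrow> real" by (simp add: restrict_def)
  then show ?case using empty.prems(4)[of "\<lambda>_. undefined" "\<lambda>_. undefined"] by (simp add: nn_integral_empty)
next
  case (insert i I)
  interpret product_sigma_finite "\<lambda>_ :: 'i. lborel :: real measure" ..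
  interpret I: sigma_finite_measure "\<Pi>\<^sub>M i\<in>I. (lborel :: real measure)" by (rule sigma_finite) fact
  note [simp] = insert.hyps
  note [measurable] = insert.prems(1-3)
  define F where "F k a = (\<integral>\<^sup>+x. k (x(i := a)) \<partial>(\<Pi>\<^sub>M i\<in>I. lborel))" for k :: "('i \<Rightarrow> real) \<Rightarrow> ennreal" and a
  have F: "(\<integral>\<^sup>+x. k x \<partial>(\<Pi>\<^sub>M i\<in>insert i I. lborel)) = (\<integral>\<^sup>+a. F k a \<partial>lborel)"
    if "k \<in> borel_measurable (\<Pi>\<^sub>M i\<in>insert i I. lborel)" for k :: "('i \<Rightarrow> real) \<Rightarrow> ennreal"
    using that by (simp add: product_nn_integral_insert_rev F_def)
  have F_meas: "F k \<in> borel_measurable borel" if [measurable]: "k \<in> borel_measurable (\<Pi>\<^sub>M i\<in>insert i I. lborel)"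
    for k :: "('i \<Rightarrow> real) \<Rightarrow> ennreal"
  proof -
    have "F k \<in> borel_measurable lborel" unfolding F_def by measurable
    then show ?thesis by simp
  qed
  have slice: "(\<lambda>x. k (x(i := a))) \<in> borel_measurable (\<Pi>\<^sub>M i\<in>I. lborel)"
    if [measurable]: "k \<in> borel_measurable (\<Pi>\<^sub>M i\<in>insert i I. lborel)" for k :: "('i \<Rightarrow> real) \<Rightarrow> ennreal" and a
    by measurable
  have "F f a * F g b \<le> (F h ((a + b) / 2))\<^sup>2" for a b
    unfolding F_def
  proof (rule insert.IH)
    fix x y :: "'i \<Rightarrow> real" assume xy: "x \<in> extensional I" "y \<in> extensional I"
    have "f (x(i := a)) * g (y(i := b)) \<le> (h (\<lambda>j\<in>insert i I. ((x(i := a)) j + (y(i := b)) j) / 2))\<^sup>2"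
      using xy by (intro insert.prems(4)) (auto simp: extensional_def)
    moreover have "(\<lambda>j\<in>insert i I. ((x(i := a)) j + (y(i := b)) j) / 2) = (\<lambda>j\<in>I. (x j + y j) / 2)(i := (a + b) / 2)"
      by (auto simp: fun_eq_iff)
    ultimately show "f (x(i := a)) * g (y(i := b)) \<le> (h ((\<lambda>j\<in>I. (x j + y j) / 2)(i := (a + b) / 2)))\<^sup>2"
      by simp
  qed (intro slice insert.prems(1-3))+
  then show ?case
    unfolding F[OF insert.prems(1)] F[OF insert.prems(2)] F[OF insert.prems(3)]
    by (intro prekopa_leindler_real F_meas insert.prems)
qed

section \<open>Beta-ensembles\<close>

lemma fun_upd_has_derivative:
  "((\<lambda>t. (x(j := t)) k) has_real_derivative (if k = j then 1 else 0)) (at s)"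
  by (cases "k = j") auto

lemma weyl_chamber_diff_pos:
  assumes "x \<in> weyl_chamber N" "k \<in> {1..N}" "l \<in> {Suc k..N}"
  shows "0 < x l - x k"
  using assms by (auto simp: weyl_chamber_def)

definition kronecker :: "nat \<Rightarrow> nat \<Rightarrow> real" where
  "kronecker j k = (if k = j then 1 else 0)"

definition hamiltonian_gradient :: "(real \<Rightarrow> real) \<Rightarrow> nat \<Rightarrow> nat \<Rightarrow> (nat \<Rightarrow> real) \<Rightarrow> real" where
  "hamiltonian_gradient V N j x =
     1 / 2 * deriv V (x j) - 1 / real N * (\<Sum>k=1..N. \<Sum>l=Suc k..N. (kronecker j l - kronecker j k) / (x l - x k))"

lemma partial_deriv_hamiltonian:
  assumes V: "C2 V" and x: "x \<in> weyl_chamber N" and j: "j \<in> {1..N}"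
  shows "partial_deriv j (hamiltonian V N) x = hamiltonian_gradient V N j x"
proof -
  have coord: "((\<lambda>t. (x(j := t)) k) has_real_derivative kronecker j k) (at (x j))" for k
    unfolding kronecker_def by (rule fun_upd_has_derivative)
  have dV: "((\<lambda>t. V ((x(j := t)) k)) has_real_derivative deriv V (x k) * kronecker j k) (at (x j))" for k
    using DERIV_chain2[OF C2_imp_derivatives(1)[OF V] coord, of k] by simp
  have dln: "((\<lambda>t. ln ((x(j := t)) l - (x(j := t)) k)) has_real_derivative (kronecker j l - kronecker j k) / (x l - x k)) (at (x j))"
    if "k \<in> {1..N}" "l \<in> {Suc k..N}" for k l
  proof -
    have "0 < (x(j := x j)) l - (x(j := x j)) k" using weyl_chamber_diff_pos[OF x that] by simp
    from DERIV_chain2[OF DERIV_ln[OF this] DERIV_diff[OF coord coord]]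
    show ?thesis by (simp add: divide_inverse mult.commute)
  qed
  have "((\<lambda>t. hamiltonian V N (x(j := t))) has_real_derivative
      1 / 2 * (\<Sum>k=1..N. deriv V (x k) * kronecker j k) - 1 / real N * (\<Sum>k=1..N. \<Sum>l=Suc k..N. (kronecker j l - kronecker j k) / (x l - x k))) (at (x j))"
    unfolding hamiltonian_def by (intro DERIV_diff DERIV_cmult DERIV_sum dV dln) auto
  moreover have "(\<Sum>k=1..N. deriv V (x k) * kronecker j k) = deriv V (x j)"
    using j by (simp add: kronecker_def if_distrib[of "\<lambda>z. _ * z"] cong: if_cong)
  ultimately show ?thesis
    unfolding partial_deriv_def hamiltonian_gradient_def by (simp add: DERIV_imp_deriv)
qed

lemma eventually_weyl_chamber:
  assumes x: "x \<in> weyl_chamber N"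
  shows "eventually (\<lambda>t. x(i := t) \<in> weyl_chamber N) (nhds (x i))"
proof -
  have "eventually (\<lambda>t. k < l \<longrightarrow> (x(i := t)) k < (x(i := t)) l) (nhds (x i))"
    if kl: "k \<in> {1..N}" "l \<in> {1..N}" for k l
  proof (cases "k < l")
    case True
    have "isCont (\<lambda>t. (x(i := t)) l - (x(i := t)) k) (x i)"
      by (rule DERIV_isCont[OF DERIV_diff[OF fun_upd_has_derivative fun_upd_has_derivative]])
    then have "((\<lambda>t. (x(i := t)) l - (x(i := t)) k) \<longlongrightarrow> x l - x k) (nhds (x i))"
      unfolding isCont_def by (subst (asm) tendsto_at_iff_tendsto_nhds) simp
    moreover have "0 < x l - x k" using x kl True by (auto simp: weyl_chamber_def)
    ultimately have "eventually (\<lambda>t. 0 < (x(i := t)) l - (x(i := t)) k) (nhds (x i))"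
      by (rule order_tendstoD(1))
    then show ?thesis by eventually_elim auto
  qed simp
  then have "eventually (\<lambda>t. \<forall>k\<in>{1..N}. \<forall>l\<in>{1..N}. k < l \<longrightarrow> (x(i := t)) k < (x(i := t)) l) (nhds (x i))"
    by (intro eventually_ball_finite ballI) auto
  then show ?thesis by (simp add: weyl_chamber_def)
qed

lemma partial_deriv_hamiltonian_twice:
  assumes V: "C2 V" and x: "x \<in> weyl_chamber N" and j: "j \<in> {1..N}"
  shows "partial_deriv i (partial_deriv j (hamiltonian V N)) x =
    1 / 2 * (deriv (deriv V) (x j) * kronecker i j)
     + 1 / real N * (\<Sum>k=1..N. \<Sum>l=Suc k..N. (kronecker j l - kronecker j k) / (x l - x k)\<^sup>2 * (kronecker i l - kronecker i k))"
proof -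
  have coord: "((\<lambda>t. (x(i := t)) k) has_real_derivative kronecker i k) (at (x i))" for k
    unfolding kronecker_def by (rule fun_upd_has_derivative)
  have dV: "((\<lambda>t. deriv V ((x(i := t)) j)) has_real_derivative deriv (deriv V) (x j) * kronecker i j) (at (x i))"
    using DERIV_chain2[OF C2_imp_derivatives(2)[OF V] coord, of j] by simp
  have dq: "((\<lambda>t. (kronecker j l - kronecker j k) / ((x(i := t)) l - (x(i := t)) k)) has_real_derivative
       - ((kronecker j l - kronecker j k) / (x l - x k)\<^sup>2 * (kronecker i l - kronecker i k))) (at (x i))"
    if "k \<in> {1..N}" "l \<in> {Suc k..N}" for k l
  proof -
    have "(x(i := x i)) l - (x(i := x i)) k \<noteq> 0" using weyl_chamber_diff_pos[OF x that] by simp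
    from DERIV_divide[OF DERIV_const[of "kronecker j l - kronecker j k"] DERIV_diff[OF coord coord] this]
    show ?thesis by (simp add: power2_eq_square)
  qed
  have "((\<lambda>t. hamiltonian_gradient V N j (x(i := t))) has_real_derivative
      1 / 2 * (deriv (deriv V) (x j) * kronecker i j)
      - 1 / real N * (\<Sum>k=1..N. \<Sum>l=Suc k..N. - ((kronecker j l - kronecker j k) / (x l - x k)\<^sup>2 * (kronecker i l - kronecker i k)))) (at (x i))"
    unfolding hamiltonian_gradient_def by (intro DERIV_diff DERIV_cmult DERIV_sum dV dq) auto
  then have "deriv (\<lambda>t. hamiltonian_gradient V N j (x(i := t))) (x i) =
      1 / 2 * (deriv (deriv V) (x j) * kronecker i j)
     + 1 / real N * (\<Sum>k=1..N. \<Sum>l=Suc k..N. (kronecker j l - kronecker j k) / (x l - x k)\<^sup>2 * (kronecker i l - kronecker i k))"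
    by (simp add: DERIV_imp_deriv sum_negf)
  moreover have "deriv (\<lambda>t. partial_deriv j (hamiltonian V N) (x(i := t))) (x i)
      = deriv (\<lambda>t. hamiltonian_gradient V N j (x(i := t))) (x i)"
    by (rule deriv_cong_ev[OF eventually_mono[OF eventually_weyl_chamber[OF x]] refl])
       (rule partial_deriv_hamiltonian[OF V _ j])
  ultimately show ?thesis by (simp add: partial_deriv_def[of i])
qed

text \<open>
  The Hessian in the direction \<open>(1, \<dots>, 1)\<close>: every pair term vanishes because it depends on a difference of two
  coordinates.
\<close>
lemma sum_hessian_hamiltonian:
  assumes V: "C2 V" and x: "x \<in> weyl_chamber N"
  shows "(\<Sum>i=1..N. \<Sum>j=1..N. partial_deriv i (partial_deriv j (hamiltonian V N)) x)
    = 1 / 2 * (\<Sum>j=1..N. deriv (deriv V) (x j))"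
proof -
  have kronecker_sum: "(\<Sum>i=1..N. kronecker i k) = 1" if "k \<in> {1..N}" for k
    using that by (simp add: kronecker_def)
  have "(\<Sum>i=1..N. partial_deriv i (partial_deriv j (hamiltonian V N)) x) = 1 / 2 * deriv (deriv V) (x j)"
    if j: "j \<in> {1..N}" for j
  proof -
    define r where "r k l = (kronecker j l - kronecker j k) / (x l - x k)\<^sup>2" for k l
    have "(\<Sum>i=1..N. partial_deriv i (partial_deriv j (hamiltonian V N)) x)
      = (\<Sum>i=1..N. 1 / 2 * (deriv (deriv V) (x j) * kronecker i j))
        + (\<Sum>i=1..N. 1 / real N * (\<Sum>k=1..N. \<Sum>l=Suc k..N. r k l * (kronecker i l - kronecker i k)))"
      by (simp add: partial_deriv_hamiltonian_twice[OF V x j] sum.distrib r_def)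
    also have "(\<Sum>i=1..N. 1 / 2 * (deriv (deriv V) (x j) * kronecker i j)) = 1 / 2 * deriv (deriv V) (x j)"
      using kronecker_sum[OF j] by (simp add: sum_distrib_left[symmetric] sum_divide_distrib[symmetric])
    also have "(\<Sum>i=1..N. 1 / real N * (\<Sum>k=1..N. \<Sum>l=Suc k..N. r k l * (kronecker i l - kronecker i k)))
      = 1 / real N * (\<Sum>k=1..N. \<Sum>i=1..N. \<Sum>l=Suc k..N. r k l * (kronecker i l - kronecker i k))"
      unfolding sum_distrib_left[symmetric] by (subst sum.swap) (rule refl)
    also have "\<dots> = 1 / real N * (\<Sum>k=1..N. \<Sum>l=Suc k..N. r k l * ((\<Sum>i=1..N. kronecker i l) - (\<Sum>i=1..N. kronecker i k)))"
      by (subst sum.swap) (simp add: sum_distrib_left[symmetric] sum_subtractf)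
    also have "(\<Sum>k=1..N. \<Sum>l=Suc k..N. r k l * ((\<Sum>i=1..N. kronecker i l) - (\<Sum>i=1..N. kronecker i k))) = 0"
    proof (intro sum.neutral ballI)
      fix k l assume "k \<in> {1..N}" "l \<in> {Suc k..N}"
      then have kl: "k \<in> {1..N}" "l \<in> {1..N}" by auto
      show "r k l * ((\<Sum>i=1..N. kronecker i l) - (\<Sum>i=1..N. kronecker i k)) = 0" 
        by (simp only: kronecker_sum[OF kl(1)] kronecker_sum[OF kl(2)] diff_self mult_zero_right)
    qed
    finally show ?thesis by simp
  qed
  then show ?thesis
    unfolding sum_distrib_left by (subst sum.swap) (rule sum.cong[OF refl])
qed

text \<open>
  Test the Hessian bound with the vector \<open>(1, \<dots>, 1)\<close> at the configuration \<open>s + e, \<dots>, s + N e\<close> and let \<open>e\<close> tend to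
  \<open>0\<close>. The bound \<open>a\<close> becomes \<open>2 a\<close> because \<open>V\<close> enters the energy with the factor \<open>1/2\<close>.
\<close>
lemma second_deriv_lower_bound:
  assumes V: "C2 V" and N: "N \<ge> 1"
    and hess: "\<forall>x\<in>weyl_chamber N. hessian_ge N (hamiltonian V N) x a"
  shows "deriv (deriv V) s \<ge> 2 * a"
proof -
  have lower: "a * real N \<le> 1 / 2 * (\<Sum>j=1..N. deriv (deriv V) (s + real j * e))" if e: "e > 0" for e
  proof -
    have x: "(\<lambda>j. s + real j * e) \<in> weyl_chamber N" using e by (auto simp: weyl_chamber_def)
    then have "hessian_ge N (hamiltonian V N) (\<lambda>j. s + real j * e) a" using hess by blast
    then have "a * (\<Sum>i=1..N. 1\<^sup>2) \<le> (\<Sum>i=1..N. \<Sum>j=1..N. 1 * partial_deriv i (partial_deriv j (hamiltonian V N)) (\<lambda>j. s + real j * e) * 1)"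
      unfolding hessian_ge_def by (rule allE[where x = "\<lambda>_. 1"]) simp
    then show ?thesis using sum_hessian_hamiltonian[OF V x] by simp
  qed
  define G where "G e = 1 / 2 * (\<Sum>j=1..N. deriv (deriv V) (s + real j * e))" for e
  have "continuous_on UNIV G"
    unfolding G_def
    by (intro continuous_intros continuous_on_compose2[OF C2_imp_derivatives(3)[OF V]]) auto
  then have "isCont G 0" by (simp add: continuous_on_eq_continuous_at)
  then have "(G \<longlongrightarrow> G 0) (at_right 0)"
    unfolding isCont_def by (rule filterlim_mono) (auto simp: at_le)
  moreover have "eventually (\<lambda>e. a * real N \<le> G e) (at_right 0)"
    using lower by (auto simp: eventually_at_right_field G_def intro!: exI[of _ 1])
  ultimately have "a * real N \<le> G 0" by (rule tendsto_lowerbound) simp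
  then have "real N * (2 * a) \<le> real N * deriv (deriv V) s" by (simp add: G_def mult_ac)
  then show ?thesis using N by simp
qed

lemma midpoint_strongly_convex:
  assumes V: "C2 V" and lower: "\<And>s. deriv (deriv V) s \<ge> 2 * a"
  shows "V ((x + y) / 2) \<le> (V x + V y) / 2 - a / 4 * (x - y)\<^sup>2"
proof -
  define g where "g t = V t - a * t\<^sup>2" for t
  have "convex_on UNIV g"
  proof (rule f''_ge0_imp_convex)
    show "DERIV g t :> deriv V t - 2 * a * t" for t
      unfolding g_def by (auto intro!: derivative_eq_intros C2_imp_derivatives(1)[OF V])
    show "DERIV (\<lambda>t. deriv V t - 2 * a * t) t :> deriv (deriv V) t - 2 * a" for t
      by (auto intro!: derivative_eq_intros C2_imp_derivatives(2)[OF V])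
  qed (use lower in auto)
  from convex_onD[OF this, of "1 / 2" x y]
  have "g ((x + y) / 2) \<le> (g x + g y) / 2" by (simp add: add_divide_distrib)
  then show ?thesis by (simp add: g_def power2_eq_square field_simps)
qed

lemma midpoint_ln:
  assumes "0 < u" "0 < (v::real)"
  shows "(ln u + ln v) / 2 \<le> ln ((u + v) / 2)"
proof -
  have "u * v \<le> ((u + v) / 2)\<^sup>2"
    using zero_le_power2[of "u - v"] by (simp add: power2_eq_square field_simps)
  then have "ln (u * v) \<le> ln (((u + v) / 2)\<^sup>2)" using assms by (subst ln_le_cancel_iff) auto
  then show ?thesis using assms by (simp add: ln_mult ln_realpow)
qed

lemma hamiltonian_midpoint:
  assumes V: "C2 V" and lower: "\<And>s. deriv (deriv V) s \<ge> 2 * a"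
    and x: "x \<in> weyl_chamber N" and y: "y \<in> weyl_chamber N"
  shows "hamiltonian V N (\<lambda>i. (x i + y i) / 2)
     \<le> (hamiltonian V N x + hamiltonian V N y) / 2 - a / 8 * sq_dist {1..N} x y"
proof -
  have "(\<Sum>k=1..N. V ((x k + y k) / 2)) \<le> (\<Sum>k=1..N. (V (x k) + V (y k)) / 2 - a / 4 * (x k - y k)\<^sup>2)"
    by (intro sum_mono midpoint_strongly_convex[OF V lower])
  also have "\<dots> = ((\<Sum>k=1..N. V (x k)) + (\<Sum>k=1..N. V (y k))) / 2 - a / 4 * sq_dist {1..N} x y"
    by (simp add: sum_subtractf sum.distrib sum_divide_distrib[symmetric] sum_distrib_left[symmetric] sq_dist_def)
  finally have 1: "(\<Sum>k=1..N. V ((x k + y k) / 2)) \<le> ((\<Sum>k=1..N. V (x k)) + (\<Sum>k=1..N. V (y k))) / 2 - a / 4 * sq_dist {1..N} x y" .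
  let ?L = "\<lambda>x. \<Sum>k=1..N. \<Sum>l=Suc k..N. ln (x l - x k)"
  have "(?L x + ?L y) / 2 = (\<Sum>k=1..N. \<Sum>l=Suc k..N. (ln (x l - x k) + ln (y l - y k)) / 2)"
    by (simp add: sum.distrib sum_divide_distrib[symmetric])
  also have "\<dots> \<le> (\<Sum>k=1..N. \<Sum>l=Suc k..N. ln ((x l + y l) / 2 - (x k + y k) / 2))"
  proof (intro sum_mono)
    fix k l assume kl: "k \<in> {1..N}" "l \<in> {Suc k..N}"
    have "((x l - x k) + (y l - y k)) / 2 = (x l + y l) / 2 - (x k + y k) / 2" by (simp add: field_simps)
    then show "(ln (x l - x k) + ln (y l - y k)) / 2 \<le> ln ((x l + y l) / 2 - (x k + y k) / 2)"
      using midpoint_ln[OF weyl_chamber_diff_pos[OF x kl] weyl_chamber_diff_pos[OF y kl]] by (simp only:)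
  qed
  finally have 2: "1 / real N * ((?L x + ?L y) / 2) \<le> 1 / real N * (\<Sum>k=1..N. \<Sum>l=Suc k..N. ln ((x l + y l) / 2 - (x k + y k) / 2))"
    by (rule mult_left_mono) simp
  have "1 / 2 * Sm - p * Lm \<le> (1 / 2 * Sx - p * Lx + (1 / 2 * Sy - p * Ly)) / 2 - a / 8 * q"
    if "Sm \<le> (Sx + Sy) / 2 - a / 4 * q" "p * ((Lx + Ly) / 2) \<le> p * Lm" for Sm Sx Sy Lm Lx Ly p q :: real
    using that by (simp add: algebra_simps add_divide_distrib diff_divide_distrib)
  from this[OF 1 2] show ?thesis unfolding hamiltonian_def .
qed

lemma weyl_chamber_midpoint:
  assumes "x \<in> weyl_chamber N" "y \<in> weyl_chamber N"
  shows "(\<lambda>i\<in>{1..N}. (x i + y i) / 2) \<in> weyl_chamber N"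
  using assms by (auto simp: weyl_chamber_def intro!: divide_strict_right_mono add_strict_mono)

lemma hamiltonian_restrict: "hamiltonian V N (\<lambda>i\<in>{1..N}. x i) = hamiltonian V N x"
  unfolding hamiltonian_def by (intro arg_cong2[where f = "(-)"] arg_cong2[where f = "(*)"] sum.cong refl) auto

lemma beta_weight_measurable:
  assumes V: "C2 V"
  shows "beta_weight \<beta> V N \<in> borel_measurable (\<Pi>\<^sub>M j\<in>{1..N}. lborel)"
proof -
  let ?M = "\<Pi>\<^sub>M j\<in>{1..N}. (lborel :: real measure)"
  have coord: "(\<lambda>x. x k) \<in> borel_measurable ?M" if "k \<in> {1..N}" for k
    using measurable_component_singleton[OF that, of "\<lambda>_. lborel :: real measure"] by simp
  have "V \<in> borel_measurable borel"
    by (auto intro!: borel_measurable_continuous_onI continuous_at_imp_continuous_on DERIV_isCont C2_imp_derivatives[OF V])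
  then have Vm: "(\<lambda>x. V (x k)) \<in> borel_measurable ?M" if "k \<in> {1..N}" for k
    using coord[OF that] by (rule measurable_compose[rotated])
  have "(\<lambda>x. ln (x l - x k)) \<in> borel_measurable ?M" if "k \<in> {1..N}" "l \<in> {Suc k..N}" for k l
    using that by (intro borel_measurable_ln borel_measurable_diff coord) auto
  then have H: "hamiltonian V N \<in> borel_measurable ?M"
    unfolding hamiltonian_def using Vm
    by (intro borel_measurable_diff borel_measurable_times borel_measurable_const borel_measurable_sum) auto
  have ind: "(\<lambda>x. indicator (weyl_chamber N) x :: real) = (\<lambda>x. \<Prod>k\<in>{1..N}. \<Prod>l\<in>{1..N}. if k < l then indicator {0<..} (x l - x k) else 1)"
  proof
    fix x :: "nat \<Rightarrow> real"
    show "indicator (weyl_chamber N) x = (\<Prod>k\<in>{1..N}. \<Prod>l\<in>{1..N}. if k < l then indicator {0<..} (x l - x k) else 1 :: real)"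
    proof (cases "x \<in> weyl_chamber N")
      case True
      then have "(\<Prod>k\<in>{1..N}. \<Prod>l\<in>{1..N}. if k < l then indicator {0<..} (x l - x k) else 1 :: real) = 1"
        by (intro prod.neutral ballI) (auto simp: weyl_chamber_def)
      then show ?thesis using True by simp
    next
      case False
      then obtain k l where "k \<in> {1..N}" "l \<in> {1..N}" "k < l" "\<not> x k < x l" by (auto simp: weyl_chamber_def)
      then have "(\<Prod>k\<in>{1..N}. \<Prod>l\<in>{1..N}. if k < l then indicator {0<..} (x l - x k) else 1 :: real) = 0"
        by (intro prod_zero bexI[of _ k] bexI[of _ l]) auto
      then show ?thesis using False by simp
    qed
  qed
  have "(\<lambda>x. indicator {0<..} (x l - x k) :: real) \<in> borel_measurable ?M" if "k \<in> {1..N}" "l \<in> {1..N}" for k l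
    by (rule measurable_compose[OF borel_measurable_diff[OF coord coord]]) (use that in auto)
  then have I: "(\<lambda>x. indicator (weyl_chamber N) x :: real) \<in> borel_measurable ?M"
    unfolding ind by (intro borel_measurable_prod) auto
  show ?thesis
    unfolding beta_weight_def using H I by measurable
qed

text \<open>
  The midpoint condition of the Prekopa-Leindler inequality for \<open>F w\<close>, \<open>G w\<close> and \<open>w\<close>, where \<open>w\<close> is the
  unnormalized density: strong convexity of the energy pays for the exponential cost.
\<close>
lemma beta_weight_midpoint:
  assumes \<beta>: "\<beta> > 0" and V: "C2 V" and lower: "\<And>s. deriv (deriv V) s \<ge> 2 * a"
  shows "beta_weight \<beta> V N x * beta_weight \<beta> V N y * ennreal (exp (\<beta> * a / 4 * real N * sq_dist {1..N} x y))
    \<le> (beta_weight \<beta> V N (\<lambda>i\<in>{1..N}. (x i + y i) / 2))\<^sup>2"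
proof (cases "x \<in> weyl_chamber N \<and> y \<in> weyl_chamber N")
  case True
  let ?m = "\<lambda>i\<in>{1..N}. (x i + y i) / 2"
  define b where "b = \<beta> * real N"
  have "2 * b * hamiltonian V N ?m \<le> 2 * b * ((hamiltonian V N x + hamiltonian V N y) / 2 - a / 8 * sq_dist {1..N} x y)"
    unfolding hamiltonian_restrict using \<beta> True
    by (intro mult_left_mono hamiltonian_midpoint[OF V lower]) (auto simp: b_def)
  then have le: "- b * hamiltonian V N x + (- b * hamiltonian V N y) + \<beta> * a / 4 * real N * sq_dist {1..N} x y
     \<le> - b * hamiltonian V N ?m + (- b * hamiltonian V N ?m)"
    by (simp add: b_def algebra_simps)
  have w: "beta_weight \<beta> V N z = ennreal (exp (- b * hamiltonian V N z))" if "z \<in> weyl_chamber N" for z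
    using that by (simp add: beta_weight_def b_def)
  show ?thesis
    using True weyl_chamber_midpoint[of x N y] le
    by (simp only: w power2_eq_square ennreal_mult[symmetric] exp_ge_zero mult_nonneg_nonneg exp_add[symmetric])
       (simp add: ennreal_leI)
qed (auto simp: beta_weight_def)

lemma beta_ensemble_property_tau:
  assumes \<beta>: "\<beta> > 0" and V: "C2 V" and lower: "\<And>s. deriv (deriv V) s \<ge> 2 * a"
    and Z: "beta_partition \<beta> V N \<noteq> 0" "beta_partition \<beta> V N \<noteq> \<top>"
  shows "prob_space (beta_ensemble \<beta> V N)"
    and "property_tau (beta_ensemble \<beta> V N) (\<lambda>x y. \<beta> * a / 4 * real N * sq_dist {1..N} x y)"
proof -
  let ?M = "\<Pi>\<^sub>M j\<in>{1..N}. (lborel :: real measure)"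
  define Z where "Z = beta_partition \<beta> V N"
  define w where "w = beta_weight \<beta> V N"
  have Z0: "Z \<noteq> 0" "Z \<noteq> \<top>" using Z by (auto simp: Z_def)
  have w [measurable]: "w \<in> borel_measurable ?M" unfolding w_def by (rule beta_weight_measurable[OF V])
  have Zw: "(\<integral>\<^sup>+x. w x \<partial>?M) = Z" by (simp add: Z_def w_def beta_partition_def)
  have \<mu>: "beta_ensemble \<beta> V N = density ?M (\<lambda>x. w x / Z)" by (simp add: beta_ensemble_def Z_def w_def)
  have int: "(\<integral>\<^sup>+x. F x \<partial>beta_ensemble \<beta> V N) = (\<integral>\<^sup>+x. w x * F x \<partial>?M) / Z"
    if [measurable]: "F \<in> borel_measurable ?M" for F
  proof -
    have "(\<integral>\<^sup>+x. F x \<partial>beta_ensemble \<beta> V N) = (\<integral>\<^sup>+x. w x / Z * F x \<partial>?M)"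
      unfolding \<mu> by (rule nn_integral_density) measurable
    also have "\<dots> = (\<integral>\<^sup>+x. (w x * F x) / Z \<partial>?M)"
      by (simp add: divide_ennreal_def mult_ac)
    also have "\<dots> = (\<integral>\<^sup>+x. w x * F x \<partial>?M) / Z" by (rule nn_integral_divide) measurable
    finally show ?thesis .
  qed
  show "prob_space (beta_ensemble \<beta> V N)"
  proof (rule prob_spaceI)
    have "emeasure (beta_ensemble \<beta> V N) (space (beta_ensemble \<beta> V N)) = (\<integral>\<^sup>+x. 1 \<partial>beta_ensemble \<beta> V N)"
      by simp
    also have "\<dots> = 1" using Z0 Zw by (subst int) (simp_all add: ennreal_divide_self less_top zero_less_iff_neq_zero)
    finally show "emeasure (beta_ensemble \<beta> V N) (space (beta_ensemble \<beta> V N)) = 1" .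
  qed
  show "property_tau (beta_ensemble \<beta> V N) (\<lambda>x y. \<beta> * a / 4 * real N * sq_dist {1..N} x y)"
    unfolding property_tau_def
  proof (intro allI impI)
    fix F G :: "(nat \<Rightarrow> real) \<Rightarrow> ennreal"
    assume "F \<in> borel_measurable (beta_ensemble \<beta> V N)" "G \<in> borel_measurable (beta_ensemble \<beta> V N)"
    then have FG_meas [measurable]: "F \<in> borel_measurable ?M" "G \<in> borel_measurable ?M" by (simp_all add: \<mu>)
    assume FG: "\<forall>x\<in>space (beta_ensemble \<beta> V N). \<forall>y\<in>space (beta_ensemble \<beta> V N).
        F x * G y \<le> ennreal (exp (\<beta> * a / 4 * real N * sq_dist {1..N} x y))"
    have "(\<integral>\<^sup>+x. w x * F x \<partial>?M) * (\<integral>\<^sup>+x. w x * G x \<partial>?M) \<le> (\<integral>\<^sup>+x. w x \<partial>?M)\<^sup>2"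
    proof (rule prekopa_leindler_midpoint)
      fix x y :: "nat \<Rightarrow> real" assume xy: "x \<in> extensional {1..N}" "y \<in> extensional {1..N}"
      have "w x * F x * (w y * G y) = w x * w y * (F x * G y)" by (simp add: mult_ac)
      also have "\<dots> \<le> w x * w y * ennreal (exp (\<beta> * a / 4 * real N * sq_dist {1..N} x y))"
        using FG xy by (intro mult_left_mono) (auto simp: \<mu> space_PiM PiE_def)
      also have "\<dots> \<le> (w (\<lambda>i\<in>{1..N}. (x i + y i) / 2))\<^sup>2"
        unfolding w_def by (rule beta_weight_midpoint[OF \<beta> V lower])
      finally show "w x * F x * (w y * G y) \<le> (w (\<lambda>i\<in>{1..N}. (x i + y i) / 2))\<^sup>2" .
    qed measurable
    then have "(\<integral>\<^sup>+x. w x * F x \<partial>?M) * (\<integral>\<^sup>+x. w x * G x \<partial>?M) * (inverse Z * inverse Z) \<le> Z\<^sup>2 * (inverse Z * inverse Z)"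
      unfolding Zw by (rule mult_right_mono) simp
    also have "Z\<^sup>2 * (inverse Z * inverse Z) = (Z / Z) * (Z / Z)"
      by (simp add: divide_ennreal_def power2_eq_square mult_ac)
    also have "\<dots> = 1" using Z0 by (simp add: ennreal_divide_self less_top zero_less_iff_neq_zero)
    finally show "(\<integral>\<^sup>+x. F x \<partial>beta_ensemble \<beta> V N) * (\<integral>\<^sup>+x. G x \<partial>beta_ensemble \<beta> V N) \<le> 1"
      unfolding int[OF FG_meas(1)] int[OF FG_meas(2)] by (simp add: divide_ennreal_def mult_ac)
  qed
qed

text \<open>
  If the partition function is \<open>0\<close> or infinite, the normalized density vanishes almost everywhere, as
  \<open>0 / 0 = 0\<close> and \<open>x / \<top> = 0\<close> in the extended half-line, and the measure is zero.
\<close>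
lemma beta_ensemble_degenerate:
  assumes V: "C2 V" and Z: "beta_partition \<beta> V N = 0 \<or> beta_partition \<beta> V N = \<top>"
    and [measurable]: "F \<in> borel_measurable (\<Pi>\<^sub>M j\<in>{1..N}. lborel)"
  shows "(\<integral>\<^sup>+x. F x \<partial>beta_ensemble \<beta> V N) = 0"
proof -
  let ?M = "\<Pi>\<^sub>M j\<in>{1..N}. (lborel :: real measure)"
  have [measurable]: "beta_weight \<beta> V N \<in> borel_measurable ?M" by (rule beta_weight_measurable[OF V])
  have zero: "AE x in ?M. beta_weight \<beta> V N x / beta_partition \<beta> V N = 0"
  proof (cases "beta_partition \<beta> V N = \<top>")
    case False
    then have "(\<integral>\<^sup>+x. beta_weight \<beta> V N x \<partial>?M) = 0" using Z by (simp add: beta_partition_def)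
    then have "AE x in ?M. beta_weight \<beta> V N x = 0" 
      using nn_integral_0_iff_AE[OF beta_weight_measurable[OF V]] by blast
    then show ?thesis by eventually_elim simp
  qed simp
  have "(\<integral>\<^sup>+x. F x \<partial>beta_ensemble \<beta> V N) = (\<integral>\<^sup>+x. beta_weight \<beta> V N x / beta_partition \<beta> V N * F x \<partial>?M)"
    unfolding beta_ensemble_def by (rule nn_integral_density) measurable
  also have "\<dots> = (\<integral>\<^sup>+x. 0 \<partial>?M)"
    by (rule nn_integral_cong_AE) (use zero in eventually_elim, simp)
  finally show ?thesis by simp
qed

lemma lin_stat_tilde_measurable:
  assumes f: "C2 f"
  shows "lin_stat_tilde N \<mu> f \<in> borel_measurable (\<Pi>\<^sub>M j\<in>{1..N}. lborel)"
proof -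
  let ?M = "\<Pi>\<^sub>M j\<in>{1..N}. (lborel :: real measure)"
  have coord: "(\<lambda>x. x k) \<in> borel_measurable ?M" if "k \<in> {1..N}" for k
    using measurable_component_singleton[OF that, of "\<lambda>_. lborel :: real measure"] by simp
  have "f \<in> borel_measurable borel"
    by (auto intro!: borel_measurable_continuous_onI continuous_at_imp_continuous_on DERIV_isCont C2_imp_derivatives[OF f])
  then have fm: "(\<lambda>x. f (x k)) \<in> borel_measurable ?M" if "k \<in> {1..N}" for k
    using coord[OF that] by (rule measurable_compose[rotated])
  show ?thesis
    unfolding lin_stat_tilde_def lin_stat_def using fm coord
    by (intro borel_measurable_diff borel_measurable_sum borel_measurable_times borel_measurable_const) auto
qed

section \<open>The concentration inequality\<close>

theorem proposition8p4:
  fixes \<gamma> :: real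
  assumes "\<gamma> > 0"
  shows
    "(\<forall>\<sigma>>0. \<exists>c>0. \<forall>N\<ge>1. \<forall>(M :: 'w measure) (\<xi> :: nat \<Rightarrow> nat \<Rightarrow> 'w \<Rightarrow> real) (f :: real \<Rightarrow> real) \<mu>.
        prob_space M \<longrightarrow>
        prob_space.indep_vars M (\<lambda>_. borel) (\<lambda>(j, k). \<xi> j k) (upper_indices N) \<longrightarrow>
        (\<forall>(j, k) \<in> upper_indices N. log_sobolev (distr M borel (\<xi> j k)) (\<sigma>\<^sup>2)) \<longrightarrow>
        \<mu> = wigner_eigenvalue_law N M \<xi> \<longrightarrow>
        C2 f \<longrightarrow>
        (\<forall>j\<in>{1..N}. integrable \<mu> (\<lambda>x. deriv f (x j))) \<longrightarrow>
        (\<forall>t. \<bar>deriv (deriv f) t\<bar> \<le> \<gamma>) \<longrightarrow>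
        (\<integral>\<^sup>+x. ennreal (exp (c * sqrt (real N) * \<bar>lin_stat_tilde N \<mu> f x\<bar>)) \<partial>\<mu>) \<le> 2)
     \<and>
     (\<forall>\<beta>>0. \<forall>a>0. \<exists>c>0. \<forall>N\<ge>1. \<forall>(V :: real \<Rightarrow> real) (f :: real \<Rightarrow> real) \<mu>.
        strictly_convex V \<longrightarrow>
        C2 V \<longrightarrow>
        (\<forall>x\<in>weyl_chamber N. hessian_ge N (hamiltonian V N) x a) \<longrightarrow>
        \<mu> = beta_ensemble \<beta> V N \<longrightarrow>
        C2 f \<longrightarrow>
        (\<forall>j\<in>{1..N}. integrable \<mu> (\<lambda>x. deriv f (x j))) \<longrightarrow>
        (\<forall>t. \<bar>deriv (deriv f) t\<bar> \<le> \<gamma>) \<longrightarrow>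
        (\<integral>\<^sup>+x. ennreal (exp (c * sqrt (real N) * \<bar>lin_stat_tilde N \<mu> f x\<bar>)) \<partial>\<mu>) \<le> 2)"
proof (intro conjI allI impI, goal_cases wigner beta)
  case (wigner \<sigma>)
  define \<kappa> where "\<kappa> = 1 / (8 * \<sigma>\<^sup>2)"
  have \<kappa>: "\<kappa> > 0" using wigner by (simp add: \<kappa>_def)
  show ?case
  proof (intro exI[of _ "\<kappa> / (2 * \<gamma>)"] conjI allI impI)
    show "\<kappa> / (2 * \<gamma>) > 0" using \<kappa> assms by simp
  next
    fix N :: nat and M :: "'w measure" and \<xi> :: "nat \<Rightarrow> nat \<Rightarrow> 'w \<Rightarrow> real" and f :: "real \<Rightarrow> real" and \<mu>
    assume N: "N \<ge> 1" and M: "prob_space M"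
      and ind: "prob_space.indep_vars M (\<lambda>_. borel) (\<lambda>(j, k). \<xi> j k) (upper_indices N)"
      and lsi: "\<forall>(j, k) \<in> upper_indices N. log_sobolev (distr M borel (\<xi> j k)) (\<sigma>\<^sup>2)"
      and \<mu>: "\<mu> = wigner_eigenvalue_law N M \<xi>"
      and f: "C2 f" "\<forall>t. \<bar>deriv (deriv f) t\<bar> \<le> \<gamma>"
    have "\<sigma>\<^sup>2 > 0" using wigner by simp
    note law = wigner_eigenvalue_law_property_tau[OF M N this ind lsi, folded \<mu> \<kappa>_def]
    show "(\<integral>\<^sup>+x. ennreal (exp (\<kappa> / (2 * \<gamma>) * sqrt (real N) * \<bar>lin_stat_tilde N \<mu> f x\<bar>)) \<partial>\<mu>) \<le> 2"
      by (rule second_order_concentration[OF N \<kappa> assms law f(1)]) (use f(2) in blast)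
  qed
next
  case (beta \<beta> a)
  define \<kappa> where "\<kappa> = \<beta> * a / 4"
  have \<kappa>: "\<kappa> > 0" using beta by (simp add: \<kappa>_def)
  show ?case
  proof (intro exI[of _ "\<kappa> / (2 * \<gamma>)"] conjI allI impI)
    show "\<kappa> / (2 * \<gamma>) > 0" using \<kappa> assms by simp
  next
    fix N :: nat and V f :: "real \<Rightarrow> real" and \<mu>
    assume N: "N \<ge> 1" and V: "C2 V"
      and hess: "\<forall>x\<in>weyl_chamber N. hessian_ge N (hamiltonian V N) x a"
      and \<mu>: "\<mu> = beta_ensemble \<beta> V N"
      and f: "C2 f" "\<forall>t. \<bar>deriv (deriv f) t\<bar> \<le> \<gamma>"
    have lower: "deriv (deriv V) s \<ge> 2 * a" for s by (rule second_deriv_lower_bound[OF V N hess])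
    show "(\<integral>\<^sup>+x. ennreal (exp (\<kappa> / (2 * \<gamma>) * sqrt (real N) * \<bar>lin_stat_tilde N \<mu> f x\<bar>)) \<partial>\<mu>) \<le> 2"
    proof (cases "beta_partition \<beta> V N = 0 \<or> beta_partition \<beta> V N = \<top>")
      case True
      have "(\<integral>\<^sup>+x. ennreal (exp (\<kappa> / (2 * \<gamma>) * sqrt (real N) * \<bar>lin_stat_tilde N \<mu> f x\<bar>)) \<partial>\<mu>) = 0"
        unfolding \<mu>
      proof (rule beta_ensemble_degenerate[OF V True])
        have [measurable]: "lin_stat_tilde N (beta_ensemble \<beta> V N) f \<in> borel_measurable (\<Pi>\<^sub>M j\<in>{1..N}. lborel)"
          by (rule lin_stat_tilde_measurable[OF f(1)])
        show "(\<lambda>x. ennreal (exp (\<kappa> / (2 * \<gamma>) * sqrt (real N) * \<bar>lin_stat_tilde N (beta_ensemble \<beta> V N) f x\<bar>)))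
            \<in> borel_measurable (\<Pi>\<^sub>M j\<in>{1..N}. lborel)" by measurable
      qed
      then show ?thesis by simp
    next
      case False
      then have Z: "beta_partition \<beta> V N \<noteq> 0" "beta_partition \<beta> V N \<noteq> \<top>" by auto
      note law = beta_ensemble_property_tau[OF beta(1) V lower Z, folded \<mu> \<kappa>_def]
      have "sets \<mu> = sets (\<Pi>\<^sub>M j\<in>{1..N}. (lborel :: real measure))" by (simp add: \<mu> beta_ensemble_def)
      also have "\<dots> = sets (\<Pi>\<^sub>M j\<in>{1..N}. borel)" by (rule sets_PiM_cong) auto
      finally have sets: "sets \<mu> = sets (\<Pi>\<^sub>M j\<in>{1..N}. borel)" .
      show ?thesis
        by (rule second_order_concentration[OF N \<kappa> assms law(1) sets law(2) f(1)]) (use f(2) in blast)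
    qed
  qed
qed

end
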